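(* Let $(R,\mathfrak{m})$ be a commutative Noetherian local ring that is not Gorenstein, with $\mathfrak{m}^3=0\neq\mathfrak{m}^2$, and suppose that $R$ contains exact zero divisors. If $T$ is a totally reflexive $R$-module that has an upper triangular minimal presentation matrix, then $T$ has an upper triangular minimal complete resolution.
   Context: Let $(R,\mathfrak{m})$ be a commutative Noetherian local ring. Totally reflexive: a finitely generated $R$-module $M$ is totally reflexive if the biduality map $M\to \operatorname{Hom}_R(\operatorname{Hom}_R(M,R),R)$ is an isomorphism and $\operatorname{Ext}_R^i(M,R)=0=\operatorname{Ext}_R^i(\operatorname{Hom}_R(M,R),R)$ for all $i>0$. Exact zero divisor: a non-unit $a\in R$ is an exact zero divisor if there exists $b\in R$ with $(0:a)=(b)$ and $(0:b)=(a)$. Minimal presentation matrix: a minimal presentation matrix of a finitely generated module $M$ with minimal number of generators $n$ is a matrix over $R$ with $n$ rows whose cokernel is isomorphic to $M$ and whose columns form a minimal generating set of the kernel of the corresponding surjection $R^n\to M$. A matrix $(a_{ij})$ is upper triangular if $a_{ij}=0$ whenever $i>j$. Complete resolution: a totally acyclic complex is an acyclic complex $\mathbb{A}$ (indexed by $\mathbb{Z}$) of finitely generated free $R$-modules such that $\operatorname{Hom}_R(\mathbb{A},R)$ is also acyclic; a complete resolution of a totally reflexive module $T$ is a totally acyclic complex $(\mathbb{A},\partial)$ with $T\cong\operatorname{coker}(\partial_1\colon A_1\to A_0)$. A complex $(\mathbb{F},\partial)$ of free modules is minimal if $\operatorname{im}\partial_i\subseteq\mathfrak{m}F_{i-1}$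 for all $i$. Upper triangular complex: a complex of free modules in which every differential can simultaneously (with respect to a choice of one basis for each module of the complex) be represented by a square matrix $(a_{ij})$ with $a_{ij}=0$ when $i>j$.
   Formalization: The upper triangular minimal presentation matrix is required to be square; with rectangular matrices allowed the claim fails, e.g. for T = R (empty matrix), since a module with a nonzero free summand has no minimal complete resolution here. *)

theory Defs
  imports "HOL-Algebra.Algebra"
begin

section \<open>Rings\<close>

definition noetherian_local_ring :: "('a, 'r) ring_scheme \<Rightarrow> 'a set \<Rightarrow> bool" where
  "noetherian_local_ring R m \<longleftrightarrow>
     cring R \<and> noetherian_ring R \<and> maximalideal m R \<and> (\<forall>J. maximalideal J R \<longrightarrow> J = m)"

definition ring_ann :: "('a, 'r) ring_scheme \<Rightarrow> 'a \<Rightarrow> 'a set" where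
  "ring_ann R a = {x \<in> carrier R. x \<otimes>\<^bsub>R\<^esub> a = \<zero>\<^bsub>R\<^esub>}"

text \<open>The degenerate pair \<open>a = 0\<close>, \<open>b = 1\<close> is not excluded, so assuming that an exact zero
  divisor exists is weaker here than under the convention \<open>a \<noteq> 0\<close>.\<close>

definition exact_zero_divisor :: "('a, 'r) ring_scheme \<Rightarrow> 'a \<Rightarrow> bool" where
  "exact_zero_divisor R a \<longleftrightarrow> a \<in> carrier R - Units R \<and>
     (\<exists>b \<in> carrier R. ring_ann R a = PIdl\<^bsub>R\<^esub> b \<and> ring_ann R b = PIdl\<^bsub>R\<^esub> a)"

section \<open>Modules\<close>

text \<open>The locale \<^locale>\<open>module\<close> ignores the fields \<open>mult\<close> and \<open>one\<close> of a module record; they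
  are filled arbitrarily below.\<close>

definition self_mod :: "('a, 'r) ring_scheme \<Rightarrow> ('a, 'a) module" where
  "self_mod R = \<lparr>carrier = carrier R, monoid.mult = monoid.mult R, one = \<one>\<^bsub>R\<^esub>,
     ring.zero = \<zero>\<^bsub>R\<^esub>, ring.add = ring.add R, module.smult = monoid.mult R\<rparr>"

definition free_mod :: "('a, 'r) ring_scheme \<Rightarrow> nat \<Rightarrow> ('a, nat \<Rightarrow> 'a) module" where
  "free_mod R n = \<lparr>carrier = {..<n} \<rightarrow>\<^sub>E carrier R, monoid.mult = undefined, one = undefined,
     ring.zero = (\<lambda>i\<in>{..<n}. \<zero>\<^bsub>R\<^esub>), ring.add = (\<lambda>u v. \<lambda>i\<in>{..<n}. u i \<oplus>\<^bsub>R\<^esub> v i),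
     module.smult = (\<lambda>r v. \<lambda>i\<in>{..<n}. r \<otimes>\<^bsub>R\<^esub> v i)\<rparr>"

definition mod_hom :: "('a, 'r) ring_scheme \<Rightarrow> ('a, 'b, 'p) module_scheme
    \<Rightarrow> ('a, 'c, 'q) module_scheme \<Rightarrow> ('b \<Rightarrow> 'c) set" where
  "mod_hom R M N = {f \<in> hom (add_monoid M) (add_monoid N).
     \<forall>r \<in> carrier R. \<forall>x \<in> carrier M. f (r \<odot>\<^bsub>M\<^esub> x) = r \<odot>\<^bsub>N\<^esub> f x}"

definition mod_iso :: "('a, 'r) ring_scheme \<Rightarrow> ('a, 'b, 'p) module_scheme
    \<Rightarrow> ('a, 'c, 'q) module_scheme \<Rightarrow> ('b \<Rightarrow> 'c) set" where
  "mod_iso R M N = {f \<in> mod_hom R M N. bij_betw f (carrier M) (carrier N)}"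

text \<open>Elements of the Hom module are made extensional, so that two of them are equal as soon as
  they agree on the carrier.\<close>

definition Hom_mod :: "('a, 'r) ring_scheme \<Rightarrow> ('a, 'b, 'p) module_scheme
    \<Rightarrow> ('a, 'c, 'q) module_scheme \<Rightarrow> ('a, 'b \<Rightarrow> 'c) module" where
  "Hom_mod R M N = \<lparr>carrier = mod_hom R M N \<inter> extensional (carrier M),
     monoid.mult = undefined, one = undefined,
     ring.zero = (\<lambda>x\<in>carrier M. \<zero>\<^bsub>N\<^esub>), ring.add = (\<lambda>f g. \<lambda>x\<in>carrier M. f x \<oplus>\<^bsub>N\<^esub> g x),
     module.smult = (\<lambda>r f. \<lambda>x\<in>carrier M. r \<odot>\<^bsub>N\<^esub> f x)\<rparr>"

text \<open>For \<open>f : L \<rightarrow> M\<close>, the map \<open>Hom(f, N) : Hom(M, N) \<rightarrow> Hom(L, N)\<close>.\<close>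

definition Hom_map :: "('a, 'b, 'p) module_scheme \<Rightarrow> ('b \<Rightarrow> 'c) \<Rightarrow> ('c \<Rightarrow> 'd) \<Rightarrow> ('b \<Rightarrow> 'd)" where
  "Hom_map L f = (\<lambda>\<phi>. compose (carrier L) \<phi> f)"

definition dual_mod :: "('a, 'r) ring_scheme \<Rightarrow> ('a, 'b, 'p) module_scheme \<Rightarrow> ('a, 'b \<Rightarrow> 'a) module" where
  "dual_mod R M = Hom_mod R M (self_mod R)"

definition biduality :: "('a, 'r) ring_scheme \<Rightarrow> ('a, 'b, 'p) module_scheme
    \<Rightarrow> 'b \<Rightarrow> (('b \<Rightarrow> 'a) \<Rightarrow> 'a)" where
  "biduality R M = (\<lambda>x. \<lambda>\<phi>\<in>carrier (dual_mod R M). \<phi> x)"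

definition quot_mod :: "('a, 'b, 'p) module_scheme \<Rightarrow> 'b set \<Rightarrow> ('a, 'b set) module" where
  "quot_mod M S = \<lparr>carrier = a_rcosets\<^bsub>M\<^esub> S, monoid.mult = undefined, one = undefined,
     ring.zero = S, ring.add = set_add M, module.smult = (\<lambda>r Y. \<Union>y\<in>Y. S +>\<^bsub>M\<^esub> (r \<odot>\<^bsub>M\<^esub> y))\<rparr>"

definition mod_span :: "('a, 'r) ring_scheme \<Rightarrow> ('a, 'b, 'p) module_scheme \<Rightarrow> 'b set \<Rightarrow> 'b set" where
  "mod_span R M S = \<Inter>{N. submodule N R M \<and> S \<subseteq> N}"

definition generates :: "('a, 'r) ring_scheme \<Rightarrow> ('a, 'b, 'p) module_scheme \<Rightarrow> 'b set \<Rightarrow> bool" where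
  "generates R M S \<longleftrightarrow> S \<subseteq> carrier M \<and> mod_span R M S = carrier M"

definition fin_gen :: "('a, 'r) ring_scheme \<Rightarrow> ('a, 'b, 'p) module_scheme \<Rightarrow> bool" where
  "fin_gen R M \<longleftrightarrow> (\<exists>S. finite S \<and> generates R M S)"

definition min_num_gens :: "('a, 'r) ring_scheme \<Rightarrow> ('a, 'b, 'p) module_scheme \<Rightarrow> nat" where
  "min_num_gens R M = (LEAST n. \<exists>S. finite S \<and> card S = n \<and> generates R M S)"

definition ideal_smult :: "('a, 'r) ring_scheme \<Rightarrow> 'a set \<Rightarrow> ('a, 'b, 'p) module_scheme \<Rightarrow> 'b set" where
  "ideal_smult R J M = mod_span R M {r \<odot>\<^bsub>M\<^esub> x | r x. r \<in> J \<and> x \<in> carrier M}"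

definition is_basis :: "('a, 'r) ring_scheme \<Rightarrow> ('a, 'b, 'p) module_scheme
    \<Rightarrow> nat \<Rightarrow> (nat \<Rightarrow> 'b) \<Rightarrow> bool" where
  "is_basis R M n v \<longleftrightarrow> v ` {..<n} \<subseteq> carrier M \<and>
     (\<forall>x \<in> carrier M. \<exists>!c. c \<in> {..<n} \<rightarrow>\<^sub>E carrier R \<and>
        x = (\<Oplus>\<^bsub>M\<^esub>i\<in>{..<n}. c i \<odot>\<^bsub>M\<^esub> v i))"

definition fin_free :: "('a, 'r) ring_scheme \<Rightarrow> ('a, 'b, 'p) module_scheme \<Rightarrow> bool" where
  "fin_free R M \<longleftrightarrow> module R M \<and> (\<exists>n v. is_basis R M n v)"

section \<open>Gorenstein rings\<close>

text \<open>A local ring is Gorenstein if it has finite injective dimension over itself. Quantification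
  over all modules is not available in HOL, so both the test modules for injectivity and the terms
  of the injective resolution are taken with carrier in \<^typ>\<open>'a list\<close>, a type of cardinality
  \<open>max(|'a|, \<aleph>\<^sub>0)\<close>. For noetherian \<open>R\<close> this loses nothing: it contains a copy of \<open>R\<close>, so by
  Baer's criterion the test modules suffice, and the injective hull of a module of cardinality at
  most \<open>max(|R|, \<aleph>\<^sub>0)\<close> again satisfies this bound.\<close>

definition injective_mod :: "('a, 'r) ring_scheme \<Rightarrow> ('a, 'c, 'q) module_scheme \<Rightarrow> bool" where
  "injective_mod R E \<longleftrightarrow> module R E \<and>
     (\<forall>(B :: ('a, 'a list) module) S f.
        module R B \<and> submodule S R B \<and> f \<in> mod_hom R (B\<lparr>carrier := S\<rparr>) E \<longrightarrow>
        (\<exists>g \<in> mod_hom R B E. \<forall>x \<in> S. g x = f x))"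

definition finite_inj_dim :: "('a, 'r) ring_scheme \<Rightarrow> ('a, 'b, 'p) module_scheme \<Rightarrow> bool" where
  "finite_inj_dim R M \<longleftrightarrow>
     (\<exists>(E :: nat \<Rightarrow> ('a, 'a list) module) e d n.
        (\<forall>i. injective_mod R (E i)) \<and>
        e \<in> mod_hom R M (E 0) \<and> (\<forall>i. d i \<in> mod_hom R (E i) (E (Suc i))) \<and>
        inj_on e (carrier M) \<and>
        a_kernel (E 0) (E 1) (d 0) = e ` carrier M \<and>
        (\<forall>i. a_kernel (E (Suc i)) (E (Suc (Suc i))) (d (Suc i)) = d i ` carrier (E i)) \<and>
        (\<forall>i>n. carrier (E i) = {\<zero>\<^bsub>E i\<^esub>}))"

definition gorenstein :: "('a, 'r) ring_scheme \<Rightarrow> bool" where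
  "gorenstein R \<longleftrightarrow> finite_inj_dim R (self_mod R)"

section \<open>Ext and total reflexivity\<close>

text \<open>A resolution \<open>\<cdots> \<rightarrow> R\<^bsup>n 1\<^esup> \<rightarrow> R\<^bsup>n 0\<^esup> \<rightarrow> M \<rightarrow> 0\<close> by finitely generated free modules, with
  \<open>d i : R\<^bsup>n (i + 1)\<^esup> \<rightarrow> R\<^bsup>n i\<^esup>\<close>. It exists for every finitely generated \<open>M\<close> over a noetherian
  ring.\<close>

definition free_resolution :: "('a, 'r) ring_scheme \<Rightarrow> ('a, 'b, 'p) module_scheme
    \<Rightarrow> (nat \<Rightarrow> nat) \<Rightarrow> (nat \<Rightarrow> (nat \<Rightarrow> 'a) \<Rightarrow> (nat \<Rightarrow> 'a)) \<Rightarrow> ((nat \<Rightarrow> 'a) \<Rightarrow> 'b) \<Rightarrow> bool" where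
  "free_resolution R M n d e \<longleftrightarrow>
     e \<in> mod_hom R (free_mod R (n 0)) M \<and>
     (\<forall>i. d i \<in> mod_hom R (free_mod R (n (Suc i))) (free_mod R (n i))) \<and>
     e ` carrier (free_mod R (n 0)) = carrier M \<and>
     a_kernel (free_mod R (n 0)) M e = d 0 ` carrier (free_mod R (n 1)) \<and>
     (\<forall>i. a_kernel (free_mod R (n (Suc i))) (free_mod R (n i)) (d i) =
          d (Suc i) ` carrier (free_mod R (n (Suc (Suc i)))))"

text \<open>The \<open>i\<close>-th cohomology module of \<open>Hom(F, N)\<close>, where \<open>F\<close> is given by \<open>n\<close> and \<open>d\<close>.\<close>

definition Hom_cohomology :: "('a, 'r) ring_scheme \<Rightarrow> (nat \<Rightarrow> nat)
    \<Rightarrow> (nat \<Rightarrow> (nat \<Rightarrow> 'a) \<Rightarrow> (nat \<Rightarrow> 'a)) \<Rightarrow> ('a, 'c, 'q) module_scheme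
    \<Rightarrow> nat \<Rightarrow> ('a, ((nat \<Rightarrow> 'a) \<Rightarrow> 'c) set) module" where
  "Hom_cohomology R n d N i =
     (let F = (\<lambda>j. free_mod R (n j));
          C = (\<lambda>j. Hom_mod R (F j) N);
          Z = a_kernel (C i) (C (Suc i)) (Hom_map (F (Suc i)) (d i));
          B = (case i of 0 \<Rightarrow> {\<zero>\<^bsub>C 0\<^esub>} | Suc j \<Rightarrow> Hom_map (F (Suc j)) (d j) ` carrier (C j))
      in quot_mod ((C i)\<lparr>carrier := Z\<rparr>) B)"

text \<open>For finitely generated \<open>M\<close> over a noetherian ring. Up to isomorphism \<open>Ext\<^sup>i(M, N)\<close> does not
  depend on the resolution.\<close>

definition Ext_vanishes :: "('a, 'r) ring_scheme \<Rightarrow> nat \<Rightarrow> ('a, 'b, 'p) module_scheme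
    \<Rightarrow> ('a, 'c, 'q) module_scheme \<Rightarrow> bool" where
  "Ext_vanishes R i M N \<longleftrightarrow>
     (\<forall>n d e. free_resolution R M n d e \<longrightarrow>
        carrier (Hom_cohomology R n d N i) = {\<zero>\<^bsub>Hom_cohomology R n d N i\<^esub>})"

definition totally_reflexive :: "('a, 'r) ring_scheme \<Rightarrow> ('a, 'b, 'p) module_scheme \<Rightarrow> bool" where
  "totally_reflexive R M \<longleftrightarrow> module R M \<and> fin_gen R M \<and>
     biduality R M \<in> mod_iso R M (dual_mod R (dual_mod R M)) \<and>
     (\<forall>i>0. Ext_vanishes R i M (self_mod R) \<and> Ext_vanishes R i (dual_mod R M) (self_mod R))"

section \<open>Matrices and minimal presentations\<close>

definition mat_over :: "('a, 'r) ring_scheme \<Rightarrow> nat \<Rightarrow> nat \<Rightarrow> (nat \<Rightarrow> nat \<Rightarrow> 'a) \<Rightarrow> bool" where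
  "mat_over R n k U \<longleftrightarrow> (\<forall>i<n. \<forall>j<k. U i j \<in> carrier R)"

definition mat_col :: "nat \<Rightarrow> (nat \<Rightarrow> nat \<Rightarrow> 'a) \<Rightarrow> nat \<Rightarrow> (nat \<Rightarrow> 'a)" where
  "mat_col n U j = (\<lambda>i\<in>{..<n}. U i j)"

definition upper_triangular_mat :: "('a, 'r) ring_scheme \<Rightarrow> nat \<Rightarrow> (nat \<Rightarrow> nat \<Rightarrow> 'a) \<Rightarrow> bool" where
  "upper_triangular_mat R n U \<longleftrightarrow> mat_over R n n U \<and> (\<forall>i<n. \<forall>j<i. U i j = \<zero>\<^bsub>R\<^esub>)"

text \<open>The columns \<open>j < k\<close> generate the kernel of \<open>p\<close>, and no proper subfamily of them does. Thus
  \<open>p\<close> induces an isomorphism from the cokernel of \<open>U\<close> to \<open>M\<close>.\<close>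

definition minimal_presentation_matrix :: "('a, 'r) ring_scheme \<Rightarrow> ('a, 'b, 'p) module_scheme
    \<Rightarrow> nat \<Rightarrow> nat \<Rightarrow> (nat \<Rightarrow> nat \<Rightarrow> 'a) \<Rightarrow> bool" where
  "minimal_presentation_matrix R M n k U \<longleftrightarrow>
     n = min_num_gens R M \<and> mat_over R n k U \<and>
     (\<exists>p \<in> mod_hom R (free_mod R n) M.
        p ` carrier (free_mod R n) = carrier M \<and>
        mod_span R (free_mod R n) (mat_col n U ` {..<k}) = a_kernel (free_mod R n) M p \<and>
        (\<forall>J. J \<subset> {..<k} \<longrightarrow>
           mod_span R (free_mod R n) (mat_col n U ` J) \<noteq> a_kernel (free_mod R n) M p))"

text \<open>Upper triangular matrices are square. This matters: for nonzero \<open>a \<in> m\<close>, the \<open>2 \<times> 1\<close> matrix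
  with entries \<open>a, 0\<close> is a minimal presentation matrix of \<open>R/(a) \<oplus> R\<close>, and a module with a nonzero
  free direct summand has no minimal complete resolution over an artinian
  local ring.\<close>

definition has_upper_triangular_min_pres :: "('a, 'r) ring_scheme \<Rightarrow> ('a, 'b, 'p) module_scheme \<Rightarrow> bool" where
  "has_upper_triangular_min_pres R M \<longleftrightarrow>
     (\<exists>n U. minimal_presentation_matrix R M n n U \<and> upper_triangular_mat R n U)"

section \<open>Complete resolutions\<close>

text \<open>Complexes \<open>(A, d)\<close> are indexed by the integers, with \<open>d i : A i \<rightarrow> A (i - 1)\<close>.\<close>

definition free_complex :: "('a, 'r) ring_scheme \<Rightarrow> (int \<Rightarrow> ('a, 'c, 'q) module_scheme)
    \<Rightarrow> (int \<Rightarrow> 'c \<Rightarrow> 'c) \<Rightarrow> bool" where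
  "free_complex R A d \<longleftrightarrow>
     (\<forall>i. fin_free R (A i)) \<and> (\<forall>i. d i \<in> mod_hom R (A i) (A (i - 1))) \<and>
     (\<forall>i. \<forall>x \<in> carrier (A i). d (i - 1) (d i x) = \<zero>\<^bsub>A (i - 2)\<^esub>)"

definition acyclic_complex :: "(int \<Rightarrow> ('a, 'c, 'q) module_scheme) \<Rightarrow> (int \<Rightarrow> 'c \<Rightarrow> 'c) \<Rightarrow> bool" where
  "acyclic_complex A d \<longleftrightarrow>
     (\<forall>i. a_kernel (A i) (A (i - 1)) (d i) = d (i + 1) ` carrier (A (i + 1)))"

text \<open>\<open>Hom(A, R)\<close> is reindexed homologically: its term in degree \<open>i\<close> is \<open>Hom(A (- i), R)\<close>.\<close>

definition dual_complex :: "('a, 'r) ring_scheme \<Rightarrow> (int \<Rightarrow> ('a, 'c, 'q) module_scheme)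
    \<Rightarrow> int \<Rightarrow> ('a, 'c \<Rightarrow> 'a) module" where
  "dual_complex R A i = dual_mod R (A (- i))"

definition dual_diff :: "(int \<Rightarrow> ('a, 'c, 'q) module_scheme) \<Rightarrow> (int \<Rightarrow> 'c \<Rightarrow> 'c)
    \<Rightarrow> int \<Rightarrow> ('c \<Rightarrow> 'a) \<Rightarrow> ('c \<Rightarrow> 'a)" where
  "dual_diff A d i = Hom_map (A (1 - i)) (d (1 - i))"

definition totally_acyclic :: "('a, 'r) ring_scheme \<Rightarrow> (int \<Rightarrow> ('a, 'c, 'q) module_scheme)
    \<Rightarrow> (int \<Rightarrow> 'c \<Rightarrow> 'c) \<Rightarrow> bool" where
  "totally_acyclic R A d \<longleftrightarrow> free_complex R A d \<and> acyclic_complex A d \<and>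
     acyclic_complex (dual_complex R A) (dual_diff A d)"

definition complete_resolution :: "('a, 'r) ring_scheme \<Rightarrow> ('a, 'b, 'p) module_scheme
    \<Rightarrow> (int \<Rightarrow> ('a, 'c, 'q) module_scheme) \<Rightarrow> (int \<Rightarrow> 'c \<Rightarrow> 'c) \<Rightarrow> bool" where
  "complete_resolution R M A d \<longleftrightarrow> totally_acyclic R A d \<and>
     mod_iso R M (quot_mod (A 0) (d 1 ` carrier (A 1))) \<noteq> {}"

definition minimal_complex :: "('a, 'r) ring_scheme \<Rightarrow> 'a set
    \<Rightarrow> (int \<Rightarrow> ('a, 'c, 'q) module_scheme) \<Rightarrow> (int \<Rightarrow> 'c \<Rightarrow> 'c) \<Rightarrow> bool" where
  "minimal_complex R m A d \<longleftrightarrow>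
     (\<forall>i. d i ` carrier (A i) \<subseteq> ideal_smult R m (A (i - 1)))"

text \<open>\<open>U i\<close> is the matrix of \<open>d i\<close> with respect to the chosen bases \<open>b i\<close> and \<open>b (i - 1)\<close>;
  that all of these matrices are square means that all ranks are equal.\<close>

definition upper_triangular_complex :: "('a, 'r) ring_scheme
    \<Rightarrow> (int \<Rightarrow> ('a, 'c, 'q) module_scheme) \<Rightarrow> (int \<Rightarrow> 'c \<Rightarrow> 'c) \<Rightarrow> bool" where
  "upper_triangular_complex R A d \<longleftrightarrow>
     (\<exists>n b U. \<forall>i :: int. is_basis R (A i) n (b i) \<and> upper_triangular_mat R n (U i) \<and>
        (\<forall>t<n. d i (b i t) = (\<Oplus>\<^bsub>A (i - 1)\<^esub>s\<in>{..<n}. U i s t \<odot>\<^bsub>A (i - 1)\<^esub> b (i - 1) s)))"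

end

theory Submission
  imports Defs
begin

text \<open>Let \<open>r\<close> be the length of \<open>m\<^sup>2\<close> and \<open>e\<close> that of \<open>m/m\<^sup>2\<close>. Total reflexivity gives a minimal sequence
  of matrices \<open>D\<^sub>0, D\<^sub>1 = U, D\<^sub>2, \<dots>\<close> that is exact together with its transpose. As \<open>R\<close> is not
  Gorenstein, some homomorphism \<open>m \<rightarrow> R\<close> is not a multiplication, and a cocycle argument then shows
  that a differential maps \<open>mF\<close> onto the socle \<open>m\<^sup>2F'\<close> of its target. Counting lengths gives \<open>r \<ge> 2\<close>,
  \<open>e = r + 1\<close> and constant Betti numbers \<open>n\<close>.

  Let \<open>U\<close> be upper triangular and let \<open>E\<^sub>j\<close> be spanned by the first \<open>j\<close> basis vectors. For the least
  \<open>j\<close> with \<open>U(m E\<^sub>j) \<noteq> m\<^sup>2E\<^sub>j\<close>, the kernel of \<open>U\<close> on \<open>E\<^sub>j\<close> is too long; this bounds the image of a large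
  submodule under the transpose of \<open>W = D\<^sub>2\<close>, so that \<open>ker W\<^sup>T = im U\<^sup>T\<close> contains more than the
  diagonal entries of \<open>U\<close> before the \<open>j\<close>-th one permit unless \<open>r \<le> 1\<close>. Hence no such \<open>j\<close> exists, and the
  diagonal entries \<open>a\<^sub>j\<close> of \<open>U\<close> satisfy \<open>a\<^sub>j m = m\<^sup>2\<close>. The kernel of \<open>U\<close> is then generated by the columns
  of an upper triangular matrix, and the same argument applies to its diagonal entries \<open>b\<^sub>j\<close>, so
  \<open>(0 : a\<^sub>j) = (b\<^sub>j)\<close> and \<open>(0 : b\<^sub>j) = (a\<^sub>j)\<close>. Starting from \<open>U\<close>, triangular matrices with diagonals
  alternating between \<open>a\<close> and \<open>b\<close> and with vanishing consecutive products can be found in both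
  directions by solving equations \<open>a\<^sub>j x = y\<close> with \<open>y \<in> m\<^sup>2\<close>; the sequence is exact by triangular
  elimination.\<close>

section \<open>Length of submodules\<close>

text \<open>The relation \<open>embdim = 1 + socdim\<close> drives the counts: it makes the relevant
  kernels exactly half as long as their free modules, and it leaves so little room that one surplus
  unit of length in the kernel of \<open>U\<close> on some E_j can be followed through
  \<open>W\<close>, its transpose and the transpose of \<open>U\<close> until it forces 2r \<le> r +
  1. The obstacle is that only \<open>U\<close> is known to be triangular: its right neighbour
  \<open>W\<close> is an arbitrary minimal syzygy. So \<open>U\<close> and \<open>W\<close> are
  compared only through lengths and orthogonality, with m^3 = 0 killing the pairings.

  Apart from \<open>U\<close>, the matrices of the final resolution are new. They are rebuilt from
  the diagonals alone, which suffices because triangular matrices with zero product and dual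
  diagonals are exact together with their transposes.

  That R is not Gorenstein is used in the form Ext^1(R/m, R) \<noteq> 0. The passage is Baer's
  argument: since m^3 = 0, outside any proper domain of a partial map there is a vector whose
  multiples by m lie inside it.\<close>

lemma (in abelian_group) add_minus_cancel_right:
  assumes c: "P \<in> carrier G" "Q \<in> carrier G" "T \<in> carrier G"
  shows "(P \<oplus> T) \<ominus> (Q \<oplus> T) = P \<ominus> Q"
proof -
  have "(P \<oplus> T) \<ominus> (Q \<oplus> T) = P \<oplus> (T \<oplus> \<ominus> T) \<oplus> \<ominus> Q"
    unfolding a_minus_def minus_add[OF c(2,3)] using c by (simp add: a_ac del: r_neg l_neg)
  then show ?thesis using c by (simp add: r_neg a_minus_def)
qed

text \<open>Closure under negation comes from scalar multiplication by
  \<open>\<ominus> \<one>\<close>.\<close>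

lemma (in module) submoduleI':
  assumes "H \<subseteq> carrier M" "\<zero>\<^bsub>M\<^esub> \<in> H"
    and "\<And>a b. \<lbrakk>a \<in> H; b \<in> H\<rbrakk> \<Longrightarrow> a \<oplus>\<^bsub>M\<^esub> b \<in> H"
    and smult: "\<And>a x. \<lbrakk>a \<in> carrier R; x \<in> H\<rbrakk> \<Longrightarrow> a \<odot>\<^bsub>M\<^esub> x \<in> H"
  shows "submodule H R M"
proof (rule submoduleI)
  fix a assume "a \<in> H"
  then show "\<ominus>\<^bsub>M\<^esub> a \<in> H"
    using smult[of "\<ominus> \<one>" a] assms(1) by (auto simp: smult_l_minus)
qed (use assms in auto)

lemma (in module) submodule_minus:
  assumes "submodule H R M" "a \<in> H" "b \<in> H"
  shows "a \<ominus>\<^bsub>M\<^esub> b \<in> H"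
  using submoduleE[OF assms(1)] assms(2,3) by (simp add: a_minus_def)

lemma (in module) submodule_zero: "submodule H R M \<Longrightarrow> \<zero>\<^bsub>M\<^esub> \<in> H"
  using subgroup.one_closed[OF submodule.axioms(1)] by fastforce

lemma (in module) submodule_inter:
  assumes "submodule A R M" "submodule B R M"
  shows "submodule (A \<inter> B) R M"
  using submoduleE[OF assms(1)] submoduleE[OF assms(2)] submodule_zero[OF assms(1)] submodule_zero[OF assms(2)]
  by (intro submoduleI') auto

lemma (in module) zero_submodule: "submodule {\<zero>\<^bsub>M\<^esub>} R M"
  by (intro submoduleI') auto

locale linear_map = M: module R M + N: module R N
  for R (structure) and M :: "('a, 'b, 'p) module_scheme" and N :: "('a, 'c, 'q) module_scheme" +
  fixes f
  assumes mod_hom: "f \<in> mod_hom R M N"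
begin

lemma closed [simp]: "x \<in> carrier M \<Longrightarrow> f x \<in> carrier N"
  using mod_hom by (auto simp: mod_hom_def hom_def)

lemma add: "x \<in> carrier M \<Longrightarrow> y \<in> carrier M \<Longrightarrow> f (x \<oplus>\<^bsub>M\<^esub> y) = f x \<oplus>\<^bsub>N\<^esub> f y"
  using mod_hom by (auto simp: mod_hom_def hom_def)

lemma smult: "a \<in> carrier R \<Longrightarrow> x \<in> carrier M \<Longrightarrow> f (a \<odot>\<^bsub>M\<^esub> x) = a \<odot>\<^bsub>N\<^esub> f x"
  using mod_hom by (auto simp: mod_hom_def)

lemma zero [simp]: "f \<zero>\<^bsub>M\<^esub> = \<zero>\<^bsub>N\<^esub>"
  using smult[of \<zero> "\<zero>\<^bsub>M\<^esub>"] by simp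

lemma minus: "x \<in> carrier M \<Longrightarrow> f (\<ominus>\<^bsub>M\<^esub> x) = \<ominus>\<^bsub>N\<^esub> f x"
  using smult[of "\<ominus> \<one>" x] by (simp add: M.smult_l_minus N.smult_l_minus)

lemma diff: "x \<in> carrier M \<Longrightarrow> y \<in> carrier M \<Longrightarrow> f (x \<ominus>\<^bsub>M\<^esub> y) = f x \<ominus>\<^bsub>N\<^esub> f y"
  by (simp add: a_minus_def add minus)

definition ker :: "'b set" where "ker = {x \<in> carrier M. f x = \<zero>\<^bsub>N\<^esub>}"

lemma image_submodule:
  assumes A: "submodule A R M"
  shows "submodule (f ` A) R N"
proof (rule N.submoduleI')
  have c: "A \<subseteq> carrier M" using M.submoduleE[OF A] by blast
  then show "f ` A \<subseteq> carrier N" by auto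
  show "\<zero>\<^bsub>N\<^esub> \<in> f ` A" using M.submodule_zero[OF A] zero by (metis image_eqI)
  fix y z assume "y \<in> f ` A" "z \<in> f ` A"
  then obtain a b where h: "a \<in> A" "b \<in> A" "y = f a" "z = f b" by auto
  then have "y \<oplus>\<^bsub>N\<^esub> z = f (a \<oplus>\<^bsub>M\<^esub> b)" using c by (auto simp: add subsetD)
  then show "y \<oplus>\<^bsub>N\<^esub> z \<in> f ` A" using M.submoduleE(5)[OF A] h by blast
next
  have c: "A \<subseteq> carrier M" using M.submoduleE[OF A] by blast
  fix r y assume r: "r \<in> carrier R" and "y \<in> f ` A"
  then obtain a where h: "a \<in> A" "y = f a" by auto
  then have "r \<odot>\<^bsub>N\<^esub> y = f (r \<odot>\<^bsub>M\<^esub> a)" using c r by (auto simp: smult subsetD)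
  then show "r \<odot>\<^bsub>N\<^esub> y \<in> f ` A" using M.submoduleE(4)[OF A] h r by blast
qed

lemma preimage_submodule:
  assumes B: "submodule B R N"
  shows "submodule {x \<in> carrier M. f x \<in> B} R M"
  using N.submoduleE[OF B] N.submodule_zero[OF B]
  by (intro M.submoduleI') (auto simp: add smult)

lemma ker_submodule: "submodule ker R M"
  using preimage_submodule[OF N.zero_submodule] by (simp add: ker_def)

lemma eq_imp_diff_ker:
  "x \<in> carrier M \<Longrightarrow> y \<in> carrier M \<Longrightarrow> f x = f y \<Longrightarrow> x \<ominus>\<^bsub>M\<^esub> y \<in> ker"
  by (simp add: ker_def diff) (simp add: a_minus_def N.M.r_neg)

end

text \<open>Only the top member of a strict chain starting at zero is recorded, because the
  inductions on chains extend them at the top. The index counts strict inclusions.\<close>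

inductive schain :: "('a, 'r) ring_scheme \<Rightarrow> ('a, 'b, 'p) module_scheme \<Rightarrow> nat \<Rightarrow> 'b set \<Rightarrow> bool"
  for R M where
  base: "schain R M 0 {\<zero>\<^bsub>M\<^esub>}"
| step: "schain R M k A \<Longrightarrow> submodule B R M \<Longrightarrow> A \<subset> B \<Longrightarrow> schain R M (Suc k) B"

definition flen :: "('a, 'r) ring_scheme \<Rightarrow> ('a, 'b, 'p) module_scheme \<Rightarrow> 'b set \<Rightarrow> bool" where
  "flen R M A \<longleftrightarrow> submodule A R M \<and> (\<exists>N. \<forall>k. schain R M k A \<longrightarrow> k \<le> N)"

text \<open>\<open>Max\<close> of an infinite set is unspecified, so the value carries information
  only under \<open>flen\<close>.\<close>

definition len :: "('a, 'r) ring_scheme \<Rightarrow> ('a, 'b, 'p) module_scheme \<Rightarrow> 'b set \<Rightarrow> nat" where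
  "len R M A = Max {k. schain R M k A}"

context module
begin

lemma schain_submodule: "schain R M k A \<Longrightarrow> submodule A R M"
  by (induction rule: schain.induct) (auto simp: zero_submodule)

lemma schain_mono:
  assumes "schain R M k A" "submodule B R M" "A \<subseteq> B"
  shows "\<exists>k' \<ge> k. schain R M k' B"
proof (cases "A = B")
  case False
  then show ?thesis using schain.step[OF assms(1,2)] assms(3)
    by (meson le_SucI order_refl psubsetI)
qed (use assms in auto)

lemma schain_exists: assumes "submodule A R M" shows "\<exists>k. schain R M k A"
  using schain_mono[OF schain.base assms] submodule_zero[OF assms] by auto

lemma schain_zero: "schain R M k {\<zero>\<^bsub>M\<^esub>} \<Longrightarrow> k = 0"
proof (induction k "{\<zero>\<^bsub>M\<^esub>}" rule: schain.induct)
  case (step k A)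
  then show ?case using schain_submodule submodule_zero by blast
qed auto

lemma flen_finite: "flen R M A \<Longrightarrow> finite {k. schain R M k A}"
  by (auto simp: flen_def finite_nat_set_iff_bounded_le)

lemma flen_submodule: "flen R M A \<Longrightarrow> submodule A R M"
  by (simp add: flen_def)

lemma len_schain: assumes "flen R M A" shows "schain R M (len R M A) A"
  using Max_in[OF flen_finite[OF assms]] schain_exists[OF flen_submodule[OF assms]]
  by (auto simp: len_def)

lemma schain_le_len: "flen R M A \<Longrightarrow> schain R M k A \<Longrightarrow> k \<le> len R M A"
  using flen_finite by (auto simp: len_def)

lemma flenI:
  "submodule A R M \<Longrightarrow> (\<And>k. schain R M k A \<Longrightarrow> k \<le> N) \<Longrightarrow> flen R M A"
  by (auto simp: flen_def)

lemma flen_mono: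
  assumes "flen R M B" "submodule A R M" "A \<subseteq> B"
  shows "flen R M A"
  using schain_mono[OF _ flen_submodule[OF assms(1)] assms(3)] schain_le_len[OF assms(1)]
  by (intro flenI[OF assms(2), of "len R M B"]) (meson le_trans)

lemma len_mono:
  assumes "flen R M B" "submodule A R M" "A \<subseteq> B"
  shows "len R M A \<le> len R M B"
  using schain_mono[OF len_schain[OF flen_mono[OF assms]] flen_submodule[OF assms(1)] assms(3)]
    schain_le_len[OF assms(1)] by (meson le_trans)

lemma len_strict_mono:
  assumes "flen R M B" "submodule A R M" "A \<subset> B"
  shows "len R M A < len R M B"
  using schain.step[OF len_schain[OF flen_mono[OF assms(1,2)]] flen_submodule[OF assms(1)] assms(3)]
    schain_le_len[OF assms(1)] assms(3) by (metis Suc_le_lessD psubset_imp_subset)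

lemma len_eq_imp_eq:
  assumes "flen R M B" "submodule A R M" "A \<subseteq> B" "len R M B \<le> len R M A"
  shows "A = B"
  using len_strict_mono[OF assms(1,2)] assms(3,4) by fastforce

lemma flen_zero [simp]: "flen R M {\<zero>\<^bsub>M\<^esub>}"
  using schain_zero by (intro flenI[OF zero_submodule, of 0]) auto

lemma len_zero [simp]: "len R M {\<zero>\<^bsub>M\<^esub>} = 0"
  using schain_zero[OF len_schain[OF flen_zero]] .

lemma len_eq_0_iff: "flen R M A \<Longrightarrow> len R M A = 0 \<longleftrightarrow> A = {\<zero>\<^bsub>M\<^esub>}"
  using len_eq_imp_eq[OF _ zero_submodule] submodule_zero[OF flen_submodule] by fastforce

end

context linear_map
begin

text \<open>Each strict step of a chain stays strict in its trace on the kernel or in its image. If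
  both were equalities, an element of the larger member would have the same image as some element of
  the smaller one, and their difference, a kernel element, would already lie in the smaller
  one.\<close>

lemma schain_split:
  assumes "schain R M k C"
  shows "\<exists>k1 k2. schain R M k1 (C \<inter> ker) \<and> schain R N k2 (f ` C) \<and> k \<le> k1 + k2"
  using assms
proof (induction rule: schain.induct)
  case base
  have "{\<zero>\<^bsub>M\<^esub>} \<inter> ker = {\<zero>\<^bsub>M\<^esub>}" using M.submodule_zero[OF ker_submodule] by auto
  then show ?case using schain.base[of R M] schain.base[of R N] by (metis add_0 image_empty image_insert le0 zero)
next
  case (step k C D)
  then obtain k1 k2 where k: "schain R M k1 (C \<inter> ker)" "schain R N k2 (f ` C)" "k \<le> k1 + k2" by blast
  have C: "submodule C R M" using step.hyps M.schain_submodule by blast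
  note D = step.hyps(2)
  have Dk: "submodule (D \<inter> ker) R M" by (rule M.submodule_inter[OF D ker_submodule])
  have ne: "C \<inter> ker \<noteq> D \<inter> ker \<or> f ` C \<noteq> f ` D"
  proof (rule ccontr)
    assume "\<not> ?thesis"
    then have eq: "C \<inter> ker = D \<inter> ker" "f ` C = f ` D" by auto
    obtain y where y: "y \<in> D" "y \<notin> C" using step.hyps by blast
    obtain x where x: "x \<in> C" "f x = f y" using eq y by (metis imageE image_eqI)
    have cc: "x \<in> carrier M" "y \<in> carrier M" using x y M.submoduleE[OF C] M.submoduleE[OF D] by auto
    have "y \<ominus>\<^bsub>M\<^esub> x \<in> D \<inter> ker"
      using eq_imp_diff_ker[OF cc(2,1)] x y M.submodule_minus[OF D, of y x] step.hyps(3) by auto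
    then have "y \<ominus>\<^bsub>M\<^esub> x \<oplus>\<^bsub>M\<^esub> x \<in> C" using eq x M.submoduleE(5)[OF C] by blast
    then show False using y cc by (simp add: a_minus_def M.M.a_assoc M.M.l_neg)
  qed
  obtain k1' where k1': "k1' \<ge> k1" "schain R M k1' (D \<inter> ker)"
    using M.schain_mono[OF k(1) Dk] step.hyps(3) by blast
  obtain k2' where k2': "k2' \<ge> k2" "schain R N k2' (f ` D)"
    using N.schain_mono[OF k(2) image_submodule[OF D]] step.hyps(3) by blast
  show ?case
  proof (cases "C \<inter> ker = D \<inter> ker")
    case True
    then have "f ` C \<subset> f ` D" using ne step.hyps(3) by blast
    then have "schain R N (Suc k2) (f ` D)" using schain.step[OF k(2) image_submodule[OF D]] by blast
    then show ?thesis using k1' k(3) by (intro exI[of _ k1'] exI[of _ "Suc k2"]) simp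
  next
    case False
    then have "C \<inter> ker \<subset> D \<inter> ker" using step.hyps(3) by blast
    then have "schain R M (Suc k1) (D \<inter> ker)" using schain.step[OF k(1) Dk] by blast
    then show ?thesis using k2' k(3) by (intro exI[of _ "Suc k1"] exI[of _ k2']) simp
  qed
qed

text \<open>The preimages of a chain in the image are stacked on top of a chain in the kernel.
  Strictness survives because every element of \<open>D\<close> has a preimage in
  \<open>A\<close>.\<close>

lemma schain_join:
  assumes "schain R N k2 D" "submodule A R M" "D \<subseteq> f ` A" "schain R M k1 (A \<inter> ker)"
  shows "schain R M (k1 + k2) {x \<in> A. f x \<in> D}"
  using assms(1,3)
proof (induction rule: schain.induct)
  case base
  have "{x \<in> A. f x \<in> {\<zero>\<^bsub>N\<^esub>}} = A \<inter> ker" using M.submoduleE(1)[OF assms(2)] by (auto simp: ker_def)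
  then show ?case using assms by simp
next
  case (step k C D)
  have "{x \<in> A. f x \<in> D} = A \<inter> {x \<in> carrier M. f x \<in> D}"
    using M.submoduleE(1)[OF assms(2)] by auto
  then have "submodule {x \<in> A. f x \<in> D} R M"
    using M.submodule_inter[OF assms(2) preimage_submodule] step by simp
  moreover obtain y where "y \<in> D" "y \<notin> C" using step.hyps by blast
  then have "{x \<in> A. f x \<in> C} \<subset> {x \<in> A. f x \<in> D}"
    using step.prems step.hyps(3) by blast
  ultimately have "schain R M (Suc (k1 + k)) {x \<in> A. f x \<in> D}"
    using schain.step[of R M "k1 + k"] step by blast
  then show ?case by simp
qed

text \<open>Additivity of length along 0 -> A \<inter> ker -> A -> f(A) -> 0:
  \<open>schain_split\<close> gives one inequality and \<open>schain_join\<close> the other. The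
  length counts below rest on it.\<close>

lemma flen_rank_nullity:
  assumes A: "submodule A R M"
  shows "flen R M A \<longleftrightarrow> flen R M (A \<inter> ker) \<and> flen R N (f ` A)" (is ?th1)
    and "flen R M A \<Longrightarrow> len R M A = len R M (A \<inter> ker) + len R N (f ` A)"
proof -
  have Ak: "submodule (A \<inter> ker) R M" by (rule M.submodule_inter[OF A ker_submodule])
  have join: "schain R M (k1 + k2) A" if "schain R N k2 (f ` A)" "schain R M k1 (A \<inter> ker)" for k1 k2
  proof -
    have "{x \<in> A. f x \<in> f ` A} = A" by auto
    then show ?thesis using schain_join[OF that(1) A _ that(2)] by simp
  qed
  have 1: "flen R N (f ` A)" if fA: "flen R M A"
  proof (rule N.flenI[OF image_submodule[OF A], of "len R M A"])
    fix k assume k: "schain R N k (f ` A)"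
    obtain k1 where k1: "schain R M k1 (A \<inter> ker)" using M.schain_exists[OF Ak] by blast
    show "k \<le> len R M A"
      using M.schain_le_len[OF fA join[OF k k1]] by simp
  qed
  have 2: "k \<le> len R M (A \<inter> ker) + len R N (f ` A)"
    if "flen R M (A \<inter> ker)" "flen R N (f ` A)" "schain R M k A" for k
    using schain_split[OF that(3)] M.schain_le_len[OF that(1)] N.schain_le_len[OF that(2)]
    by (meson add_mono le_trans)
  show ?th1
    using 1 2 M.flenI[OF A] M.flen_mono[OF _ Ak] by blast
  then show "flen R M A \<Longrightarrow> len R M A = len R M (A \<inter> ker) + len R N (f ` A)"
    using 2 M.len_schain M.schain_le_len join N.len_schain by (meson le_antisym)
qed

end

section \<open>Adjoining one generator to a submodule\<close>

definition add_cyclic :: "('a, 'r) ring_scheme \<Rightarrow> ('a, 'b, 'p) module_scheme \<Rightarrow> 'b set \<Rightarrow> 'b \<Rightarrow> 'b set" where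
  "add_cyclic R M A x = {a \<oplus>\<^bsub>M\<^esub> r \<odot>\<^bsub>M\<^esub> x | a r. a \<in> A \<and> r \<in> carrier R}"

context module
begin

lemma add_cyclic_submodule:
  assumes A: "submodule A R M" and x: "x \<in> carrier M"
  shows "submodule (add_cyclic R M A x) R M"
proof (rule submoduleI')
  have c: "A \<subseteq> carrier M" using submoduleE[OF A] by blast
  show "add_cyclic R M A x \<subseteq> carrier M" using c x by (auto simp: add_cyclic_def)
  have "\<zero>\<^bsub>M\<^esub> = \<zero>\<^bsub>M\<^esub> \<oplus>\<^bsub>M\<^esub> \<zero> \<odot>\<^bsub>M\<^esub> x" using x by simp
  then show "\<zero>\<^bsub>M\<^esub> \<in> add_cyclic R M A x"
    unfolding add_cyclic_def using submodule_zero[OF A] by blast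
  fix y z assume "y \<in> add_cyclic R M A x" "z \<in> add_cyclic R M A x"
  then obtain a b r s where h: "y = a \<oplus>\<^bsub>M\<^esub> r \<odot>\<^bsub>M\<^esub> x" "z = b \<oplus>\<^bsub>M\<^esub> s \<odot>\<^bsub>M\<^esub> x" "a \<in> A" "b \<in> A"
     "r \<in> carrier R" "s \<in> carrier R" by (auto simp: add_cyclic_def)
  have ab: "a \<in> carrier M" "b \<in> carrier M" using h c by auto
  have "y \<oplus>\<^bsub>M\<^esub> z = (a \<oplus>\<^bsub>M\<^esub> b) \<oplus>\<^bsub>M\<^esub> (r \<oplus> s) \<odot>\<^bsub>M\<^esub> x"
    using h ab x by (simp add: smult_l_distr M.a_ac)
  then show "y \<oplus>\<^bsub>M\<^esub> z \<in> add_cyclic R M A x"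
    unfolding add_cyclic_def using h submoduleE(5)[OF A] by blast
next
  have c: "A \<subseteq> carrier M" using submoduleE[OF A] by blast
  fix t y assume t: "t \<in> carrier R" and "y \<in> add_cyclic R M A x"
  then obtain a r where h: "y = a \<oplus>\<^bsub>M\<^esub> r \<odot>\<^bsub>M\<^esub> x" "a \<in> A" "r \<in> carrier R" by (auto simp: add_cyclic_def)
  have "t \<odot>\<^bsub>M\<^esub> y = t \<odot>\<^bsub>M\<^esub> a \<oplus>\<^bsub>M\<^esub> (t \<otimes> r) \<odot>\<^bsub>M\<^esub> x"
    using h c x t by (auto simp: smult_r_distr smult_assoc1 subsetD)
  then show "t \<odot>\<^bsub>M\<^esub> y \<in> add_cyclic R M A x"
    unfolding add_cyclic_def using h t submoduleE(4)[OF A] by blast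
qed

lemma add_cyclic_superset:
  assumes A: "submodule A R M" and x: "x \<in> carrier M"
  shows "A \<subseteq> add_cyclic R M A x" "x \<in> add_cyclic R M A x"
proof -
  have c: "A \<subseteq> carrier M" using submoduleE[OF A] by blast
  have "a = a \<oplus>\<^bsub>M\<^esub> \<zero> \<odot>\<^bsub>M\<^esub> x" if "a \<in> A" for a using c x that by auto
  then show "A \<subseteq> add_cyclic R M A x" unfolding add_cyclic_def by blast
  have "x = \<zero>\<^bsub>M\<^esub> \<oplus>\<^bsub>M\<^esub> \<one> \<odot>\<^bsub>M\<^esub> x" using x by simp
  then show "x \<in> add_cyclic R M A x" unfolding add_cyclic_def using submodule_zero[OF A] by blast
qed

lemma add_cyclic_least:
  assumes "submodule B R M" "A \<subseteq> B" "x \<in> B"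
  shows "add_cyclic R M A x \<subseteq> B"
  using submoduleE[OF assms(1)] assms(2,3) by (auto simp: add_cyclic_def)

text \<open>Intersecting a chain with \<open>A\<close> loses at most one step, because \<open>A + Rx\<close> covers \<open>A\<close>.\<close>

lemma schain_cover:
  assumes A: "submodule A R M" and x: "x \<in> carrier M"
    and m: "\<And>r. r \<in> carrier R - Units R \<Longrightarrow> r \<odot>\<^bsub>M\<^esub> x \<in> A"
    and "schain R M k C" "C \<subseteq> add_cyclic R M A x"
  shows "\<exists>k1. schain R M k1 (C \<inter> A) \<and> k \<le> k1 + (if C \<subseteq> A then 0 else 1)"
  using assms(4,5)
proof (induction rule: schain.induct)
  case base
  have "{\<zero>\<^bsub>M\<^esub>} \<inter> A = {\<zero>\<^bsub>M\<^esub>}" using submodule_zero[OF A] by auto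
  then show ?case using schain.base[of R M] by auto
next
  case (step k C D)
  have c: "A \<subseteq> carrier M" using submoduleE[OF A] by blast
  have C: "submodule C R M" using step.hyps schain_submodule by blast
  note D = step.hyps(2)
  have DA: "submodule (D \<inter> A) R M" by (rule submodule_inter[OF D A])
  obtain k1 where k1: "schain R M k1 (C \<inter> A)" "k \<le> k1 + (if C \<subseteq> A then 0 else 1)"
    using step by blast
  consider "D \<subseteq> A" | "C \<subseteq> A" "\<not> D \<subseteq> A" | "\<not> C \<subseteq> A" using step.hyps by blast
  then show ?case
  proof cases
    case 1
    then have eq: "D \<inter> A = D" "C \<inter> A = C" using step.hyps by auto
    show ?thesis using schain.step[OF step.hyps(1) D step.hyps(3)] 1 unfolding eq by auto
  next
    case 2
    obtain k1' where "k1' \<ge> k1" "schain R M k1' (D \<inter> A)"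
      using schain_mono[OF k1(1) DA] step.hyps(3) by blast
    then show ?thesis using k1(2) 2 by (intro exI[of _ k1']) auto
  next
    case 3
    then obtain e where e: "e \<in> C" "e \<notin> A" by blast
    then obtain a u where au: "e = a \<oplus>\<^bsub>M\<^esub> u \<odot>\<^bsub>M\<^esub> x" "a \<in> A" "u \<in> carrier R"
      using step.prems step.hyps(3) unfolding add_cyclic_def by blast
    \<comment> \<open>A nonunit \<open>u\<close> would put \<open>u \<odot> x\<close>, and with it
      \<open>e\<close>, into \<open>A\<close>.\<close>
    have uU: "u \<in> Units R" using m[of u] e au submoduleE(5)[OF A] by blast
    obtain y where y: "y \<in> D" "y \<notin> C" using step.hyps by blast
    then obtain a' v where av: "y = a' \<oplus>\<^bsub>M\<^esub> v \<odot>\<^bsub>M\<^esub> x" "a' \<in> A" "v \<in> carrier R"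
      using step.prems unfolding add_cyclic_def by blast
    \<comment> \<open>The factor is chosen so that the multiples of \<open>x\<close> cancel in y - w
      e. This difference lies in \<open>A\<close> but not in \<open>C\<close>, so the step remains
      strict after intersecting with \<open>A\<close>.\<close>
    define w where "w = v \<otimes> inv u"
    have w: "w \<in> carrier R" "w \<otimes> u = v" using uU av au R.m_assoc[of v "inv u" u] by (simp_all add: w_def)
    have ec: "e \<in> carrier M" "a \<in> carrier M" "a' \<in> carrier M" using e submoduleE(1)[OF C] au av c by auto
    have "w \<odot>\<^bsub>M\<^esub> e = w \<odot>\<^bsub>M\<^esub> a \<oplus>\<^bsub>M\<^esub> v \<odot>\<^bsub>M\<^esub> x"
      using au w x ec smult_assoc1[of w u x] by (simp add: smult_r_distr)
    then have eq: "y \<ominus>\<^bsub>M\<^esub> w \<odot>\<^bsub>M\<^esub> e = a' \<ominus>\<^bsub>M\<^esub> w \<odot>\<^bsub>M\<^esub> a"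
      using av x ec w M.add_minus_cancel_right[of a' "w \<odot>\<^bsub>M\<^esub> a" "v \<odot>\<^bsub>M\<^esub> x"] by simp
    have we: "w \<odot>\<^bsub>M\<^esub> e \<in> C" "w \<odot>\<^bsub>M\<^esub> a \<in> A" using w e au submoduleE(4)[OF C] submoduleE(4)[OF A] by auto
    have inDA: "y \<ominus>\<^bsub>M\<^esub> w \<odot>\<^bsub>M\<^esub> e \<in> D" "y \<ominus>\<^bsub>M\<^esub> w \<odot>\<^bsub>M\<^esub> e \<in> A"
      using submodule_minus[OF D y(1), of "w \<odot>\<^bsub>M\<^esub> e"] we step.hyps(3) submodule_minus[OF A av(2) we(2)] eq by auto
    have "y \<ominus>\<^bsub>M\<^esub> w \<odot>\<^bsub>M\<^esub> e \<notin> C"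
    proof
      assume "y \<ominus>\<^bsub>M\<^esub> w \<odot>\<^bsub>M\<^esub> e \<in> C"
      then have "y \<ominus>\<^bsub>M\<^esub> w \<odot>\<^bsub>M\<^esub> e \<oplus>\<^bsub>M\<^esub> w \<odot>\<^bsub>M\<^esub> e \<in> C" using we submoduleE(5)[OF C] by blast
      moreover have "y \<in> carrier M" using y submoduleE(1)[OF D] by blast
      ultimately show False using y we(1) submoduleE(1)[OF C]
        by (simp add: a_minus_def M.a_assoc M.l_neg subsetD)
    qed
    then have "C \<inter> A \<subset> D \<inter> A" using inDA step.hyps(3) by blast
    then have "schain R M (Suc k1) (D \<inter> A)" using schain.step[OF k1(1) DA] by blast
    moreover have "\<not> D \<subseteq> A" using 3 step.hyps(3) by blast
    ultimately show ?thesis using k1(2) 3 by (intro exI[of _ "Suc k1"]) simp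
  qed
qed

text \<open>The condition on nonunits makes the quotient of A + Rx by A zero or simple, so at most
  one unit of length is gained, and exactly one when x is outside A.\<close>

lemma flen_add_cyclic:
  assumes A: "flen R M A" and x: "x \<in> carrier M"
    and m: "\<And>r. r \<in> carrier R - Units R \<Longrightarrow> r \<odot>\<^bsub>M\<^esub> x \<in> A"
  shows "flen R M (add_cyclic R M A x)"
    and "len R M (add_cyclic R M A x) \<le> len R M A + 1"
    and "x \<notin> A \<Longrightarrow> len R M (add_cyclic R M A x) = len R M A + 1"
proof -
  note sA = flen_submodule[OF A]
  note sB = add_cyclic_submodule[OF sA x]
  have *: "k \<le> len R M A + 1" if k: "schain R M k (add_cyclic R M A x)" for k
  proof -
    obtain k1 where k1: "schain R M k1 (add_cyclic R M A x \<inter> A)" "k \<le> k1 + 1"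
      using schain_cover[OF sA x m k order_refl] by (auto split: if_splits)
    moreover have "add_cyclic R M A x \<inter> A = A" using add_cyclic_superset[OF sA x] by blast
    ultimately show ?thesis using schain_le_len[OF A] by (metis add_le_mono1 le_trans)
  qed
  then show f: "flen R M (add_cyclic R M A x)" using flenI[OF sB] by blast
  show le: "len R M (add_cyclic R M A x) \<le> len R M A + 1" using * len_schain[OF f] by blast
  assume "x \<notin> A"
  then have "A \<subset> add_cyclic R M A x" using add_cyclic_superset[OF sA x] by blast
  then show "len R M (add_cyclic R M A x) = len R M A + 1" using len_strict_mono[OF f sA] le by linarith
qed

end

section \<open>Free modules and matrices\<close>

lemma free_mod_carrier: "carrier (free_mod R n) = {..<n} \<rightarrow>\<^sub>E carrier R"
  by (simp add: free_mod_def)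

lemma free_nth [intro]: "v \<in> carrier (free_mod R n) \<Longrightarrow> i < n \<Longrightarrow> v i \<in> carrier R"
  by (auto simp: free_mod_carrier)

lemma free_eqI:
  "u \<in> carrier (free_mod R n) \<Longrightarrow> v \<in> carrier (free_mod R n) \<Longrightarrow> (\<And>i. i < n \<Longrightarrow> u i = v i) \<Longrightarrow> u = v"
  unfolding free_mod_carrier by (rule PiE_ext) auto

lemma free_restrict [intro]:
  "(\<And>i. i < n \<Longrightarrow> f i \<in> carrier R) \<Longrightarrow> (\<lambda>i\<in>{..<n}. f i) \<in> carrier (free_mod R n)"
  by (auto simp: free_mod_carrier)

lemma free_add_nth: "i < n \<Longrightarrow> (u \<oplus>\<^bsub>free_mod R n\<^esub> v) i = u i \<oplus>\<^bsub>R\<^esub> v i"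
  by (simp add: free_mod_def)

lemma free_smult_nth: "i < n \<Longrightarrow> (a \<odot>\<^bsub>free_mod R n\<^esub> v) i = a \<otimes>\<^bsub>R\<^esub> v i"
  by (simp add: free_mod_def)

lemma free_zero_nth: "i < n \<Longrightarrow> \<zero>\<^bsub>free_mod R n\<^esub> i = \<zero>\<^bsub>R\<^esub>"
  by (simp add: free_mod_def)

lemma self_mod_simps [simp]:
  "carrier (self_mod R) = carrier R" "\<zero>\<^bsub>self_mod R\<^esub> = \<zero>\<^bsub>R\<^esub>"
  "x \<oplus>\<^bsub>self_mod R\<^esub> y = x \<oplus>\<^bsub>R\<^esub> y" "x \<odot>\<^bsub>self_mod R\<^esub> y = x \<otimes>\<^bsub>R\<^esub> y"
  by (simp_all add: self_mod_def)

definition tr :: "(nat \<Rightarrow> nat \<Rightarrow> 'a) \<Rightarrow> nat \<Rightarrow> nat \<Rightarrow> 'a" where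
  "tr D i j = D j i"

lemma tr_tr [simp]: "tr (tr D) = D"
  by (auto simp: tr_def fun_eq_iff)

lemma mat_over_tr [simp]: "mat_over R a b (tr D) \<longleftrightarrow> mat_over R b a D"
  by (auto simp: mat_over_def tr_def)

context cring
begin

lemma self_module: "module R (self_mod R)"
proof (rule moduleI)
  show "abelian_group (self_mod R)"
  proof (rule abelian_groupI)
    fix x assume "x \<in> carrier (self_mod R)"
    then show "\<exists>y\<in>carrier (self_mod R). y \<oplus>\<^bsub>self_mod R\<^esub> x = \<zero>\<^bsub>self_mod R\<^esub>"
      by (intro bexI[of _ "\<ominus> x"]) (auto simp: l_neg)
  qed (auto simp: a_ac)
qed (auto simp: l_distr r_distr m_assoc is_cring)

lemma free_smult_closed [simp]:
  "a \<in> carrier R \<Longrightarrow> v \<in> carrier (free_mod R n) \<Longrightarrow> a \<odot>\<^bsub>free_mod R n\<^esub> v \<in> carrier (free_mod R n)"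
  by (auto simp: free_mod_def)

lemma free_add_closed [simp]:
  "u \<in> carrier (free_mod R n) \<Longrightarrow> v \<in> carrier (free_mod R n) \<Longrightarrow> u \<oplus>\<^bsub>free_mod R n\<^esub> v \<in> carrier (free_mod R n)"
  by (auto simp: free_mod_def)

lemma free_zero_closed [simp]: "\<zero>\<^bsub>free_mod R n\<^esub> \<in> carrier (free_mod R n)"
  by (auto simp: free_mod_def)

lemma free_module: "module R (free_mod R n)"
proof (rule moduleI)
  show "abelian_group (free_mod R n)"
  proof (rule abelian_groupI)
    fix x assume x: "x \<in> carrier (free_mod R n)"
    define y where "y = (\<lambda>i\<in>{..<n}. \<ominus> x i)"
    have y: "y \<in> carrier (free_mod R n)" using x by (auto simp: y_def)
    have "y \<oplus>\<^bsub>free_mod R n\<^esub> x = \<zero>\<^bsub>free_mod R n\<^esub>"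
      using x y by (intro free_eqI[of _ R n]) (simp_all add: free_add_nth free_zero_nth y_def l_neg free_nth)
    then show "\<exists>y\<in>carrier (free_mod R n). y \<oplus>\<^bsub>free_mod R n\<^esub> x = \<zero>\<^bsub>free_mod R n\<^esub>" using y by blast
  qed (simp_all, (intro free_eqI[of _ R n]; simp add: free_add_nth free_zero_nth a_ac free_nth)+)
qed (simp_all add: is_cring, (intro free_eqI[of _ R n]; simp add: free_add_nth free_smult_nth l_distr r_distr m_assoc free_nth)+)

lemma free_neg_nth:
  assumes "v \<in> carrier (free_mod R n)" "i < n"
  shows "(\<ominus>\<^bsub>free_mod R n\<^esub> v) i = \<ominus> v i"
proof -
  interpret F: module R "free_mod R n" by (rule free_module)
  have "\<ominus>\<^bsub>free_mod R n\<^esub> v = (\<ominus> \<one>) \<odot>\<^bsub>free_mod R n\<^esub> v"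
    using assms by (simp add: F.smult_l_minus)
  moreover have "v i \<in> carrier R" using assms by auto
  ultimately show ?thesis using assms by (simp add: free_smult_nth l_minus)
qed

lemma free_minus_nth:
  assumes "u \<in> carrier (free_mod R n)" "v \<in> carrier (free_mod R n)" "i < n"
  shows "(u \<ominus>\<^bsub>free_mod R n\<^esub> v) i = u i \<ominus> v i"
  using assms by (simp add: a_minus_def free_add_nth free_neg_nth)

lemma free_minus_closed [simp]:
  assumes "u \<in> carrier (free_mod R n)" "v \<in> carrier (free_mod R n)"
  shows "u \<ominus>\<^bsub>free_mod R n\<^esub> v \<in> carrier (free_mod R n)"
proof -
  interpret F: module R "free_mod R n" by (rule free_module)
  show ?thesis using assms by (rule F.minus_closed)
qed

lemma finsum_swap:
  assumes "finite A" "finite B" "\<And>i j. i \<in> A \<Longrightarrow> j \<in> B \<Longrightarrow> f i j \<in> carrier R"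
  shows "(\<Oplus>i\<in>A. \<Oplus>j\<in>B. f i j) = (\<Oplus>j\<in>B. \<Oplus>i\<in>A. f i j)"
  using assms(1,3)
proof (induction A rule: finite_induct)
  case (insert a A)
  have "(\<Oplus>j\<in>B. \<Oplus>i\<in>insert a A. f i j) = (\<Oplus>j\<in>B. f a j \<oplus> (\<Oplus>i\<in>A. f i j))"
    using insert by (intro finsum_cong') (auto intro!: finsum_closed simp: finsum_insert)
  also have "\<dots> = (\<Oplus>j\<in>B. f a j) \<oplus> (\<Oplus>j\<in>B. \<Oplus>i\<in>A. f i j)"
    using insert by (intro finsum_addf) (auto intro!: finsum_closed)
  also have "\<dots> = (\<Oplus>i\<in>insert a A. \<Oplus>j\<in>B. f i j)"
    using insert by (subst finsum_insert) (auto intro!: finsum_closed)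
  finally show ?case by simp
qed (simp add: finsum_zero)

section \<open>Pairing, matrix-vector products and transposes\<close>

definition dot :: "nat \<Rightarrow> (nat \<Rightarrow> 'a) \<Rightarrow> (nat \<Rightarrow> 'a) \<Rightarrow> 'a" where
  "dot k u v = (\<Oplus>i\<in>{..<k}. u i \<otimes> v i)"

text \<open>Matrices are total functions without a size. The numbers of rows \<open>a\<close> and
  columns \<open>b\<close> are passed along and only entries in that range count. The restriction
  makes the value an extensional vector, as \<open>free_mod R a\<close> requires.\<close>

definition mv :: "nat \<Rightarrow> nat \<Rightarrow> (nat \<Rightarrow> nat \<Rightarrow> 'a) \<Rightarrow> (nat \<Rightarrow> 'a) \<Rightarrow> nat \<Rightarrow> 'a" where
  "mv a b D v = (\<lambda>i\<in>{..<a}. dot b (D i) v)"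

definition mat_mul :: "nat \<Rightarrow> (nat \<Rightarrow> nat \<Rightarrow> 'a) \<Rightarrow> (nat \<Rightarrow> nat \<Rightarrow> 'a) \<Rightarrow> nat \<Rightarrow> nat \<Rightarrow> 'a" where
  "mat_mul b D E i j = dot b (D i) (\<lambda>l. E l j)"

definition unit_vec :: "nat \<Rightarrow> nat \<Rightarrow> nat \<Rightarrow> 'a" where
  "unit_vec n j = (\<lambda>i\<in>{..<n}. if i = j then \<one> else \<zero>)"

lemma dot_cong:
  assumes "\<And>i. i < k \<Longrightarrow> u i = u' i" "\<And>i. i < k \<Longrightarrow> v i = v' i"
    "\<And>i. i < k \<Longrightarrow> u' i \<in> carrier R" "\<And>i. i < k \<Longrightarrow> v' i \<in> carrier R"
  shows "dot k u v = dot k u' v'"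
  unfolding dot_def using assms by (intro finsum_cong') auto

lemma dot_closed [simp]:
  "(\<And>i. i < k \<Longrightarrow> u i \<in> carrier R) \<Longrightarrow> (\<And>i. i < k \<Longrightarrow> v i \<in> carrier R) \<Longrightarrow> dot k u v \<in> carrier R"
  unfolding dot_def by (intro finsum_closed) auto

lemma dot_comm:
  "(\<And>i. i < k \<Longrightarrow> u i \<in> carrier R) \<Longrightarrow> (\<And>i. i < k \<Longrightarrow> v i \<in> carrier R) \<Longrightarrow> dot k u v = dot k v u"
  unfolding dot_def by (intro finsum_cong') (auto simp: m_comm)

lemma dot_0 [simp]: "dot 0 u v = \<zero>"
  by (simp add: dot_def)

lemma dot_Suc:
  "(\<And>i. i \<le> k \<Longrightarrow> u i \<in> carrier R) \<Longrightarrow> (\<And>i. i \<le> k \<Longrightarrow> v i \<in> carrier R) \<Longrightarrow>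
     dot (Suc k) u v = dot k u v \<oplus> u k \<otimes> v k"
  unfolding dot_def lessThan_Suc by (subst finsum_insert) (auto simp: a_comm)

lemma dot_eq_zero:
  "(\<And>i. i < k \<Longrightarrow> u i \<otimes> v i = \<zero>) \<Longrightarrow> dot k u v = \<zero>"
  unfolding dot_def using finsum_zero[of "{..<k}"] add.finprod_one_eqI by (auto intro!: add.finprod_one_eqI)

lemma dot_add:
  assumes "\<And>i. i < k \<Longrightarrow> u i \<in> carrier R" "\<And>i. i < k \<Longrightarrow> v i \<in> carrier R" "\<And>i. i < k \<Longrightarrow> w i \<in> carrier R"
  shows "dot k u (\<lambda>i. v i \<oplus> w i) = dot k u v \<oplus> dot k u w"
proof -
  have "dot k u (\<lambda>i. v i \<oplus> w i) = (\<Oplus>i\<in>{..<k}. u i \<otimes> v i \<oplus> u i \<otimes> w i)"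
    unfolding dot_def using assms by (intro finsum_cong') (auto simp: r_distr)
  then show ?thesis unfolding dot_def using assms by (subst finsum_addf[symmetric]) auto
qed

lemma dot_smult:
  assumes "\<And>i. i < k \<Longrightarrow> u i \<in> carrier R" "\<And>i. i < k \<Longrightarrow> v i \<in> carrier R" "c \<in> carrier R"
  shows "dot k u (\<lambda>i. c \<otimes> v i) = c \<otimes> dot k u v"
  unfolding dot_def using assms by (subst finsum_rdistr) (auto intro!: finsum_cong' simp: m_lcomm)

lemma dot_unit:
  assumes "\<And>i. i < k \<Longrightarrow> u i \<in> carrier R" "j < k"
  shows "dot k u (unit_vec k j) = u j"
proof -
  have "dot k u (unit_vec k j) = (\<Oplus>i\<in>{..<k}. if j = i then u i else \<zero>)"
    unfolding dot_def unit_vec_def using assms by (intro finsum_cong') auto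
  then show ?thesis using assms finsum_singleton[of j "{..<k}" u] by auto
qed

lemma unit_vec_closed [simp]: "unit_vec n j \<in> carrier (free_mod R n)"
  by (auto simp: unit_vec_def free_mod_carrier)

lemma mat_overD: "mat_over R a b D \<Longrightarrow> i < a \<Longrightarrow> j < b \<Longrightarrow> D i j \<in> carrier R"
  by (simp add: mat_over_def)

lemma mv_nth: "i < a \<Longrightarrow> mv a b D v i = dot b (D i) v"
  by (simp add: mv_def)

lemma mv_closed [simp]:
  assumes "mat_over R a b D" "v \<in> carrier (free_mod R b)"
  shows "mv a b D v \<in> carrier (free_mod R a)"
  unfolding mv_def using assms by (auto intro!: dot_closed simp: mat_over_def)

lemma mv_linear:
  assumes D: "mat_over R a b D"
  shows "linear_map R (free_mod R b) (free_mod R a) (mv a b D)"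
proof -
  have 1: "mv a b D (u \<oplus>\<^bsub>free_mod R b\<^esub> v) = mv a b D u \<oplus>\<^bsub>free_mod R a\<^esub> mv a b D v"
    if "u \<in> carrier (free_mod R b)" "v \<in> carrier (free_mod R b)" for u v
  proof (rule free_eqI[where R = R])
    fix i assume i: "i < a"
    have "dot b (D i) (u \<oplus>\<^bsub>free_mod R b\<^esub> v) = dot b (D i) (\<lambda>j. u j \<oplus> v j)"
      using that i D by (intro dot_cong) (auto simp: free_add_nth mat_over_def)
    also have "\<dots> = dot b (D i) u \<oplus> dot b (D i) v"
      using that i D by (intro dot_add) (auto simp: mat_over_def)
    finally show "mv a b D (u \<oplus>\<^bsub>free_mod R b\<^esub> v) i = (mv a b D u \<oplus>\<^bsub>free_mod R a\<^esub> mv a b D v) i"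
      using i by (simp add: mv_nth free_add_nth)
  qed (use that D in auto)
  have 2: "mv a b D (c \<odot>\<^bsub>free_mod R b\<^esub> v) = c \<odot>\<^bsub>free_mod R a\<^esub> mv a b D v"
    if "c \<in> carrier R" "v \<in> carrier (free_mod R b)" for c v
  proof (rule free_eqI[where R = R])
    fix i assume i: "i < a"
    have "dot b (D i) (c \<odot>\<^bsub>free_mod R b\<^esub> v) = dot b (D i) (\<lambda>j. c \<otimes> v j)"
      using that i D by (intro dot_cong) (auto simp: free_smult_nth mat_over_def)
    also have "\<dots> = c \<otimes> dot b (D i) v"
      using that i D by (intro dot_smult) (auto simp: mat_over_def)
    finally show "mv a b D (c \<odot>\<^bsub>free_mod R b\<^esub> v) i = (c \<odot>\<^bsub>free_mod R a\<^esub> mv a b D v) i"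
      using i by (simp add: mv_nth free_smult_nth)
  qed (use that D in auto)
  show ?thesis
    using 1 2 D by (intro linear_map.intro linear_map_axioms.intro free_module)
      (auto simp: mod_hom_def hom_def)
qed

lemma mv_mod_hom: "mat_over R a b D \<Longrightarrow> mv a b D \<in> mod_hom R (free_mod R b) (free_mod R a)"
  using linear_map.mod_hom[OF mv_linear] .

lemma dot_assoc:
  assumes "\<And>i. i < a \<Longrightarrow> w i \<in> carrier R" "\<And>i j. i < a \<Longrightarrow> j < b \<Longrightarrow> D i j \<in> carrier R"
    "\<And>j. j < b \<Longrightarrow> v j \<in> carrier R"
  shows "dot a w (\<lambda>i. dot b (D i) v) = dot b (\<lambda>j. dot a w (\<lambda>i. D i j)) v"
proof -
  have "dot a w (\<lambda>i. dot b (D i) v) = (\<Oplus>i\<in>{..<a}. \<Oplus>j\<in>{..<b}. w i \<otimes> D i j \<otimes> v j)"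
    unfolding dot_def using assms
    by (intro finsum_cong') (auto intro!: finsum_closed finsum_cong' simp: finsum_rdistr m_assoc)
  also have "\<dots> = (\<Oplus>j\<in>{..<b}. \<Oplus>i\<in>{..<a}. w i \<otimes> D i j \<otimes> v j)"
    using assms by (intro finsum_swap) auto
  also have "\<dots> = dot b (\<lambda>j. dot a w (\<lambda>i. D i j)) v"
    unfolding dot_def using assms
    by (intro finsum_cong') (auto intro!: finsum_closed finsum_cong' simp: finsum_ldistr m_assoc)
  finally show ?thesis .
qed

text \<open>The transpose is the adjoint for the pairing \<open>dot\<close>. This converts
  statements about dual modules and kernels of transposes into orthogonality relations.\<close>

lemma mv_adjoint:
  assumes D: "mat_over R a b D" and w: "w \<in> carrier (free_mod R a)" and v: "v \<in> carrier (free_mod R b)"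
  shows "dot a w (mv a b D v) = dot b (mv b a (tr D) w) v"
proof -
  have "dot a w (mv a b D v) = dot a w (\<lambda>i. dot b (D i) v)"
    using assms by (intro dot_cong) (auto simp: mv_nth mat_over_def intro!: dot_closed)
  also have "\<dots> = dot b (\<lambda>j. dot a w (\<lambda>i. D i j)) v"
    using assms by (intro dot_assoc) (auto simp: mat_over_def)
  also have "\<dots> = dot b (mv b a (tr D) w) v"
    using assms by (intro dot_cong)
      (auto simp: mv_nth tr_def[abs_def] mat_over_def dot_comm[of a w] free_nth intro!: dot_closed)
  finally show ?thesis .
qed

lemma mat_over_mul:
  "mat_over R a b D \<Longrightarrow> mat_over R b c E \<Longrightarrow> mat_over R a c (mat_mul b D E)"
  by (auto simp: mat_over_def mat_mul_def intro!: dot_closed)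

lemma mv_mat_mul:
  assumes D: "mat_over R a b D" and E: "mat_over R b c E" and v: "v \<in> carrier (free_mod R c)"
  shows "mv a c (mat_mul b D E) v = mv a b D (mv b c E v)"
proof (rule free_eqI[where R = R])
  fix i assume i: "i < a"
  have "mv a b D (mv b c E v) i = dot b (D i) (\<lambda>l. dot c (E l) v)"
    unfolding mv_nth[OF i] using assms i by (intro dot_cong) (auto simp: mv_nth mat_over_def intro!: dot_closed)
  also have "\<dots> = dot c (\<lambda>j. dot b (D i) (\<lambda>l. E l j)) v"
    using assms i by (intro dot_assoc) (auto simp: mat_over_def)
  also have "\<dots> = mv a c (mat_mul b D E) v i"
    unfolding mv_nth[OF i] using assms i by (intro dot_cong) (auto simp: mat_mul_def mat_over_def intro!: dot_closed)
  finally show "mv a c (mat_mul b D E) v i = mv a b D (mv b c E v) i" by simp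
qed (use assms mat_over_mul[OF D E] in \<open>simp_all\<close>)

lemma mv_unit: "mat_over R a b D \<Longrightarrow> j < b \<Longrightarrow> mv a b D (unit_vec b j) = mat_col a D j"
  by (auto simp: mv_def mat_col_def dot_unit mat_over_def restrict_def)

lemma mat_col_closed: "mat_over R a b D \<Longrightarrow> j < b \<Longrightarrow> mat_col a D j \<in> carrier (free_mod R a)"
  by (auto simp: mat_col_def mat_over_def)

lemma mv_eq_zeroI:
  assumes D: "mat_over R a b D" and "v \<in> carrier (free_mod R b)" "\<And>i. i < a \<Longrightarrow> dot b (D i) v = \<zero>"
  shows "mv a b D v = \<zero>\<^bsub>free_mod R a\<^esub>"
  using assms by (intro free_eqI[of _ R a]) (auto simp: mv_nth free_zero_nth)

lemma mat_mul_zero_iff: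
  assumes D: "mat_over R a b D" and E: "mat_over R b c E"
  shows "(\<forall>i<a. \<forall>j<c. mat_mul b D E i j = \<zero>) \<longleftrightarrow>
    (\<forall>v \<in> carrier (free_mod R c). mv a b D (mv b c E v) = \<zero>\<^bsub>free_mod R a\<^esub>)"
proof
  assume z: "\<forall>i<a. \<forall>j<c. mat_mul b D E i j = \<zero>"
  show "\<forall>v \<in> carrier (free_mod R c). mv a b D (mv b c E v) = \<zero>\<^bsub>free_mod R a\<^esub>"
  proof
    fix v assume v: "v \<in> carrier (free_mod R c)"
    have "dot c (mat_mul b D E i) v = \<zero>" if "i < a" for i
      using z v that by (intro dot_eq_zero) (auto simp: free_nth)
    then show "mv a b D (mv b c E v) = \<zero>\<^bsub>free_mod R a\<^esub>"
      using mv_eq_zeroI[OF mat_over_mul[OF D E] v] mv_mat_mul[OF D E v] by simp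
  qed
next
  assume z: "\<forall>v \<in> carrier (free_mod R c). mv a b D (mv b c E v) = \<zero>\<^bsub>free_mod R a\<^esub>"
  show "\<forall>i<a. \<forall>j<c. mat_mul b D E i j = \<zero>"
  proof (intro allI impI)
    fix i j assume ij: "i < a" "j < c"
    have "mv a c (mat_mul b D E) (unit_vec c j) i = \<zero>"
      using z mv_mat_mul[OF D E, of "unit_vec c j"] ij by (simp add: free_zero_nth)
    then show "mat_mul b D E i j = \<zero>"
      using mv_unit[OF mat_over_mul[OF D E] ij(2)] ij by (simp add: mat_col_def)
  qed
qed

lemma mat_mul_tr:
  assumes D: "mat_over R a b D" and E: "mat_over R b c E" and "i < c" "j < a"
  shows "mat_mul b (tr E) (tr D) i j = mat_mul b D E j i"
  unfolding mat_mul_def tr_def using assms by (intro dot_comm) (auto simp: mat_over_def)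

lemma free_finsum_nth:
  assumes "finite A" "\<And>j. j \<in> A \<Longrightarrow> f j \<in> carrier (free_mod R n)" "i < n"
  shows "(\<Oplus>\<^bsub>free_mod R n\<^esub>j\<in>A. f j) i = (\<Oplus>j\<in>A. f j i)"
  using assms(1,2)
proof (induction A rule: finite_induct)
  case empty
  interpret F: module R "free_mod R n" by (rule free_module)
  show ?case using assms(3) by (simp add: free_zero_nth)
next
  case (insert a A)
  interpret F: module R "free_mod R n" by (rule free_module)
  have "(\<Oplus>\<^bsub>free_mod R n\<^esub>j\<in>insert a A. f j) = f a \<oplus>\<^bsub>free_mod R n\<^esub> (\<Oplus>\<^bsub>free_mod R n\<^esub>j\<in>A. f j)"
    using insert by (intro F.finsum_insert) auto
  moreover have "(\<Oplus>j\<in>insert a A. f j i) = f a i \<oplus> (\<Oplus>j\<in>A. f j i)"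
    using insert assms(3) by (intro finsum_insert) auto
  ultimately show ?case using insert assms(3) by (simp add: free_add_nth)
qed

lemma mv_eq_finsum:
  assumes D: "mat_over R a b D" and v: "v \<in> carrier (free_mod R b)"
  shows "mv a b D v = (\<Oplus>\<^bsub>free_mod R a\<^esub>j\<in>{..<b}. v j \<odot>\<^bsub>free_mod R a\<^esub> mat_col a D j)"
proof -
  interpret F: module R "free_mod R a" by (rule free_module)
  have c: "v j \<odot>\<^bsub>free_mod R a\<^esub> mat_col a D j \<in> carrier (free_mod R a)" if "j < b" for j
    using that v mat_col_closed[OF D] by (auto intro!: free_smult_closed)
  show ?thesis
  proof (rule free_eqI[where R = R])
    fix i assume i: "i < a"
    have "(\<Oplus>\<^bsub>free_mod R a\<^esub>j\<in>{..<b}. v j \<odot>\<^bsub>free_mod R a\<^esub> mat_col a D j) i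
        = (\<Oplus>j\<in>{..<b}. (v j \<odot>\<^bsub>free_mod R a\<^esub> mat_col a D j) i)"
      using c i by (intro free_finsum_nth) auto
    also have "\<dots> = dot b (D i) v"
      unfolding dot_def using i D v
      by (intro finsum_cong') (auto simp: free_smult_nth mat_col_def m_comm mat_over_def free_nth)
    finally show "mv a b D v i = (\<Oplus>\<^bsub>free_mod R a\<^esub>j\<in>{..<b}. v j \<odot>\<^bsub>free_mod R a\<^esub> mat_col a D j) i"
      using i by (simp add: mv_nth)
  qed (use D v c in \<open>auto intro!: F.finsum_closed\<close>)
qed

lemma free_eq_finsum_unit:
  assumes v: "v \<in> carrier (free_mod R n)"
  shows "v = (\<Oplus>\<^bsub>free_mod R n\<^esub>j\<in>{..<n}. v j \<odot>\<^bsub>free_mod R n\<^esub> unit_vec n j)"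
proof -
  define I where "I = (\<lambda>(i :: nat) j. if i = j then \<one> else \<zero>)"
  have I: "mat_over R n n I" by (auto simp: mat_over_def I_def)
  have cI: "mat_col n I j = unit_vec n j" for j by (auto simp: mat_col_def I_def unit_vec_def)
  have "mv n n I v = v"
  proof (rule free_eqI[where R = R])
    fix i assume i: "i < n"
    have "mv n n I v i = dot n v (unit_vec n i)"
      unfolding mv_nth[OF i] using i v
      by (subst dot_comm) (auto simp: I_def unit_vec_def intro!: dot_cong)
    then show "mv n n I v i = v i" using dot_unit[of n v i] v i by auto
  qed (use I v in auto)
  then show ?thesis using mv_eq_finsum[OF I v] cI by simp
qed

end

lemma (in linear_map) finsum_hom:
  assumes "finite A" "\<And>j. j \<in> A \<Longrightarrow> g j \<in> carrier M"
  shows "f (\<Oplus>\<^bsub>M\<^esub>j\<in>A. g j) = (\<Oplus>\<^bsub>N\<^esub>j\<in>A. f (g j))"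
  using assms
proof (induction A rule: finite_induct)
  case (insert a A)
  have "f (\<Oplus>\<^bsub>M\<^esub>j\<in>insert a A. g j) = f (g a \<oplus>\<^bsub>M\<^esub> (\<Oplus>\<^bsub>M\<^esub>j\<in>A. g j))"
    using insert by (subst M.M.finsum_insert) auto
  also have "\<dots> = f (g a) \<oplus>\<^bsub>N\<^esub> (\<Oplus>\<^bsub>N\<^esub>j\<in>A. f (g j))"
    using insert by (subst add) (auto intro!: M.M.finsum_closed)
  also have "\<dots> = (\<Oplus>\<^bsub>N\<^esub>j\<in>insert a A. f (g j))"
    using insert by (intro N.M.finsum_insert[symmetric]) auto
  finally show ?case .
qed simp

context cring
begin

lemma linear_on_free:
  assumes "linear_map R (free_mod R n) M f" "v \<in> carrier (free_mod R n)"
  shows "f v = (\<Oplus>\<^bsub>M\<^esub>j\<in>{..<n}. v j \<odot>\<^bsub>M\<^esub> f (unit_vec n j))"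
proof -
  interpret f: linear_map R "free_mod R n" M f by fact
  have "f v = (\<Oplus>\<^bsub>M\<^esub>j\<in>{..<n}. f (v j \<odot>\<^bsub>free_mod R n\<^esub> unit_vec n j))"
    by (subst free_eq_finsum_unit[OF assms(2)], rule f.finsum_hom) (use assms(2) in auto)
  also have "\<dots> = (\<Oplus>\<^bsub>M\<^esub>j\<in>{..<n}. v j \<odot>\<^bsub>M\<^esub> f (unit_vec n j))"
    using assms(2) by (intro f.N.M.finsum_cong') (auto simp: f.smult free_nth intro!: f.N.smult_closed)
  finally show ?thesis .
qed

lemma self_finsum: "finite A \<Longrightarrow> f \<in> A \<rightarrow> carrier R \<Longrightarrow> (\<Oplus>\<^bsub>self_mod R\<^esub>j\<in>A. f j) = (\<Oplus>j\<in>A. f j)"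
proof (induction A rule: finite_induct)
  case empty
  interpret self: module R "self_mod R" by (rule self_module)
  show ?case by simp
next
  case (insert a A)
  interpret self: module R "self_mod R" by (rule self_module)
  have "(\<Oplus>\<^bsub>self_mod R\<^esub>j\<in>insert a A. f j) = f a \<oplus>\<^bsub>self_mod R\<^esub> (\<Oplus>\<^bsub>self_mod R\<^esub>j\<in>A. f j)"
    using insert by (intro self.M.finsum_insert) auto
  also have "\<dots> = f a \<oplus> (\<Oplus>j\<in>A. f j)" using insert by auto
  finally show ?case using insert by (subst finsum_insert) auto
qed

lemma functional_eq_dot:
  assumes "linear_map R (free_mod R n) (self_mod R) f" "v \<in> carrier (free_mod R n)"
  shows "f v = dot n (\<lambda>j\<in>{..<n}. f (unit_vec n j)) v"
proof -
  interpret f: linear_map R "free_mod R n" "self_mod R" f by fact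
  have c: "f (unit_vec n j) \<in> carrier R" for j using f.closed[OF unit_vec_closed] by simp
  have "f v = (\<Oplus>j\<in>{..<n}. v j \<otimes> f (unit_vec n j))"
    using linear_on_free[OF assms] assms(2) c by (subst self_finsum[symmetric]) (auto intro!: m_closed)
  also have "\<dots> = dot n (\<lambda>j\<in>{..<n}. f (unit_vec n j)) v"
    unfolding dot_def using assms(2) c by (intro finsum_cong') (auto simp: m_comm free_nth)
  finally show ?thesis .
qed

lemma dot_linear:
  assumes y: "y \<in> carrier (free_mod R n)"
  shows "linear_map R (free_mod R n) (self_mod R) (dot n y)"
proof -
  have 1: "dot n y (u \<oplus>\<^bsub>free_mod R n\<^esub> v) = dot n y u \<oplus> dot n y v"
    if "u \<in> carrier (free_mod R n)" "v \<in> carrier (free_mod R n)" for u v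
  proof -
    have "dot n y (u \<oplus>\<^bsub>free_mod R n\<^esub> v) = dot n y (\<lambda>i. u i \<oplus> v i)"
      using that y by (intro dot_cong) (auto simp: free_add_nth)
    then show ?thesis using that y by (subst (asm) dot_add) auto
  qed
  have 2: "dot n y (c \<odot>\<^bsub>free_mod R n\<^esub> v) = c \<otimes> dot n y v"
    if "v \<in> carrier (free_mod R n)" "c \<in> carrier R" for c v
  proof -
    have "dot n y (c \<odot>\<^bsub>free_mod R n\<^esub> v) = dot n y (\<lambda>i. c \<otimes> v i)"
      using that y by (intro dot_cong) (auto simp: free_smult_nth)
    then show ?thesis using that y by (subst (asm) dot_smult) auto
  qed
  show ?thesis
    using 1 2 y by (intro linear_map.intro linear_map_axioms.intro free_module self_module)
      (auto simp: mod_hom_def hom_def free_nth)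
qed

lemma nth_linear:
  assumes "i < n" shows "linear_map R (free_mod R n) (self_mod R) (\<lambda>v. v i)"
  using assms by (intro linear_map.intro linear_map_axioms.intro free_module self_module)
    (auto simp: mod_hom_def hom_def free_nth free_add_nth free_smult_nth)

lemma mat_of_columns:
  assumes "\<And>j. j < b \<Longrightarrow> w j \<in> carrier (free_mod R a)"
  shows "mat_over R a b (\<lambda>i j. w j i)" "\<And>j. j < b \<Longrightarrow> mat_col a (\<lambda>i j. w j i) j = w j"
proof -
  show "mat_over R a b (\<lambda>i j. w j i)" using assms by (auto simp: mat_over_def)
  fix j assume "j < b"
  then show "mat_col a (\<lambda>i j. w j i) j = w j"
    using assms[of j] by (intro free_eqI[of _ R a]) (auto simp: mat_col_def)
qed

section \<open>Images and kernels of matrices\<close>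

definition im :: "nat \<Rightarrow> nat \<Rightarrow> (nat \<Rightarrow> nat \<Rightarrow> 'a) \<Rightarrow> (nat \<Rightarrow> 'a) set" where
  "im a b D = mv a b D ` carrier (free_mod R b)"

definition kr :: "nat \<Rightarrow> nat \<Rightarrow> (nat \<Rightarrow> nat \<Rightarrow> 'a) \<Rightarrow> (nat \<Rightarrow> 'a) set" where
  "kr a b D = {v \<in> carrier (free_mod R b). mv a b D v = \<zero>\<^bsub>free_mod R a\<^esub>}"

lemma kr_eq_ker: "mat_over R a b D \<Longrightarrow> linear_map.ker (free_mod R b) (free_mod R a) (mv a b D) = kr a b D"
  by (auto simp: kr_def linear_map.ker_def[OF mv_linear])

lemma kr_submodule: "mat_over R a b D \<Longrightarrow> submodule (kr a b D) R (free_mod R b)"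
  using linear_map.ker_submodule[OF mv_linear] kr_eq_ker by metis

lemma im_submodule: "mat_over R a b D \<Longrightarrow> submodule (im a b D) R (free_mod R a)"
  unfolding im_def by (rule linear_map.image_submodule[OF mv_linear module.carrier_is_submodule[OF free_module]])

lemma im_closed: "mat_over R a b D \<Longrightarrow> im a b D \<subseteq> carrier (free_mod R a)"
  by (auto simp: im_def)

lemma col_in_im: "mat_over R a b D \<Longrightarrow> j < b \<Longrightarrow> mat_col a D j \<in> im a b D"
  unfolding im_def using mv_unit[of a b D j] unit_vec_closed by (metis image_eqI)

lemma submodule_finsum:
  assumes "module R M" "submodule H R M" "finite A" "\<And>j. j \<in> A \<Longrightarrow> f j \<in> H"
  shows "(\<Oplus>\<^bsub>M\<^esub>j\<in>A. f j) \<in> H"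
  using assms(3,4)
proof (induction A rule: finite_induct)
  case empty
  interpret M: module R M by fact
  show ?case using M.submodule_zero[OF assms(2)] by simp
next
  case (insert a A)
  interpret M: module R M by fact
  have "H \<subseteq> carrier M" using M.submoduleE(1)[OF assms(2)] .
  then have "(\<Oplus>\<^bsub>M\<^esub>j\<in>insert a A. f j) = f a \<oplus>\<^bsub>M\<^esub> (\<Oplus>\<^bsub>M\<^esub>j\<in>A. f j)"
    using insert by (intro M.M.finsum_insert) auto
  then show ?case using insert M.submoduleE(5)[OF assms(2)] by auto
qed

lemma im_least:
  assumes D: "mat_over R a b D" and H: "submodule H R (free_mod R a)" and cols: "\<And>j. j < b \<Longrightarrow> mat_col a D j \<in> H"
  shows "im a b D \<subseteq> H"
proof
  interpret F: module R "free_mod R a" by (rule free_module)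
  fix x assume "x \<in> im a b D"
  then obtain v where v: "v \<in> carrier (free_mod R b)" "x = mv a b D v" by (auto simp: im_def)
  have "(\<Oplus>\<^bsub>free_mod R a\<^esub>j\<in>{..<b}. v j \<odot>\<^bsub>free_mod R a\<^esub> mat_col a D j) \<in> H"
    using F.submoduleE(4)[OF H] cols v(1) by (intro submodule_finsum[OF free_module H]) (auto simp: free_nth)
  then show "x \<in> H" using mv_eq_finsum[OF D v(1)] v(2) by simp
qed

lemma span_eq_im:
  assumes D: "mat_over R a b D"
  shows "mod_span R (free_mod R a) (mat_col a D ` {..<b}) = im a b D"
  unfolding mod_span_def
proof (rule subset_antisym)
  show "\<Inter> {N. submodule N R (free_mod R a) \<and> mat_col a D ` {..<b} \<subseteq> N} \<subseteq> im a b D"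
    using im_submodule[OF D] col_in_im[OF D] by auto
  show "im a b D \<subseteq> \<Inter> {N. submodule N R (free_mod R a) \<and> mat_col a D ` {..<b} \<subseteq> N}"
    using im_least[OF D] by blast
qed

lemma im_subset_kr_iff:
  assumes D: "mat_over R a b D" and E: "mat_over R b c E"
  shows "im b c E \<subseteq> kr a b D \<longleftrightarrow> (\<forall>i<a. \<forall>j<c. mat_mul b D E i j = \<zero>)"
  unfolding mat_mul_zero_iff[OF D E] using E by (auto simp: im_def kr_def)

text \<open>DE = 0 gives zero for the product of the transposes in reverse order, so one inclusion
  in the exactness of a dual sequence is automatic.\<close>

lemma im_subset_kr_tr:
  assumes D: "mat_over R a b D" and E: "mat_over R b c E" and "im b c E \<subseteq> kr a b D"
  shows "im b a (tr D) \<subseteq> kr c b (tr E)"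
proof -
  have "mat_over R c b (tr E)" "mat_over R b a (tr D)" using D E by simp_all
  then show ?thesis
    using assms(3) mat_mul_tr[OF D E] by (simp add: im_subset_kr_iff[OF D E] im_subset_kr_iff)
qed

end

section \<open>Local rings with vanishing cube of the maximal ideal\<close>

lemma (in cring) ideal_iff_submodule: "ideal I R \<longleftrightarrow> submodule I R (self_mod R)"
proof
  interpret self: module R "self_mod R" by (rule self_module)
  assume "ideal I R"
  then interpret I: ideal I R .
  show "submodule I R (self_mod R)"
    using I.Icarr I.I_l_closed by (intro self.submoduleI') auto
next
  interpret self: module R "self_mod R" by (rule self_module)
  assume I: "submodule I R (self_mod R)"
  note E = self.submoduleE[OF I]
  have sub: "I \<subseteq> carrier R" using E(1) by simp
  have neg: "\<ominus> a \<in> I" if "a \<in> I" for a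
    using E(4)[of "\<ominus> \<one>" a] that sub by (auto simp: l_minus)
  show "ideal I R"
  proof (rule idealI[OF ring_axioms])
    show "subgroup I (add_monoid R)"
      using self.submodule_zero[OF I] E(5) sub neg by (intro subgroup.intro) (auto simp: a_inv_def)
  next
    fix a x assume "a \<in> I" "x \<in> carrier R"
    then show "x \<otimes> a \<in> I" "a \<otimes> x \<in> I" using E(4)[of x a] sub m_comm[of x a] by auto
  qed
qed

locale short_local = cring R for R (structure) +
  fixes m
  assumes noetherian: "noetherian_ring R"
    and maximal: "maximalideal m R"
    and cube: "m \<cdot> m \<cdot> m = {\<zero>}"
    and square: "m \<cdot> m \<noteq> {\<zero>}"
begin

sublocale m: ideal m R
  using maximal by (simp add: maximalideal_def)

abbreviation m2 where "m2 \<equiv> m \<cdot> m"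

sublocale m2: ideal "m \<cdot> m" R
  using ideal_prod_is_ideal m.ideal_axioms by blast

interpretation self: module R "self_mod R" by (rule self_module)

lemma m_sub: "submodule m R (self_mod R)" and m2_sub: "submodule m2 R (self_mod R)"
  using m.ideal_axioms m2.ideal_axioms ideal_iff_submodule by auto

lemma m2_le: "m2 \<subseteq> m"
  using ideal_prod_inter[OF m.ideal_axioms m.ideal_axioms] by blast

lemma mm: "x \<in> m \<Longrightarrow> y \<in> m \<Longrightarrow> x \<otimes> y \<in> m2"
  by (rule ideal_prod.prod)

lemma m2m: "x \<in> m2 \<Longrightarrow> y \<in> m \<Longrightarrow> x \<otimes> y = \<zero>"
  using ideal_prod.prod[of x m2 y m R] cube by auto

lemma mm2: "x \<in> m \<Longrightarrow> y \<in> m2 \<Longrightarrow> x \<otimes> y = \<zero>"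
  using m2m[of y x] m_comm[of x y] by simp

lemma one_notin_m: "\<one> \<notin> m"
  using maximalideal.I_notcarr[OF maximal] m.one_imp_carrier by auto

text \<open>For x outside m, maximality gives rx = 1 - a with a in m, and 1 + a + a^2 inverts 1 - a
  because a^3 = 0.\<close>

lemma unit_iff: "x \<in> carrier R \<Longrightarrow> x \<in> Units R \<longleftrightarrow> x \<notin> m"
proof
  assume x: "x \<in> carrier R" "x \<notin> m"
  define J where "J = add_cyclic R (self_mod R) m x"
  have J: "submodule J R (self_mod R)" "m \<subseteq> J" "x \<in> J"
    unfolding J_def using x self.add_cyclic_submodule[OF m_sub] self.add_cyclic_superset[OF m_sub] by auto
  then have "J = carrier R"
    using maximalideal.I_maximal[OF maximal, of J] x ideal_iff_submodule self.submoduleE(1)[OF J(1)] by auto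
  then have "\<one> \<in> J" by simp
  then obtain a r where a: "a \<in> m" "r \<in> carrier R" "\<one> = a \<oplus> r \<otimes> x" by (auto simp: J_def add_cyclic_def)
  have ac: "a \<in> carrier R" using a by simp
  have z: "a \<otimes> a \<otimes> a = \<zero>" using m2m[OF mm] a by blast
  have "r \<otimes> x = \<one> \<ominus> a" using a x ac
    by (metis a_comm a_minus_def add.inv_solve_right m_closed one_closed)
  then have "(r \<otimes> x) \<otimes> (\<one> \<oplus> a \<oplus> a \<otimes> a) = (\<one> \<ominus> a) \<otimes> (\<one> \<oplus> a \<oplus> a \<otimes> a)" by simp
  also have "\<dots> = \<one> \<ominus> a \<otimes> a \<otimes> a" using ac by algebra
  finally have "(r \<otimes> x) \<otimes> (\<one> \<oplus> a \<oplus> a \<otimes> a) = \<one>" using z by (simp add: a_minus_def)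
  then have "x \<otimes> (r \<otimes> (\<one> \<oplus> a \<oplus> a \<otimes> a)) = \<one>" using x a ac by (simp add: m_ac)
  then show "x \<in> Units R" using x a ac
    by (metis Units_one_closed a_closed m_closed one_closed unit_factor)
next
  assume "x \<in> carrier R" "x \<in> Units R"
  then show "x \<notin> m" using one_notin_m m.I_l_closed[of x "inv x"] by auto
qed

lemma nonunit: "r \<in> carrier R - Units R \<Longrightarrow> r \<in> m"
  using unit_iff by blast

text \<open>The quotient I/A is killed by m and I has finitely many generators, each of which adds
  at most one to the length. Applied to 0 \<subseteq> \<open>m2\<close> \<subseteq>
  \<open>m\<close>, this gives the ideals finite length.\<close>

lemma flen_extend:
  assumes "flen R (self_mod R) A" "ideal I R" "\<And>x y. x \<in> m \<Longrightarrow> y \<in> I \<Longrightarrow> x \<otimes> y \<in> A"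
  shows "flen R (self_mod R) I"
proof -
  obtain S where S: "S \<subseteq> carrier R" "finite S" "I = Idl S"
    using noetherian_ring.finetely_gen[OF noetherian assms(2)] by blast
  have SI: "S \<subseteq> I" using genideal_self[OF S(1)] S(3) by simp
  have "\<exists>B. flen R (self_mod R) B \<and> A \<subseteq> B \<and> S \<subseteq> B"
    using S(2) SI
  proof (induction S rule: finite_induct)
    case (insert x S)
    then obtain B where B: "flen R (self_mod R) B" "A \<subseteq> B" "S \<subseteq> B" by auto
    have x: "x \<in> carrier (self_mod R)" using insert ideal.Icarr[OF assms(2)] by auto
    have "flen R (self_mod R) (add_cyclic R (self_mod R) B x)"
    proof (rule self.flen_add_cyclic(1)[OF B(1) x])
      fix r assume "r \<in> carrier R - Units R"
      then show "r \<odot>\<^bsub>self_mod R\<^esub> x \<in> B" using nonunit assms(3) insert B by auto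
    qed
    then show ?case
      using B self.add_cyclic_superset[OF self.flen_submodule[OF B(1)] x] by blast
  qed (use assms(1) in auto)
  then obtain B where B: "flen R (self_mod R) B" "S \<subseteq> B" by blast
  then have "I \<subseteq> B" using genideal_minimal[of B S] S(3) self.flen_submodule ideal_iff_submodule by auto
  then show ?thesis using self.flen_mono[OF B(1)] ideal_iff_submodule assms(2) by blast
qed

lemma flen_m: "flen R (self_mod R) m"
proof -
  have "flen R (self_mod R) m2"
    using flen_extend[of "{\<zero>}" m2] self.flen_zero mm2 m2.ideal_axioms by auto
  then show ?thesis
    using flen_extend[of m2 m] mm m.ideal_axioms by auto
qed

lemma carrier_eq_add_cyclic: "carrier R = add_cyclic R (self_mod R) m \<one>"
proof -
  have "add_cyclic R (self_mod R) m \<one> \<subseteq> carrier R"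
    using self.submoduleE(1)[OF self.add_cyclic_submodule[OF m_sub]] by simp
  moreover have "x \<in> add_cyclic R (self_mod R) m \<one>" if "x \<in> carrier R" for x
  proof -
    have "x = \<zero> \<oplus> x \<otimes> \<one>" using that by simp
    then show ?thesis using that m.zero_closed unfolding add_cyclic_def self_mod_simps by blast
  qed
  ultimately show ?thesis by blast
qed

lemma flen_R: "flen R (self_mod R) (carrier R)"
  and len_R_m: "len R (self_mod R) (carrier R) = len R (self_mod R) m + 1"
proof -
  have *: "r \<odot>\<^bsub>self_mod R\<^esub> \<one> \<in> m" if "r \<in> carrier R - Units R" for r
    using that nonunit by auto
  show "flen R (self_mod R) (carrier R)"
    using self.flen_add_cyclic(1)[OF flen_m _ *] carrier_eq_add_cyclic by auto
  show "len R (self_mod R) (carrier R) = len R (self_mod R) m + 1"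
    using self.flen_add_cyclic(3)[OF flen_m _ * one_notin_m] carrier_eq_add_cyclic by auto
qed

lemma flen_self: "submodule I R (self_mod R) \<Longrightarrow> flen R (self_mod R) I"
  using self.flen_mono[OF flen_R] self.submoduleE(1) by auto

text \<open>Since m kills m^2 and m/m^2, these two lengths are dimensions over the residue field.
  The name anticipates \<open>socle_eq_m2\<close>, by which \<open>m2\<close> is the socle in the
  situation of interest. The subtraction in \<open>embdim\<close> is not truncated, as
  \<open>m2\<close> lies in \<open>m\<close>.\<close>

definition socdim :: nat where "socdim = len R (self_mod R) m2"
definition embdim :: nat where "embdim = len R (self_mod R) m - socdim"

lemma len_m2: "len R (self_mod R) m2 = socdim"
  by (simp add: socdim_def)

lemma len_m: "len R (self_mod R) m = embdim + socdim"
  using self.len_mono[OF flen_m m2_sub m2_le] by (simp add: embdim_def socdim_def)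

lemma len_R: "len R (self_mod R) (carrier R) = 1 + embdim + socdim"
  using len_R_m len_m by simp

lemma socdim_pos: "0 < socdim"
  using self.len_eq_0_iff[OF flen_self[OF m2_sub]] square by (auto simp: socdim_def)

lemma R_sub: "submodule (carrier R) R (self_mod R)"
  using self.carrier_is_submodule by simp

lemma zero_sub: "submodule {\<zero>} R (self_mod R)"
  using self.zero_submodule by simp

subsection \<open>Products of ideals inside a free module\<close>

definition box :: "nat \<Rightarrow> (nat \<Rightarrow> 'a set) \<Rightarrow> (nat \<Rightarrow> 'a) set" where
  "box n J = {v \<in> carrier (free_mod R n). \<forall>i<n. v i \<in> J i}"

lemma box_submodule:
  assumes "\<And>i. i < n \<Longrightarrow> submodule (J i) R (self_mod R)"
  shows "submodule (box n J) R (free_mod R n)"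
proof -
  interpret F: module R "free_mod R n" by (rule free_module)
  show ?thesis
    using self.submoduleE[OF assms] self.submodule_zero[OF assms]
    by (intro F.submoduleI') (auto simp: box_def free_add_nth free_smult_nth free_zero_nth)
qed

text \<open>The coordinates are switched on one at a time: the projection to coordinate
  \<open>j\<close> maps each box onto \<open>J j\<close>, with the preceding box as kernel.\<close>

lemma box_len_aux:
  assumes J: "\<And>i. i < n \<Longrightarrow> submodule (J i) R (self_mod R)" and "j \<le> n"
  shows "flen R (free_mod R n) (box n (\<lambda>i. if i < j then J i else {\<zero>})) \<and>
    len R (free_mod R n) (box n (\<lambda>i. if i < j then J i else {\<zero>})) = (\<Sum>i<j. len R (self_mod R) (J i))"
  using assms(2)
proof (induction j)
  case 0
  interpret F: module R "free_mod R n" by (rule free_module)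
  have "box n (\<lambda>i. {\<zero>}) = {\<zero>\<^bsub>free_mod R n\<^esub>}"
    by (auto simp: box_def free_zero_nth intro!: free_eqI[of _ R n])
  then show ?case by simp
next
  case (Suc j)
  let ?B = "\<lambda>j. box n (\<lambda>i. if i < j then J i else {\<zero>})"
  have j: "j < n" using Suc by simp
  interpret f: linear_map R "free_mod R n" "self_mod R" "\<lambda>v. v j"
    using nth_linear[OF j] .
  have B: "submodule (?B (Suc j)) R (free_mod R n)" using J zero_sub by (intro box_submodule) auto
  have k: "?B (Suc j) \<inter> f.ker = ?B j"
  proof (rule subset_antisym; rule subsetI)
    fix x assume "x \<in> ?B (Suc j) \<inter> f.ker"
    then have x: "x \<in> carrier (free_mod R n)" "x j = \<zero>"
      "\<And>i. i < n \<Longrightarrow> x i \<in> (if i < Suc j then J i else {\<zero>})" by (auto simp: box_def f.ker_def)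
    have "x i \<in> (if i < j then J i else {\<zero>})" if "i < n" for i
      using x(2) x(3)[OF that] by (cases "i = j") (auto simp: less_Suc_eq)
    then show "x \<in> ?B j" using x(1) by (simp add: box_def)
  next
    fix x assume x: "x \<in> ?B j"
    then have "x j = \<zero>" using j by (auto simp: box_def)
    moreover have "\<zero> \<in> J j" using self.submodule_zero[OF J[OF j]] by simp
    ultimately show "x \<in> ?B (Suc j) \<inter> f.ker" using x by (auto simp: box_def f.ker_def less_Suc_eq)
  qed
  have i: "(\<lambda>v. v j) ` ?B (Suc j) = J j"
  proof
    show "(\<lambda>v. v j) ` ?B (Suc j) \<subseteq> J j" using j by (auto simp: box_def)
    show "J j \<subseteq> (\<lambda>v. v j) ` ?B (Suc j)"
    proof
      fix a assume a: "a \<in> J j"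
      have ac: "a \<in> carrier R" using a self.submoduleE(1)[OF J[OF j]] by auto
      define v where "v = (\<lambda>i\<in>{..<n}. if i = j then a else \<zero>)"
      have "v \<in> ?B (Suc j)" using a ac self.submodule_zero[OF J] j
        by (auto simp: box_def v_def free_mod_carrier less_Suc_eq)
      moreover have "v j = a" using j by (simp add: v_def)
      ultimately show "a \<in> (\<lambda>v. v j) ` ?B (Suc j)" by blast
    qed
  qed
  have "flen R (free_mod R n) (?B (Suc j))"
    using f.flen_rank_nullity(1)[OF B] k i Suc flen_self[OF J[OF j]] by simp
  then show ?case using f.flen_rank_nullity(2)[OF B] k i Suc by simp
qed

lemma len_box:
  assumes J: "\<And>i. i < n \<Longrightarrow> submodule (J i) R (self_mod R)"
  shows "len R (free_mod R n) (box n J) = (\<Sum>i<n. len R (self_mod R) (J i))"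
proof -
  have "box n (\<lambda>i. if i < n then J i else {\<zero>}) = box n J" by (auto simp: box_def)
  then show ?thesis using box_len_aux[of n J n] J by simp
qed

lemma box_carrier: "box n (\<lambda>_. carrier R) = carrier (free_mod R n)"
  by (auto simp: box_def)

lemma flen_free: "submodule A R (free_mod R n) \<Longrightarrow> flen R (free_mod R n) A"
proof -
  interpret F: module R "free_mod R n" by (rule free_module)
  have "box n (\<lambda>i. if i < n then carrier R else {\<zero>}) = carrier (free_mod R n)"
    by (auto simp: box_def)
  then have "flen R (free_mod R n) (carrier (free_mod R n))"
    using box_len_aux[where J = "\<lambda>_. carrier R" and n = n and j = n] R_sub by simp
  then show "submodule A R (free_mod R n) \<Longrightarrow> flen R (free_mod R n) A"
    using F.flen_mono F.submoduleE(1) by blast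
qed

abbreviation lenF :: "nat \<Rightarrow> (nat \<Rightarrow> 'a) set \<Rightarrow> nat" where "lenF n \<equiv> len R (free_mod R n)"

definition mF :: "nat \<Rightarrow> (nat \<Rightarrow> 'a) set" where "mF n = box n (\<lambda>_. m)"
definition m2F :: "nat \<Rightarrow> (nat \<Rightarrow> 'a) set" where "m2F n = box n (\<lambda>_. m2)"

lemma mF_sub: "submodule (mF n) R (free_mod R n)" and m2F_sub: "submodule (m2F n) R (free_mod R n)"
  using m_sub m2_sub by (auto simp: mF_def m2F_def intro: box_submodule)

lemma free_sub: "submodule (carrier (free_mod R n)) R (free_mod R n)"
  by (rule module.carrier_is_submodule[OF free_module])

lemma len_mF: "lenF n (mF n) = n * (embdim + socdim)"
  by (simp add: mF_def len_box m_sub len_m)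

lemma len_m2F: "lenF n (m2F n) = n * socdim"
  by (simp add: m2F_def len_box m2_sub len_m2)

lemma len_free: "lenF n (carrier (free_mod R n)) = n * (1 + embdim + socdim)"
  using len_box[of n "\<lambda>_. carrier R"] R_sub by (simp add: box_carrier len_R)

lemma lenF_mono: "submodule B R (free_mod R n) \<Longrightarrow> submodule A R (free_mod R n) \<Longrightarrow> A \<subseteq> B \<Longrightarrow> lenF n A \<le> lenF n B"
  by (rule module.len_mono[OF free_module flen_free])

lemma lenF_eq:
  "submodule B R (free_mod R n) \<Longrightarrow> submodule A R (free_mod R n) \<Longrightarrow> A \<subseteq> B \<Longrightarrow> lenF n B \<le> lenF n A \<Longrightarrow> A = B"
  by (rule module.len_eq_imp_eq[OF free_module flen_free])

lemma mF_closed: "mF n \<subseteq> carrier (free_mod R n)" and m2F_closed: "m2F n \<subseteq> carrier (free_mod R n)"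
  by (auto simp: mF_def m2F_def box_def)

lemma mv_len:
  assumes D: "mat_over R a b D" and A: "submodule A R (free_mod R b)"
  shows "lenF b A = lenF b (A \<inter> kr a b D) + lenF a (mv a b D ` A)"
  using linear_map.flen_rank_nullity(2)[OF mv_linear[OF D] A flen_free[OF A]] kr_eq_ker[OF D] by simp

lemma mv_len_full:
  assumes D: "mat_over R a b D"
  shows "lenF b (kr a b D) + lenF a (im a b D) = b * (1 + embdim + socdim)"
proof -
  have "carrier (free_mod R b) \<inter> kr a b D = kr a b D" by (auto simp: kr_def)
  then show ?thesis using mv_len[OF D free_sub] by (simp add: im_def len_free)
qed

lemma mv_image_sub:
  assumes D: "mat_over R a b D" and A: "submodule A R (free_mod R b)"
  shows "submodule (mv a b D ` A) R (free_mod R a)"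
  by (rule linear_map.image_submodule[OF mv_linear[OF D] A])

subsection \<open>Matrices over the maximal ideal\<close>

definition mat_m :: "nat \<Rightarrow> nat \<Rightarrow> (nat \<Rightarrow> nat \<Rightarrow> 'a) \<Rightarrow> bool" where
  "mat_m a b D \<longleftrightarrow> (\<forall>i<a. \<forall>j<b. D i j \<in> m)"

lemma mat_m_over: "mat_m a b D \<Longrightarrow> mat_over R a b D"
  by (auto simp: mat_m_def mat_over_def)

lemma mat_m_tr [simp]: "mat_m a b (tr D) \<longleftrightarrow> mat_m b a D"
  by (auto simp: mat_m_def tr_def)

lemma dot_in:
  assumes "submodule I R (self_mod R)" "\<And>i. i < k \<Longrightarrow> u i \<otimes> v i \<in> I"
  shows "dot k u v \<in> I"
proof -
  have "I \<subseteq> carrier R" using self.submoduleE(1)[OF assms(1)] by simp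
  then have "dot k u v = (\<Oplus>\<^bsub>self_mod R\<^esub>i\<in>{..<k}. u i \<otimes> v i)"
    unfolding dot_def using assms(2) by (subst self_finsum) auto
  then show ?thesis using submodule_finsum[OF self_module assms(1), of "{..<k}" "\<lambda>i. u i \<otimes> v i"] assms(2) by auto
qed

lemma mv_in_mF:
  assumes D: "mat_m a b D" and v: "v \<in> carrier (free_mod R b)"
  shows "mv a b D v \<in> mF a"
proof -
  have "dot b (D i) v \<in> m" if "i < a" for i
    using D v that by (intro dot_in[OF m_sub]) (auto simp: mat_m_def free_nth m.I_r_closed)
  then show ?thesis using v mat_m_over[OF D] by (simp add: mF_def box_def mv_nth)
qed

lemma mv_in_m2F:
  assumes D: "mat_m a b D" and v: "v \<in> mF b"
  shows "mv a b D v \<in> m2F a"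
proof -
  have "dot b (D i) v \<in> m2" if "i < a" for i
    using D v that by (intro dot_in[OF m2_sub]) (auto simp: mat_m_def mF_def box_def mm)
  moreover have "v \<in> carrier (free_mod R b)" using v mF_closed by blast
  ultimately show ?thesis using mat_m_over[OF D] by (simp add: m2F_def box_def mv_nth)
qed

lemma m2F_subset_kr:
  assumes D: "mat_m a b D"
  shows "m2F b \<subseteq> kr a b D"
proof
  fix v assume v: "v \<in> m2F b"
  have "dot b (D i) v = \<zero>" if "i < a" for i
    using D v that by (intro dot_eq_zero) (auto simp: mat_m_def m2F_def box_def mm2)
  then show "v \<in> kr a b D" using mv_eq_zeroI[OF mat_m_over[OF D]] v m2F_closed by (auto simp: kr_def)
qed

lemma im_subset_mF: "mat_m a b D \<Longrightarrow> im a b D \<subseteq> mF a"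
  using mv_in_mF by (auto simp: im_def)

lemma im_subset_mF_iff: "mat_over R a b D \<Longrightarrow> im a b D \<subseteq> mF a \<longleftrightarrow> mat_m a b D"
proof
  assume D: "mat_over R a b D" and i: "im a b D \<subseteq> mF a"
  show "mat_m a b D" unfolding mat_m_def
  proof (intro allI impI)
    fix i j assume ij: "i < a" "j < b"
    have "mat_col a D j \<in> mF a" using col_in_im[OF D ij(2)] i by blast
    then show "D i j \<in> m" using ij by (auto simp: mF_def box_def mat_col_def)
  qed
qed (use im_subset_mF in auto)

end

subsection \<open>Generators\<close>

context short_local
begin

lemma adjoin_column:
  assumes D: "mat_over R a b D" and x: "x \<in> carrier (free_mod R a)"
  obtains D' where "mat_over R a (Suc b) D'" "im a b D \<subseteq> im a (Suc b) D'" "x \<in> im a (Suc b) D'"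
    "\<And>H. submodule H R (free_mod R a) \<Longrightarrow> im a b D \<subseteq> H \<Longrightarrow> x \<in> H \<Longrightarrow> im a (Suc b) D' \<subseteq> H"
proof -
  define D' where "D' = (\<lambda>i j. if j < b then D i j else x i)"
  have D': "mat_over R a (Suc b) D'" using D x by (auto simp: D'_def mat_over_def free_nth)
  have c1: "mat_col a D' j = mat_col a D j" if "j < b" for j using that by (auto simp: mat_col_def D'_def)
  have c2: "mat_col a D' b = x"
    using x D' by (intro free_eqI[of _ R a]) (auto simp: mat_col_def D'_def free_nth)
  show ?thesis
  proof
    show "im a b D \<subseteq> im a (Suc b) D'"
      using col_in_im[OF D'] c1 by (intro im_least[OF D im_submodule[OF D']]) (metis less_SucI)
    show "x \<in> im a (Suc b) D'" using col_in_im[OF D', of b] c2 by simp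
    fix H assume "submodule H R (free_mod R a)" "im a b D \<subseteq> H" "x \<in> H"
    then show "im a (Suc b) D' \<subseteq> H"
      using im_least[OF D'] c1 c2 col_in_im[OF D] by (metis less_Suc_eq subsetD)
  qed (rule D')
qed

text \<open>Among the matrices with columns in \<open>H\<close>, one whose image has maximal length
  is taken. An element of \<open>H\<close> outside that image could be adjoined as a further column
  and would increase the length.\<close>

lemma exists_matrix:
  assumes H: "submodule H R (free_mod R a)"
  shows "\<exists>b D. mat_over R a b D \<and> im a b D = H"
proof -
  interpret F: module R "free_mod R a" by (rule free_module)
  let ?P = "\<lambda>k. \<exists>b D. mat_over R a b D \<and> im a b D \<subseteq> H \<and> k = lenF a (im a b D)"
  have "im a 0 D \<subseteq> H" for D
    using im_least[of a 0 D H] H by (auto simp: mat_over_def)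
  then have ex: "?P (lenF a (im a 0 (\<lambda>_ _. \<zero>)))"
    by (intro exI[of _ 0] exI[of _ "\<lambda>_ _. \<zero>"]) (auto simp: mat_over_def)
  have bound: "?P k \<Longrightarrow> k \<le> lenF a H" for k
    using lenF_mono[OF H im_submodule] by auto
  obtain k where k: "?P k" "\<And>l. ?P l \<Longrightarrow> l \<le> k"
    using GreatestI_nat[of ?P, OF ex bound] Greatest_le_nat[of ?P _ "lenF a H", OF _ bound] by blast
  then obtain b D where D: "mat_over R a b D" "im a b D \<subseteq> H" "k = lenF a (im a b D)" by blast
  have "im a b D = H"
  proof (rule ccontr)
    assume "im a b D \<noteq> H"
    then obtain x where x: "x \<in> H" "x \<notin> im a b D" using D by blast
    have xc: "x \<in> carrier (free_mod R a)" using x F.submoduleE(1)[OF H] by blast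
    obtain D' where D': "mat_over R a (Suc b) D'" "im a b D \<subseteq> im a (Suc b) D'" "x \<in> im a (Suc b) D'"
      "im a (Suc b) D' \<subseteq> H"
      using adjoin_column[OF D(1) xc] H D(2) x(1) by metis
    have "lenF a (im a (Suc b) D') \<le> k" using k(2) D' by blast
    then have "im a b D = im a (Suc b) D'"
      using lenF_eq[OF im_submodule[OF D'(1)] im_submodule[OF D(1)] D'(2)] D(3) by simp
    then show False using x D' by simp
  qed
  then show ?thesis using D by blast
qed

text \<open>A relation among the columns whose coefficient at \<open>j\<close> is a unit can be
  solved for column \<open>j\<close>.\<close>

lemma unit_relation:
  assumes D: "mat_over R a b D" and v: "v \<in> kr a b D" and j: "j < b" "v j \<notin> m"
  shows "im a b D \<subseteq> mod_span R (free_mod R a) (mat_col a D ` ({..<b} - {j}))"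
  unfolding mod_span_def
proof (rule Inter_greatest)
  interpret F: module R "free_mod R a" by (rule free_module)
  fix N assume "N \<in> {N. submodule N R (free_mod R a) \<and> mat_col a D ` ({..<b} - {j}) \<subseteq> N}"
  then have N: "submodule N R (free_mod R a)" "\<And>k. k < b \<Longrightarrow> k \<noteq> j \<Longrightarrow> mat_col a D k \<in> N" by auto
  let ?c = "mat_col a D"
  have vc: "v \<in> carrier (free_mod R b)" "mv a b D v = \<zero>\<^bsub>free_mod R a\<^esub>" using v by (auto simp: kr_def)
  have vk: "v k \<in> carrier R" if "k < b" for k using vc that by auto
  have cc: "?c k \<in> carrier (free_mod R a)" if "k < b" for k using mat_col_closed[OF D that] .
  define s where "s = (\<Oplus>\<^bsub>free_mod R a\<^esub>k\<in>{..<b} - {j}. v k \<odot>\<^bsub>free_mod R a\<^esub> ?c k)"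
  have s: "s \<in> N" unfolding s_def
    using N F.submoduleE(4)[OF N(1)] vk by (intro submodule_finsum[OF free_module N(1)]) auto
  have sc: "s \<in> carrier (free_mod R a)" using s F.submoduleE(1)[OF N(1)] by blast
  have "insert j ({..<b} - {j}) = {..<b}" using j by auto
  then have "mv a b D v = v j \<odot>\<^bsub>free_mod R a\<^esub> ?c j \<oplus>\<^bsub>free_mod R a\<^esub> s"
    using mv_eq_finsum[OF D vc(1)] F.M.finsum_insert[of "{..<b} - {j}" j "\<lambda>k. v k \<odot>\<^bsub>free_mod R a\<^esub> ?c k"] vk cc j
    by (auto simp: s_def)
  then have "v j \<odot>\<^bsub>free_mod R a\<^esub> ?c j = \<ominus>\<^bsub>free_mod R a\<^esub> s"
    using vc sc cc[OF j(1)] vk[OF j(1)] by (metis F.M.minus_equality F.smult_closed F.M.minus_minus F.M.a_inv_closed)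
  then have "v j \<odot>\<^bsub>free_mod R a\<^esub> ?c j \<in> N" using F.submoduleE(3)[OF N(1) s] by simp
  moreover have "v j \<in> Units R" using unit_iff[OF vk] j by simp
  moreover from this have "inv (v j) \<odot>\<^bsub>free_mod R a\<^esub> (v j \<odot>\<^bsub>free_mod R a\<^esub> ?c j) = ?c j"
    using vk[OF j(1)] cc[OF j(1)] F.smult_assoc1[of "inv (v j)" "v j" "?c j", symmetric] by simp
  ultimately have "?c j \<in> N"
    using F.submoduleE(4)[OF N(1), of "inv (v j)" "v j \<odot>\<^bsub>free_mod R a\<^esub> ?c j"] by simp
  then show "im a b D \<subseteq> N" using im_least[OF D N(1)] N(2) by blast
qed

lemma minimal_kr_subset_mF:
  assumes D: "mat_over R a b D"
    and min: "\<And>b' D'. mat_over R a b' D' \<Longrightarrow> im a b' D' = im a b D \<Longrightarrow> b \<le> b'"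
  shows "kr a b D \<subseteq> mF b"
proof
  fix v assume v: "v \<in> kr a b D"
  have "v j \<in> m" if j: "j < b" for j
  proof (rule ccontr)
    assume "v j \<notin> m"
    note span = unit_relation[OF D v j this]
    \<comment> \<open>Enumerates in order the column indices different from
      \<open>j\<close>.\<close>
    define \<sigma> where "\<sigma> = (\<lambda>k. if k < j then k else Suc k)"
    define D' where "D' = (\<lambda>i k. D i (\<sigma> k))"
    have \<sigma>: "\<sigma> k < b" "\<sigma> k \<noteq> j" if "k < b - 1" for k using that j by (auto simp: \<sigma>_def)
    have D': "mat_over R a (b - 1) D'" using D \<sigma> by (auto simp: D'_def mat_over_def)
    have col: "mat_col a D' k = mat_col a D (\<sigma> k)" for k by (simp add: mat_col_def D'_def)
    have "mat_col a D ` ({..<b} - {j}) \<subseteq> im a (b - 1) D'"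
    proof
      fix x assume "x \<in> mat_col a D ` ({..<b} - {j})"
      then obtain k where k: "k < b" "k \<noteq> j" "x = mat_col a D k" by auto
      define l where "l = (if k < j then k else k - 1)"
      have "\<sigma> l = k" "l < b - 1" using k j by (auto simp: l_def \<sigma>_def)
      then show "x \<in> im a (b - 1) D'" using col_in_im[OF D', of l] col k by simp
    qed
    then have "im a b D \<subseteq> im a (b - 1) D'"
      using span im_submodule[OF D'] unfolding mod_span_def by blast
    moreover have "im a (b - 1) D' \<subseteq> im a b D"
      using im_least[OF D' im_submodule[OF D]] col col_in_im[OF D] \<sigma> by auto
    ultimately have "b \<le> b - 1" using min[OF D'] by blast
    then show False using j by simp
  qed
  then show "v \<in> mF b" using v by (auto simp: mF_def box_def kr_def)
qed

text \<open>Minimality of the number of columns is exported next to the kernel condition, because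
  \<open>dual_pairs\<close> applies it to another matrix with the same image.\<close>

lemma exists_minimal_matrix:
  assumes H: "submodule H R (free_mod R a)"
  shows "\<exists>b D. mat_over R a b D \<and> im a b D = H \<and> kr a b D \<subseteq> mF b \<and>
    (\<forall>b' D'. mat_over R a b' D' \<longrightarrow> im a b' D' = H \<longrightarrow> b \<le> b')"
proof -
  let ?P = "\<lambda>b. \<exists>D. mat_over R a b D \<and> im a b D = H"
  have ex: "\<exists>b. ?P b" using exists_matrix[OF H] by blast
  obtain D where D: "mat_over R a (Least ?P) D" "im a (Least ?P) D = H"
    using LeastI_ex[OF ex] by blast
  have min: "Least ?P \<le> b'" if "mat_over R a b' D'" "im a b' D' = H" for b' D'
    using that Least_le[of ?P b'] by blast
  show ?thesis
    using D min minimal_kr_subset_mF[OF D(1)] by (intro exI[of _ "Least ?P"] exI[of _ D]) auto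
qed

text \<open>I/A is a vector space of dimension \<open>k\<close> over the residue field, and the
  \<open>x i\<close> lift a basis of it, found by adjoining one element at a time. Generation is
  phrased through arbitrary submodules \<open>B\<close>, so that no quotient has to be
  formed.\<close>

lemma exists_generators_mod:
  assumes M: "module R M" and A: "flen R M A" and I: "flen R M I" "A \<subseteq> I"
    and mI: "\<And>r x. r \<in> m \<Longrightarrow> x \<in> I \<Longrightarrow> r \<odot>\<^bsub>M\<^esub> x \<in> A"
    and len: "len R M I = len R M A + k"
  shows "\<exists>x :: nat \<Rightarrow> 'c. (\<forall>i<k. x i \<in> I) \<and>
    (\<forall>B. submodule B R M \<longrightarrow> A \<subseteq> B \<longrightarrow> (\<forall>i<k. x i \<in> B) \<longrightarrow> I \<subseteq> B)"
  using A I(2) mI len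
proof (induction k arbitrary: A)
  case 0
  interpret M: module R M by fact
  have "A = I" using M.len_eq_imp_eq[OF I(1) M.flen_submodule[OF 0(1)] 0(2)] 0 by simp
  then show ?case by auto
next
  case (Suc k)
  interpret M: module R M by fact
  have sA: "submodule A R M" using Suc.prems(1) M.flen_submodule by blast
  have "A \<noteq> I" using Suc.prems by auto
  then obtain y where y: "y \<in> I" "y \<notin> A" using Suc.prems by blast
  have yc: "y \<in> carrier M" using y M.submoduleE(1)[OF M.flen_submodule[OF I(1)]] by blast
  have my: "r \<odot>\<^bsub>M\<^esub> y \<in> A" if "r \<in> carrier R - Units R" for r
    using that nonunit Suc.prems(3) y by blast
  let ?A = "add_cyclic R M A y"
  note fl = M.flen_add_cyclic[OF Suc.prems(1) yc my]
  have "A \<subseteq> ?A" "y \<in> ?A" "?A \<subseteq> I"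
    using M.add_cyclic_superset[OF sA yc] M.add_cyclic_least[OF M.flen_submodule[OF I(1)] Suc.prems(2) y(1)] by auto
  moreover from this have "r \<odot>\<^bsub>M\<^esub> z \<in> ?A" if "r \<in> m" "z \<in> I" for r z
    using that Suc.prems(3) by blast
  ultimately obtain x where x: "\<forall>i<k. x i \<in> I"
      "\<forall>B. submodule B R M \<longrightarrow> ?A \<subseteq> B \<longrightarrow> (\<forall>i<k. x i \<in> B) \<longrightarrow> I \<subseteq> B"
    using Suc.IH[OF fl(1)] Suc.prems(4) fl(3)[OF _ y(2)] by auto
  define x' where "x' = (\<lambda>i. if i = k then y else x i)"
  have 1: "\<forall>i<Suc k. x' i \<in> I" using x(1) y by (auto simp: x'_def less_Suc_eq)
  have 2: "I \<subseteq> B" if B: "submodule B R M" "A \<subseteq> B" "\<forall>i<Suc k. x' i \<in> B" for B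
  proof -
    have "y \<in> B" using B(3) by (auto simp: x'_def)
    moreover have "\<forall>i<k. x i \<in> B"
    proof (intro allI impI)
      fix i assume "i < k"
      then show "x i \<in> B" using B(3)[rule_format, of i] by (simp add: x'_def)
    qed
    ultimately show ?thesis using x(2) B M.add_cyclic_least[OF B(1,2)] by blast
  qed
  show ?case using 1 2 by blast
qed

end

section \<open>A criterion for the Gorenstein property\<close>

context short_local
begin

interpretation self: module R "self_mod R" by (rule self_module)

definition lin_m :: "('a \<Rightarrow> 'a) \<Rightarrow> bool" where
  "lin_m f \<longleftrightarrow> (\<forall>x\<in>m. f x \<in> carrier R) \<and> (\<forall>x\<in>m. \<forall>y\<in>m. f (x \<oplus> y) = f x \<oplus> f y) \<and>
     (\<forall>r\<in>carrier R. \<forall>x\<in>m. f (r \<otimes> x) = r \<otimes> f x)"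

text \<open>Equivalently, \<open>Ext\<^sup>1(R/m, R) = 0\<close>.\<close>

definition baer :: bool where
  "baer \<longleftrightarrow> (\<forall>f. lin_m f \<longrightarrow> (\<exists>c\<in>carrier R. \<forall>x\<in>m. f x = c \<otimes> x))"

lemma lin_mD:
  assumes "lin_m f"
  shows "x \<in> m \<Longrightarrow> f x \<in> carrier R" "x \<in> m \<Longrightarrow> y \<in> m \<Longrightarrow> f (x \<oplus> y) = f x \<oplus> f y"
    "r \<in> carrier R \<Longrightarrow> x \<in> m \<Longrightarrow> f (r \<otimes> x) = r \<otimes> f x"
  using assms by (auto simp: lin_m_def)

text \<open>The ring and the zero module are copied onto lists because \<open>finite_inj_dim\<close>
  takes the terms of an injective resolution on that type.\<close>

definition list_mod :: "('a, 'a list) module" where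
  "list_mod = \<lparr>carrier = (\<lambda>x. [x]) ` carrier R, monoid.mult = undefined, one = undefined,
     ring.zero = [\<zero>], ring.add = (\<lambda>x y. [hd x \<oplus> hd y]), module.smult = (\<lambda>r x. [r \<otimes> hd x])\<rparr>"

definition triv_mod :: "('a, 'a list) module" where
  "triv_mod = \<lparr>carrier = {[]}, monoid.mult = undefined, one = undefined,
     ring.zero = [], ring.add = (\<lambda>x y. []), module.smult = (\<lambda>r x. [])\<rparr>"

lemma list_module: "module R list_mod"
proof (rule moduleI[OF is_cring])
  show "abelian_group list_mod"
  proof (rule abelian_groupI)
    fix x assume "x \<in> carrier list_mod"
    then show "\<exists>y\<in>carrier list_mod. y \<oplus>\<^bsub>list_mod\<^esub> x = \<zero>\<^bsub>list_mod\<^esub>"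
      by (intro bexI[of _ "[\<ominus> hd x]"]) (auto simp: list_mod_def l_neg)
  qed (auto simp: list_mod_def a_ac)
qed (auto simp: list_mod_def l_distr r_distr m_assoc)

lemma triv_module: "module R triv_mod"
proof (rule moduleI[OF is_cring])
  show "abelian_group triv_mod"
    by (rule abelian_groupI) (auto simp: triv_mod_def)
qed (auto simp: triv_mod_def)

lemma triv_injective: "injective_mod R triv_mod"
  unfolding injective_mod_def
proof (intro conjI allI impI triv_module)
  fix B :: "('a, 'a list) module" and S f
  assume "module R B \<and> submodule S R B \<and> f \<in> mod_hom R (B\<lparr>carrier := S\<rparr>) triv_mod"
  then have "f x = []" if "x \<in> S" for x
    using that by (auto simp: mod_hom_def hom_def triv_mod_def Pi_def)
  moreover have "(\<lambda>_. []) \<in> mod_hom R B triv_mod"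
    by (auto simp: mod_hom_def hom_def triv_mod_def)
  ultimately show "\<exists>g\<in>mod_hom R B triv_mod. \<forall>x\<in>S. g x = f x"
    by (intro bexI[of _ "\<lambda>_. []"]) auto
qed

text \<open>A partial homomorphism into R, encoded as a single-valued submodule of B \<times> R.
  Extension is then inclusion and the bound of a chain is its union, as Zorn's lemma wants.\<close>

definition graph_ext :: "('a, 'c, 'q) module_scheme \<Rightarrow> ('c \<times> 'a) set \<Rightarrow> bool" where
  "graph_ext B G \<longleftrightarrow> G \<subseteq> carrier B \<times> carrier R \<and>
     (\<forall>x a b. (x, a) \<in> G \<longrightarrow> (x, b) \<in> G \<longrightarrow> a = b) \<and> (\<zero>\<^bsub>B\<^esub>, \<zero>) \<in> G \<and>
     (\<forall>x a y b. (x, a) \<in> G \<longrightarrow> (y, b) \<in> G \<longrightarrow> (x \<oplus>\<^bsub>B\<^esub> y, a \<oplus> b) \<in> G) \<and>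
     (\<forall>r\<in>carrier R. \<forall>x a. (x, a) \<in> G \<longrightarrow> (r \<odot>\<^bsub>B\<^esub> x, r \<otimes> a) \<in> G)"

lemma graph_extD:
  assumes "graph_ext B G"
  shows "(x, a) \<in> G \<Longrightarrow> x \<in> carrier B" "(x, a) \<in> G \<Longrightarrow> a \<in> carrier R"
    "(x, a) \<in> G \<Longrightarrow> (x, b) \<in> G \<Longrightarrow> a = b" "(\<zero>\<^bsub>B\<^esub>, \<zero>) \<in> G"
    "(x, a) \<in> G \<Longrightarrow> (y, b) \<in> G \<Longrightarrow> (x \<oplus>\<^bsub>B\<^esub> y, a \<oplus> b) \<in> G"
    "r \<in> carrier R \<Longrightarrow> (x, a) \<in> G \<Longrightarrow> (r \<odot>\<^bsub>B\<^esub> x, r \<otimes> a) \<in> G"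
  using assms unfolding graph_ext_def by blast+

text \<open>The enlarging step of Baer's criterion. A vector x outside the domain can be chosen with
  m x inside it, since otherwise three successive factors from m would lead to an element outside
  the domain, although it is zero by m^3 = 0. The map y -> (value at y x) is linear on m, hence
  multiplication by some c, and sending x to c extends the partial map.\<close>

lemma graph_ext_enlarge:
  assumes baer and "module R B" and G: "graph_ext B G" and x: "x \<in> carrier B" "x \<notin> Domain G"
  shows "\<exists>G'. graph_ext B G' \<and> G \<subset> G'"
proof -
  interpret B: module R B by fact
  note GD = graph_extD[OF G]
  have "\<exists>x\<in>carrier B. x \<notin> Domain G \<and> (\<forall>y\<in>m. y \<odot>\<^bsub>B\<^esub> x \<in> Domain G)"
  proof (rule ccontr)
    assume "\<not> ?thesis"
    then have *: "\<exists>y\<in>m. y \<odot>\<^bsub>B\<^esub> x \<notin> Domain G" if "x \<in> carrier B" "x \<notin> Domain G" for x using that by blast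
    obtain y where y: "y \<in> m" "y \<odot>\<^bsub>B\<^esub> x \<notin> Domain G" using * x by blast
    obtain z where z: "z \<in> m" "z \<odot>\<^bsub>B\<^esub> (y \<odot>\<^bsub>B\<^esub> x) \<notin> Domain G" using *[OF _ y(2)] x y by auto
    obtain w where w: "w \<in> m" "w \<odot>\<^bsub>B\<^esub> (z \<odot>\<^bsub>B\<^esub> (y \<odot>\<^bsub>B\<^esub> x)) \<notin> Domain G"
      using *[OF _ z(2)] x y z by auto
    have c: "w \<in> carrier R" "z \<in> carrier R" "y \<in> carrier R" using w y z by auto
    have "w \<odot>\<^bsub>B\<^esub> (z \<odot>\<^bsub>B\<^esub> (y \<odot>\<^bsub>B\<^esub> x)) = (w \<otimes> (z \<otimes> y)) \<odot>\<^bsub>B\<^esub> x"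
      using c x by (simp add: B.smult_assoc1)
    also have "\<dots> = \<zero>\<^bsub>B\<^esub>" using mm2[OF w(1) mm[OF z(1) y(1)]] x by simp
    finally show False using w GD(4) by auto
  qed
  then obtain x where x: "x \<in> carrier B" "x \<notin> Domain G" and mx: "\<And>y. y \<in> m \<Longrightarrow> y \<odot>\<^bsub>B\<^esub> x \<in> Domain G"
    by blast
  define f where "f = (\<lambda>y. THE a. (y \<odot>\<^bsub>B\<^esub> x, a) \<in> G)"
  have f_eq: "f y = a" if "(y \<odot>\<^bsub>B\<^esub> x, a) \<in> G" for y a
    unfolding f_def using that GD(3) by blast
  have f: "(y \<odot>\<^bsub>B\<^esub> x, f y) \<in> G" if y: "y \<in> m" for y
  proof -
    obtain a where "(y \<odot>\<^bsub>B\<^esub> x, a) \<in> G" using mx[OF y] by auto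
    then show ?thesis using f_eq by simp
  qed
  have "lin_m f" unfolding lin_m_def
  proof (intro conjI ballI)
    fix y z assume "y \<in> m" "z \<in> m"
    then show "f (y \<oplus> z) = f y \<oplus> f z"
      using f_eq[of "y \<oplus> z"] GD(5)[OF f f] x by (simp add: B.smult_l_distr)
  next
    fix r y assume "r \<in> carrier R" "y \<in> m"
    then show "f (r \<otimes> y) = r \<otimes> f y"
      using f_eq[of "r \<otimes> y"] GD(6)[OF _ f] x by (simp add: B.smult_assoc1)
  qed (use GD(2) f in blast)
  then obtain c where c: "c \<in> carrier R" "\<And>y. y \<in> m \<Longrightarrow> f y = c \<otimes> y"
    using \<open>baer\<close> unfolding baer_def by blast
  define G' where "G' = {(n \<oplus>\<^bsub>B\<^esub> r \<odot>\<^bsub>B\<^esub> x, a \<oplus> r \<otimes> c) | n r a. (n, a) \<in> G \<and> r \<in> carrier R}"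
  have G'I: "(n \<oplus>\<^bsub>B\<^esub> r \<odot>\<^bsub>B\<^esub> x, a \<oplus> r \<otimes> c) \<in> G'" if "(n, a) \<in> G" "r \<in> carrier R" for n a r
    unfolding G'_def using that by blast
  have G'E: "\<exists>n r a. (n, a) \<in> G \<and> r \<in> carrier R \<and> y = n \<oplus>\<^bsub>B\<^esub> r \<odot>\<^bsub>B\<^esub> x \<and> b = a \<oplus> r \<otimes> c"
    if "(y, b) \<in> G'" for y b using that unfolding G'_def by auto
  have sub: "G \<subseteq> G'"
  proof
    fix p assume p: "p \<in> G"
    obtain n a where na: "p = (n, a)" by (cases p)
    show "p \<in> G'" using G'I[of n a \<zero>] p na x c GD(1,2)[of n a] by simp
  qed
  have "(x, c) \<in> G'" using G'I[OF GD(4), of \<one>] x c by simp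
  then have "G \<noteq> G'" using x by auto
  moreover have "graph_ext B G'"
    unfolding graph_ext_def
  proof (intro conjI allI impI ballI)
    show "G' \<subseteq> carrier B \<times> carrier R" unfolding G'_def using GD(1,2) x c by auto
    show "(\<zero>\<^bsub>B\<^esub>, \<zero>) \<in> G'" using sub GD(4) by blast
  next
    fix y a z b assume "(y, a) \<in> G'" "(z, b) \<in> G'"
    then obtain n r p n' r' p' where h: "(n, p) \<in> G" "r \<in> carrier R" "y = n \<oplus>\<^bsub>B\<^esub> r \<odot>\<^bsub>B\<^esub> x" "a = p \<oplus> r \<otimes> c"
      "(n', p') \<in> G" "r' \<in> carrier R" "z = n' \<oplus>\<^bsub>B\<^esub> r' \<odot>\<^bsub>B\<^esub> x" "b = p' \<oplus> r' \<otimes> c"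
      using G'E by metis
    note hc = GD(1,2)[OF h(1)] GD(1,2)[OF h(5)]
    have "y \<oplus>\<^bsub>B\<^esub> z = (n \<oplus>\<^bsub>B\<^esub> n') \<oplus>\<^bsub>B\<^esub> (r \<oplus> r') \<odot>\<^bsub>B\<^esub> x"
      using h hc x by (simp add: B.smult_l_distr B.M.a_ac)
    moreover have "a \<oplus> b = (p \<oplus> p') \<oplus> (r \<oplus> r') \<otimes> c"
      using h hc c by (simp add: l_distr a_ac)
    ultimately show "(y \<oplus>\<^bsub>B\<^esub> z, a \<oplus> b) \<in> G'" using G'I[OF GD(5)[OF h(1,5)], of "r \<oplus> r'"] h by simp
  next
    fix s y a assume s: "s \<in> carrier R" and "(y, a) \<in> G'"
    then obtain n r p where h: "(n, p) \<in> G" "r \<in> carrier R" "y = n \<oplus>\<^bsub>B\<^esub> r \<odot>\<^bsub>B\<^esub> x" "a = p \<oplus> r \<otimes> c"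
      using G'E by metis
    note hc = GD(1,2)[OF h(1)]
    have "s \<odot>\<^bsub>B\<^esub> y = s \<odot>\<^bsub>B\<^esub> n \<oplus>\<^bsub>B\<^esub> (s \<otimes> r) \<odot>\<^bsub>B\<^esub> x"
      using h hc x s by (simp add: B.smult_r_distr B.smult_assoc1)
    moreover have "s \<otimes> a = s \<otimes> p \<oplus> (s \<otimes> r) \<otimes> c"
      using h hc c s by (simp add: r_distr m_assoc)
    ultimately show "(s \<odot>\<^bsub>B\<^esub> y, s \<otimes> a) \<in> G'" using G'I[OF GD(6)[OF s h(1)], of "s \<otimes> r"] h s by simp
  next
    fix y a b assume "(y, a) \<in> G'" "(y, b) \<in> G'"
    then obtain n r p n' r' p' where h: "(n, p) \<in> G" "r \<in> carrier R" "y = n \<oplus>\<^bsub>B\<^esub> r \<odot>\<^bsub>B\<^esub> x" "a = p \<oplus> r \<otimes> c"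
      "(n', p') \<in> G" "r' \<in> carrier R" "y = n' \<oplus>\<^bsub>B\<^esub> r' \<odot>\<^bsub>B\<^esub> x" "b = p' \<oplus> r' \<otimes> c"
      using G'E by metis
    note hc = GD(1,2)[OF h(1)] GD(1,2)[OF h(5)]
    \<comment> \<open>Well-definedness comes down to the difference of the two scalars:
      \<open>t\<close> times \<open>x\<close> lies in the old domain, so \<open>t\<close> is not a
      unit, and on \<open>m\<close> the prescribed value is that of multiplication by
      \<open>c\<close>.\<close>
    define t where "t = r \<ominus> r'"
    have t: "t \<in> carrier R" "r = t \<oplus> r'" using h by (auto simp: t_def a_minus_def a_assoc l_neg)
    have "(n \<oplus>\<^bsub>B\<^esub> t \<odot>\<^bsub>B\<^esub> x) \<oplus>\<^bsub>B\<^esub> r' \<odot>\<^bsub>B\<^esub> x = n' \<oplus>\<^bsub>B\<^esub> r' \<odot>\<^bsub>B\<^esub> x"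
      using h(3,7) t hc x h by (simp add: B.smult_l_distr B.M.a_assoc)
    then have n': "n \<oplus>\<^bsub>B\<^esub> t \<odot>\<^bsub>B\<^esub> x = n'" using t hc x h by simp
    have tx: "t \<odot>\<^bsub>B\<^esub> x = (\<ominus> \<one>) \<odot>\<^bsub>B\<^esub> n \<oplus>\<^bsub>B\<^esub> n'"
      unfolding n'[symmetric] using hc t x
      by (simp add: B.smult_l_minus B.M.a_assoc[symmetric] B.M.l_neg)
    have inG: "(t \<odot>\<^bsub>B\<^esub> x, (\<ominus> \<one>) \<otimes> p \<oplus> p') \<in> G"
      unfolding tx using GD(5)[OF GD(6)[OF _ h(1)] h(5), of "\<ominus> \<one>"] by simp
    have "t \<in> m"
    proof (rule ccontr)
      assume "t \<notin> m"
      then have u: "t \<in> Units R" using unit_iff[OF t(1)] by simp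
      have "inv t \<odot>\<^bsub>B\<^esub> (t \<odot>\<^bsub>B\<^esub> x) = x"
        using u t x B.smult_assoc1[of "inv t" t x, symmetric] by simp
      then have "x \<in> Domain G" using GD(6)[OF _ inG, of "inv t"] u by (metis Domain.intros Units_inv_closed)
      then show False using x by simp
    qed
    then have "(\<ominus> \<one>) \<otimes> p \<oplus> p' = c \<otimes> t" using c(2) f_eq[OF inG] by simp
    then have "p' = p \<oplus> t \<otimes> c" using hc t c
      by (metis a_assoc a_comm l_minus l_one m_comm r_neg1 one_closed add.inv_closed m_closed l_neg l_zero r_zero)
    then show "a = b" using h t hc c by (simp add: l_distr a_assoc)
  qed
  ultimately show ?thesis using sub by blast
qed

text \<open>Zorn's lemma for the graphs extending that of \<open>f\<close>. A maximal one has full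
  domain by \<open>graph_ext_enlarge\<close>.\<close>

lemma list_injective:
  assumes baer shows "injective_mod R list_mod"
  unfolding injective_mod_def
proof (intro conjI allI impI list_module)
  fix B :: "('a, 'a list) module" and S f
  assume "module R B \<and> submodule S R B \<and> f \<in> mod_hom R (B\<lparr>carrier := S\<rparr>) list_mod"
  then have B: "module R B" and S: "submodule S R B" and f: "f \<in> mod_hom R (B\<lparr>carrier := S\<rparr>) list_mod" by auto
  interpret B: module R B by fact
  interpret f: linear_map R "B\<lparr>carrier := S\<rparr>" list_mod f
    using submodule.submodule_is_module[OF S B] list_module f
    by (intro linear_map.intro linear_map_axioms.intro)
  have Sc: "S \<subseteq> carrier B" using B.submoduleE(1)[OF S] .
  have fc: "\<exists>a\<in>carrier R. f x = [a]" if "x \<in> S" for x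
    using f.closed[of x] that by (auto simp: list_mod_def)
  define G0 where "G0 = (\<lambda>x. (x, hd (f x))) ` S"
  have G0: "graph_ext B G0" unfolding graph_ext_def
  proof (intro conjI allI impI ballI)
    show "G0 \<subseteq> carrier B \<times> carrier R" using Sc fc unfolding G0_def by force
    show "(\<zero>\<^bsub>B\<^esub>, \<zero>) \<in> G0"
      using B.submodule_zero[OF S] f.zero by (force simp: G0_def list_mod_def)
  next
    fix x a y b assume "(x, a) \<in> G0" "(y, b) \<in> G0"
    then show "(x \<oplus>\<^bsub>B\<^esub> y, a \<oplus> b) \<in> G0"
      using f.add[of x y] B.submoduleE(5)[OF S, of x y] by (auto simp: G0_def list_mod_def)
  next
    fix r x a assume "r \<in> carrier R" "(x, a) \<in> G0"
    then show "(r \<odot>\<^bsub>B\<^esub> x, r \<otimes> a) \<in> G0"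
      using f.smult[of r x] B.submoduleE(4)[OF S, of r x] by (auto simp: G0_def list_mod_def)
  qed (auto simp: G0_def)
  define exts where "exts = {G. graph_ext B G \<and> G0 \<subseteq> G}"
  have nonempty: "exts \<noteq> {}" using G0 by (auto simp: exts_def)
  have chain: "\<Union>C \<in> exts" if C: "C \<noteq> {}" "subset.chain exts C" for C
  proof -
    have CG: "graph_ext B G" "G0 \<subseteq> G" if "G \<in> C" for G
      using C(2) that by (auto simp: subset_chain_def exts_def)
    have two: "\<exists>G\<in>C. p \<in> G \<and> q \<in> G" if pq: "p \<in> \<Union>C" "q \<in> \<Union>C" for p q
    proof -
      obtain G H where "G \<in> C" "p \<in> G" "H \<in> C" "q \<in> H" using pq by blast
      moreover have "G \<subseteq> H \<or> H \<subseteq> G" using subset.chain_total[OF C(2)] calculation by blast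
      ultimately show ?thesis by blast
    qed
    have "graph_ext B (\<Union>C)" unfolding graph_ext_def
    proof (intro conjI allI impI ballI)
      show "\<Union>C \<subseteq> carrier B \<times> carrier R" using CG(1) unfolding graph_ext_def by blast
      show "(\<zero>\<^bsub>B\<^esub>, \<zero>) \<in> \<Union>C" using C(1) graph_extD(4)[OF CG(1)] by blast
    next
      fix x a b assume "(x, a) \<in> \<Union>C" "(x, b) \<in> \<Union>C"
      then show "a = b" using two graph_extD(3)[OF CG(1)] by metis
    next
      fix x a y b assume "(x, a) \<in> \<Union>C" "(y, b) \<in> \<Union>C"
      then show "(x \<oplus>\<^bsub>B\<^esub> y, a \<oplus> b) \<in> \<Union>C" using two graph_extD(5)[OF CG(1)] by (metis UnionI)
    next
      fix r x a assume "r \<in> carrier R" "(x, a) \<in> \<Union>C"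
      then show "(r \<odot>\<^bsub>B\<^esub> x, r \<otimes> a) \<in> \<Union>C" using graph_extD(6)[OF CG(1)] by blast
    qed
    moreover have "G0 \<subseteq> \<Union>C" using C(1) CG(2) by blast
    ultimately show "\<Union>C \<in> exts" by (simp add: exts_def)
  qed
  have "\<exists>M\<in>exts. \<forall>Y\<in>exts. M \<subseteq> Y \<longrightarrow> Y = M"
    using subset_Zorn_nonempty[OF nonempty chain] by simp
  then obtain G where "G \<in> exts" and max': "\<forall>Y\<in>exts. G \<subseteq> Y \<longrightarrow> Y = G" by (elim bexE)
  then have G: "graph_ext B G" "G0 \<subseteq> G" by (auto simp: exts_def)
  have max: "Y = G" if "graph_ext B Y" "G \<subseteq> Y" for Y
    using max' that G(2) by (auto simp: exts_def)
  have dom: "x \<in> Domain G" if "x \<in> carrier B" for x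
    using graph_ext_enlarge[OF assms B G(1) that] max by blast
  define g where "g = (\<lambda>x. THE a. (x, a) \<in> G)"
  have g_eq: "g x = a" if "(x, a) \<in> G" for x a
    unfolding g_def using that graph_extD(3)[OF G(1)] by blast
  have g: "(x, g x) \<in> G" if x: "x \<in> carrier B" for x
    using dom[OF x] g_eq by auto
  show "\<exists>h\<in>mod_hom R B list_mod. \<forall>x\<in>S. h x = f x"
  proof (intro bexI[of _ "\<lambda>x. [g x]"] ballI)
    fix x assume x: "x \<in> S"
    then have "(x, hd (f x)) \<in> G" using G(2) by (auto simp: G0_def)
    then show "[g x] = f x" using g_eq fc[OF x] by auto
  next
    show "(\<lambda>x. [g x]) \<in> mod_hom R B list_mod"
      using graph_extD(2)[OF G(1) g] g_eq[OF graph_extD(5)[OF G(1) g g]] g_eq[OF graph_extD(6)[OF G(1) _ g]]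
      by (auto simp: mod_hom_def hom_def list_mod_def)
  qed
qed

text \<open>R is self-injective, so 0 -> R -> R -> 0 is an injective resolution of length
  zero.\<close>

lemma baer_imp_gorenstein:
  assumes baer shows "gorenstein R"
proof -
  define E where "E = (\<lambda>i::nat. if i = 0 then list_mod else triv_mod)"
  define e where "e = (\<lambda>x :: 'a. [x])"
  define d where "d = (\<lambda>(i::nat) (x :: 'a list). [] :: 'a list)"
  have "\<forall>i. injective_mod R (E i)" using list_injective[OF assms] triv_injective by (simp add: E_def)
  moreover have "e \<in> mod_hom R (self_mod R) (E 0)"
    by (auto simp: E_def e_def mod_hom_def hom_def list_mod_def)
  moreover have "\<forall>i. d i \<in> mod_hom R (E i) (E (Suc i))"
    by (auto simp: E_def d_def mod_hom_def hom_def triv_mod_def)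
  moreover have "inj_on e (carrier (self_mod R))" by (auto simp: e_def inj_on_def)
  moreover have "a_kernel (E 0) (E 1) (d 0) = e ` carrier (self_mod R)"
    by (auto simp: a_kernel_def' E_def d_def e_def list_mod_def triv_mod_def)
  moreover have "\<forall>i. a_kernel (E (Suc i)) (E (Suc (Suc i))) (d (Suc i)) = d i ` carrier (E i)"
    by (auto simp: a_kernel_def' E_def d_def list_mod_def triv_mod_def)
  moreover have "\<forall>i>0. carrier (E i) = {\<zero>\<^bsub>E i\<^esub>}" by (auto simp: E_def triv_mod_def)
  ultimately show ?thesis unfolding gorenstein_def finite_inj_dim_def by blast
qed

text \<open>Let s span the socle m^2. A homomorphism f sends s into the socle, so f(s) = t s, and
  after subtracting multiplication by t the remaining map g kills m^2 and takes values in m^2.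
  Multiplication is a nondegenerate pairing of m/m^2 with itself into the one-dimensional m^2, so g
  is multiplication by an element of m.\<close>

lemma socdim_1_imp_baer:
  assumes "socdim = 1" and soc: "\<And>x. x \<in> m \<Longrightarrow> (\<And>y. y \<in> m \<Longrightarrow> y \<otimes> x = \<zero>) \<Longrightarrow> x \<in> m2"
  shows baer
  unfolding baer_def
proof (intro allI impI)
  fix f assume f: "lin_m f"
  note fD = lin_mD[OF f]
  obtain s where s: "s \<in> m2" "s \<noteq> \<zero>" using square m2.zero_closed by blast
  have sm: "s \<in> m" using s m2_le by blast
  have sc: "s \<in> carrier R" using sm by simp
  have socm: "x \<in> m2" if x: "x \<in> carrier R" and k: "\<And>y. y \<in> m \<Longrightarrow> y \<otimes> x = \<zero>" for x
  proof (cases "x \<in> m")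
    case False
    then have "x \<in> Units R" using unit_iff x by simp
    then have "s = \<zero>" using k[OF sm] sc x by (metis Units_inv_closed Units_r_inv l_null m_assoc r_one)
    then show ?thesis using s by simp
  qed (use soc k in blast)
  have m2s: "\<exists>r\<in>carrier R. x = r \<otimes> s" if "x \<in> m2" for x
  proof -
    let ?C = "add_cyclic R (self_mod R) {\<zero>} s"
    have z: "flen R (self_mod R) {\<zero>}" "len R (self_mod R) {\<zero>} = 0" using self.flen_zero self.len_zero by simp_all
    have "len R (self_mod R) ?C = 1"
      using self.flen_add_cyclic(3)[of "{\<zero>}" s] z sc s m2m mm2 nonunit by auto
    moreover have "?C \<subseteq> m2" using self.add_cyclic_least[OF m2_sub, of "{\<zero>}" s] s by auto
    ultimately have "?C = m2"
      using self.len_eq_imp_eq[OF flen_self[OF m2_sub]] self.add_cyclic_submodule[OF zero_sub] sc len_m2 assms(1) by simp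
    then have "x \<in> ?C" using that by simp
    then show ?thesis using sc by (auto simp: add_cyclic_def)
  qed
  have "y \<otimes> f s = \<zero>" if "y \<in> m" for y
  proof -
    have "y \<otimes> f s = f (y \<otimes> s)" using fD(3)[of y s] that sm by simp
    also have "\<dots> = f (\<zero> \<otimes> s)" using mm2[OF that s(1)] sc by simp
    also have "\<dots> = \<zero>" using fD(1)[OF sm] fD(3)[of \<zero> s] sm by simp
    finally show ?thesis .
  qed
  then have "f s \<in> m2" using socm fD(1)[OF sm] by blast
  then obtain t where t: "t \<in> carrier R" "f s = t \<otimes> s" using m2s by blast
  define g where "g = (\<lambda>x. f x \<ominus> t \<otimes> x)"
  have g: "lin_m g" unfolding lin_m_def
  proof (intro conjI ballI)
    fix x y assume "x \<in> m" "y \<in> m"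
    then show "g (x \<oplus> y) = g x \<oplus> g y" using fD t m.Icarr
      by (simp add: g_def a_minus_def r_distr minus_add a_ac)
  next
    fix r x assume "r \<in> carrier R" "x \<in> m"
    then show "g (r \<otimes> x) = r \<otimes> g x" using fD t m.Icarr
      by (simp add: g_def a_minus_def r_distr r_minus m_lcomm)
  qed (use fD t in \<open>auto simp: g_def\<close>)
  note gD = lin_mD[OF g]
  have gm2: "g x = \<zero>" if x: "x \<in> m2" for x
  proof -
    obtain r where r: "r \<in> carrier R" "x = r \<otimes> s" using m2s[OF x] by blast
    have "g s = \<zero>" using t sc by (simp add: g_def a_minus_def r_neg)
    then show ?thesis using gD(3)[OF r(1) sm] r by simp
  qed
  have gm: "g x \<in> m2" if x: "x \<in> m" for x
  proof (rule socm)
    fix y assume y: "y \<in> m"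
    then show "y \<otimes> g x = \<zero>" using gD(3)[of y x] x gm2[OF mm[OF y x]] by simp
  qed (use gD x in auto)
  obtain x :: "nat \<Rightarrow> 'a" where x: "\<And>i. i < embdim \<Longrightarrow> x i \<in> m"
    and gen: "\<And>B. submodule B R (self_mod R) \<Longrightarrow> m2 \<subseteq> B \<Longrightarrow> (\<And>i. i < embdim \<Longrightarrow> x i \<in> B) \<Longrightarrow> m \<subseteq> B"
    using exists_generators_mod[OF self_module flen_self[OF m2_sub] flen_m m2_le, of embdim] mm len_m len_m2
    by auto
  have xc: "x i \<in> carrier R" if "i < embdim" for i using x[OF that] by simp
  \<comment> \<open>Sends \<open>c\<close> to its products with generators of \<open>m\<close>
    modulo \<open>m2\<close>. On \<open>m\<close> the kernel is the socle \<open>m2\<close>, so the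
    image has length \<open>embdim\<close>; that is the full length of \<open>m2F embdim\<close> as
    \<open>socdim = 1\<close>. Hence \<open>c\<close> can be found with prescribed products.\<close>
  define \<Theta> where "\<Theta> = (\<lambda>c. \<lambda>i\<in>{..<embdim}. x i \<otimes> c)"
  interpret \<Theta>: linear_map R "self_mod R" "free_mod R embdim" \<Theta>
  proof (intro linear_map.intro linear_map_axioms.intro self_module free_module)
    show "\<Theta> \<in> mod_hom R (self_mod R) (free_mod R embdim)"
      using xc unfolding mod_hom_def hom_def
      by (auto simp: \<Theta>_def free_mod_def r_distr m_lcomm intro!: restrict_ext)
  qed
  have ker: "m \<inter> \<Theta>.ker = m2"
  proof
    have "\<Theta> c = \<zero>\<^bsub>free_mod R embdim\<^esub>" if "c \<in> m2" for c
      using x mm2 that by (auto simp: \<Theta>_def free_mod_def intro!: restrict_ext)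
    then show "m2 \<subseteq> m \<inter> \<Theta>.ker" using m2_le m.Icarr unfolding \<Theta>.ker_def by auto
    show "m \<inter> \<Theta>.ker \<subseteq> m2"
    proof
      fix c assume c: "c \<in> m \<inter> \<Theta>.ker"
      then have cm: "c \<in> m" "\<Theta> c = \<zero>\<^bsub>free_mod R embdim\<^esub>" by (auto simp: \<Theta>.ker_def)
      then have cx: "x i \<otimes> c = \<zero>" if "i < embdim" for i
        using that free_zero_nth[OF that, of R] by (metis (no_types, lifting) \<Theta>_def lessThan_iff restrict_apply')
      have cc: "c \<in> carrier R" using cm by simp
      have "submodule {y \<in> carrier R. y \<otimes> c = \<zero>} R (self_mod R)"
        using cc by (intro self.submoduleI') (auto simp: l_distr m_assoc)
      moreover have "m2 \<subseteq> {y \<in> carrier R. y \<otimes> c = \<zero>}" using m2m[OF _ cm(1)] m2.Icarr by blast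
      ultimately have "m \<subseteq> {y \<in> carrier R. y \<otimes> c = \<zero>}"
        using gen[of "{y \<in> carrier R. y \<otimes> c = \<zero>}"] cx xc by auto
      then show "c \<in> m2" using soc cm by blast
    qed
  qed
  have im: "\<Theta> ` m \<subseteq> m2F embdim"
    using x mm by (auto simp: \<Theta>_def m2F_def box_def)
  have "lenF embdim (\<Theta> ` m) = embdim"
    using \<Theta>.flen_rank_nullity(2)[OF m_sub flen_m] ker len_m len_m2 by simp
  then have eq: "\<Theta> ` m = m2F embdim"
    using lenF_eq[OF m2F_sub \<Theta>.image_submodule[OF m_sub] im] len_m2F assms(1) by simp
  have "(\<lambda>i\<in>{..<embdim}. g (x i)) \<in> m2F embdim"
    using gm x m2.Icarr by (auto simp: m2F_def box_def)
  then obtain c where c: "c \<in> m" "\<Theta> c = (\<lambda>i\<in>{..<embdim}. g (x i))" using eq by (metis imageE)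
  have cx: "x i \<otimes> c = g (x i)" if "i < embdim" for i
    using c(2) that by (metis (no_types, lifting) \<Theta>_def lessThan_iff restrict_apply')
  have cc: "c \<in> carrier R" using c by simp
  have zero: "g \<zero> = \<zero>" using gm2 m2.zero_closed by blast
  have "submodule {y \<in> m. g y = y \<otimes> c} R (self_mod R)"
  proof (rule self.submoduleI')
    show "{y \<in> m. g y = y \<otimes> c} \<subseteq> carrier (self_mod R)" by auto
  qed (use cc gD zero in \<open>auto simp: l_distr m_assoc m.I_l_closed\<close>)
  moreover have "m2 \<subseteq> {y \<in> m. g y = y \<otimes> c}" using m2_le gm2 m2m[OF _ c(1)] by auto
  ultimately have all: "m \<subseteq> {y \<in> m. g y = y \<otimes> c}"
    using gen[of "{y \<in> m. g y = y \<otimes> c}"] cx x by auto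
  have "f y = (t \<oplus> c) \<otimes> y" if y: "y \<in> m" for y
  proof -
    have "f y = g y \<oplus> t \<otimes> y" using fD(1)[OF y] t y by (simp add: g_def a_minus_def a_assoc l_neg)
    also have "g y = y \<otimes> c" using all y by blast
    also have "y \<otimes> c = c \<otimes> y" using y cc m_comm[of y c] by simp
    finally show ?thesis using t cc y by (simp add: l_distr a_comm)
  qed
  then show "\<exists>c\<in>carrier R. \<forall>x\<in>m. f x = c \<otimes> x" using t cc by blast
qed

end

section \<open>Betti numbers of totally acyclic sequences\<close>

context short_local
begin

text \<open>Total acyclicity at the single spot R^b of R^c -> R^b -> R^a. The condition is symmetric
  under transposition (\<open>dexact_tr\<close>), so each result about a sequence can also be read
  backwards.\<close>

definition dexact :: "nat \<Rightarrow> nat \<Rightarrow> nat \<Rightarrow> (nat \<Rightarrow> nat \<Rightarrow> 'a) \<Rightarrow> (nat \<Rightarrow> nat \<Rightarrow> 'a) \<Rightarrow> bool" where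
  "dexact a b c D E \<longleftrightarrow> mat_over R a b D \<and> mat_over R b c E \<and>
     kr a b D = im b c E \<and> kr c b (tr E) = im b a (tr D)"

lemma dexact_tr: "dexact a b c D E \<Longrightarrow> dexact c b a (tr E) (tr D)"
  by (auto simp: dexact_def)

lemma lin_m_dot:
  assumes f: "lin_m f" and "\<And>l. l < k \<Longrightarrow> u l \<in> carrier R" "\<And>l. l < k \<Longrightarrow> w l \<in> m"
  shows "f (dot k u w) = dot k u (\<lambda>l. f (w l))"
  using assms(2,3)
proof (induction k)
  case 0
  have "f (\<zero> \<otimes> \<zero>) = \<zero> \<otimes> f \<zero>" by (rule lin_mD(3)[OF f]) auto
  then have "f \<zero> = \<zero>" using lin_mD(1)[OF f, of \<zero>] by simp
  then show ?case by simp
next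
  case (Suc k)
  have wc: "w l \<in> carrier R" if "l < Suc k" for l using Suc.prems(2)[OF that] by simp
  have fc: "f (w l) \<in> carrier R" if "l < Suc k" for l using lin_mD(1)[OF f Suc.prems(2)[OF that]] .
  have d: "dot k u w \<in> m" using Suc.prems by (intro dot_in[OF m_sub]) (auto intro: m.I_l_closed)
  have "dot (Suc k) u w = dot k u w \<oplus> u k \<otimes> w k"
    using Suc.prems wc by (intro dot_Suc) auto
  then have "f (dot (Suc k) u w) = f (dot k u w) \<oplus> u k \<otimes> f (w k)"
    using lin_mD(2)[OF f d, of "u k \<otimes> w k"] lin_mD(3)[OF f, of "u k" "w k"] Suc.prems m.I_l_closed by simp
  also have "\<dots> = dot (Suc k) u (\<lambda>l. f (w l))"
    using Suc fc by (subst dot_Suc) auto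
  finally show ?case .
qed

text \<open>If \<open>V v\<close> lies in the socle but some coordinate of \<open>v\<close> is a unit, then every homomorphism
  \<open>f : m \<rightarrow> R\<close>, applied to a row of \<open>W\<close>, gives a cocycle for \<open>P\<^sup>T\<close>, hence a coboundary, and a
  primitive of it exhibits \<open>f\<close> as a multiplication.\<close>

lemma socle_preimage:
  assumes "\<not> baer" and VW: "dexact a b c V W" and WP: "dexact b c d W P" and W: "mat_m b c W"
    and v: "v \<in> carrier (free_mod R b)"
    and soc: "\<And>x. x \<in> m \<Longrightarrow> x \<odot>\<^bsub>free_mod R b\<^esub> v \<in> kr a b V"
  shows "v \<in> mF b"
proof (rule ccontr)
  assume "v \<notin> mF b"
  then obtain j where j: "j < b" "v j \<notin> m" using v by (auto simp: mF_def box_def)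
  have vj: "v j \<in> carrier R" "v j \<in> Units R" using v j unit_iff by auto
  have over: "mat_over R a b V" "mat_over R b c W" "mat_over R c d P"
    using VW WP by (auto simp: dexact_def)
  have Wjl: "W j l \<in> m" if "l < c" for l using W j that by (auto simp: mat_m_def)
  have "im c d P \<subseteq> kr b c W" using WP by (simp add: dexact_def)
  then have WP0: "mat_mul c W P j p = \<zero>" if "p < d" for p
    using im_subset_kr_iff[OF over(2,3)] j that by blast
  have "\<exists>c0\<in>carrier R. \<forall>x\<in>m. f x = c0 \<otimes> x" if f: "lin_m f" for f
  proof -
    note fD = lin_mD[OF f]
    define y where "y = (\<lambda>l\<in>{..<c}. f (W j l))"
    have fc: "f (W j l) \<in> carrier R" if "l < c" for l using fD(1)[OF Wjl[OF that]] .
    have yc: "y \<in> carrier (free_mod R c)" using fc by (auto simp: y_def)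
    have "y \<in> kr d c (tr P)"
    proof -
      have "dot c (tr P p) y = \<zero>" if p: "p < d" for p
      proof -
        have Xl: "P l p \<in> carrier R" if "l < c" for l using over(3) that p by (simp add: mat_over_def)
        have "dot c (tr P p) y = dot c (\<lambda>l. P l p) (\<lambda>l. f (W j l))"
          using Xl fc by (intro dot_cong) (auto simp: tr_def y_def)
        also have "\<dots> = f (dot c (\<lambda>l. P l p) (W j))"
          using lin_m_dot[OF f, of c "\<lambda>l. P l p" "W j"] Xl Wjl by simp
        also have "dot c (\<lambda>l. P l p) (W j) = mat_mul c W P j p"
          unfolding mat_mul_def using Xl Wjl by (intro dot_comm) auto
        also have "f (mat_mul c W P j p) = \<zero>"
          using WP0[OF p] lin_m_dot[OF f, of 0 "W j" "W j"] by simp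
        finally show ?thesis .
      qed
      then show ?thesis using mv_eq_zeroI[of d c "tr P" y] yc over by (simp add: kr_def)
    qed
    then have "y \<in> im c b (tr W)" using WP by (simp add: dexact_def)
    then obtain q where q: "q \<in> carrier (free_mod R b)" "y = mv c b (tr W) q" by (auto simp: im_def)
    have dq: "dot b q v \<in> carrier R" using q v by (auto intro!: dot_closed)
    \<comment> \<open>By the hypothesis on \<open>v\<close>, x v = W z for some z. Coordinate
      \<open>j\<close> reads x v_j = (row j of W) . z, so f(x v_j) = z . y with y equal to the
      transpose of W applied to q. Adjointness turns this into (W z) . q = x (q . v). As v_j is a
      unit, \<open>f\<close> is multiplication by (q . v) / v_j.\<close>
    have key: "f (x \<otimes> v j) = x \<otimes> dot b q v" if x: "x \<in> m" for x
    proof -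
      have xv: "x \<odot>\<^bsub>free_mod R b\<^esub> v \<in> im b c W" using soc[OF x] VW by (simp add: dexact_def)
      then obtain z where z: "z \<in> carrier (free_mod R c)" "x \<odot>\<^bsub>free_mod R b\<^esub> v = mv b c W z" by (auto simp: im_def)
      have zc: "z l \<in> carrier R" if "l < c" for l using z that by auto
      have "x \<otimes> v j = dot c (W j) z" using z(2) j by (metis mv_nth free_smult_nth)
      also have "\<dots> = dot c z (W j)" using zc Wjl by (intro dot_comm) auto
      finally have "f (x \<otimes> v j) = dot c z (\<lambda>l. f (W j l))" using lin_m_dot[OF f, of c z "W j"] zc Wjl by simp
      also have "\<dots> = dot c z y" using zc fc by (intro dot_cong) (auto simp: y_def)
      also have "\<dots> = dot c y z" using zc yc by (intro dot_comm) auto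
      also have "\<dots> = dot c z (mv c b (tr W) q)" using zc yc q by (subst dot_comm) auto
      also have "\<dots> = dot b (mv b c W z) q"
        using mv_adjoint[of c b "tr W" z q] over z q by simp
      also have "\<dots> = dot b q (x \<odot>\<^bsub>free_mod R b\<^esub> v)" using z q mv_closed[OF over(2) z(1)] by (subst dot_comm) auto
      also have "\<dots> = dot b q (\<lambda>i. x \<otimes> v i)" using q v x by (intro dot_cong) (auto simp: free_smult_nth)
      also have "\<dots> = x \<otimes> dot b q v" using q v x by (intro dot_smult) auto
      finally show ?thesis .
    qed
    have "f x = (inv (v j) \<otimes> dot b q v) \<otimes> x" if x: "x \<in> m" for x
    proof -
      have xc: "x \<in> carrier R" using x by simp
      have "x = inv (v j) \<otimes> (x \<otimes> v j)" using vj xc by (simp add: m_lcomm)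
      moreover have "x \<otimes> v j \<in> m" using x vj m.I_r_closed by blast
      ultimately have "f x = inv (v j) \<otimes> f (x \<otimes> v j)" using fD(3)[of "inv (v j)" "x \<otimes> v j"] vj by simp
      then show ?thesis using key[OF x] vj dq xc by (simp add: m_ac)
    qed
    then show ?thesis using vj dq by (intro bexI[of _ "inv (v j) \<otimes> dot b q v"]) auto
  qed
  then have baer unfolding baer_def by blast
  then show False using assms(1) by simp
qed

text \<open>For x in the socle, x times the first unit vector is killed by \<open>V\<close>, hence
  equals W w for some w. As m w lies in the kernel of \<open>W\<close>,
  \<open>socle_preimage\<close> one place further along gives w in mF, so that W w has its
  coordinates in m^2.\<close>

lemma socle_eq_m2:
  assumes nb: "\<not> baer" and VW: "dexact a b c V W" and WP: "dexact b c d W P" and PY: "dexact c d e' P Y"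
    and m: "mat_m a b V" "mat_m b c W" "mat_m c d P" and "0 < b"
    and x: "x \<in> m" "\<And>y. y \<in> m \<Longrightarrow> y \<otimes> x = \<zero>"
  shows "x \<in> m2"
proof -
  define v where "v = x \<odot>\<^bsub>free_mod R b\<^esub> unit_vec b 0"
  have xc: "x \<in> carrier R" using x by simp
  have vc: "v \<in> carrier (free_mod R b)" using xc by (simp add: v_def)
  have v0: "v 0 = x" using xc \<open>0 < b\<close> by (simp add: v_def free_smult_nth unit_vec_def)
  have vi: "y \<otimes> v i = \<zero>" if "y \<in> m" "i < b" for y i
    using that x xc by (auto simp: v_def free_smult_nth unit_vec_def)
  have "dot b (V i) v = \<zero>" if "i < a" for i
    using vi m(1) that by (intro dot_eq_zero) (auto simp: mat_m_def)
  then have "v \<in> kr a b V" using mv_eq_zeroI[OF mat_m_over[OF m(1)] vc] vc by (simp add: kr_def)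
  then have "v \<in> im b c W" using VW by (simp add: dexact_def)
  then obtain w where w: "w \<in> carrier (free_mod R c)" "v = mv b c W w" by (auto simp: im_def)
  have "w \<in> mF c"
  proof (rule socle_preimage[OF nb WP PY m(3) w(1)])
    fix y assume y: "y \<in> m"
    have "mv b c W (y \<odot>\<^bsub>free_mod R c\<^esub> w) = y \<odot>\<^bsub>free_mod R b\<^esub> v"
      using linear_map.smult[OF mv_linear[OF mat_m_over[OF m(2)]]] y w by simp
    also have "\<dots> = \<zero>\<^bsub>free_mod R b\<^esub>"
      using y vc vi by (intro free_eqI[of _ R b]) (auto simp: free_smult_nth free_zero_nth)
    finally show "y \<odot>\<^bsub>free_mod R c\<^esub> w \<in> kr b c W" using y w by (simp add: kr_def)
  qed
  then have "v \<in> m2F b" using mv_in_m2F[OF m(2)] w by simp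
  then show ?thesis using v0 \<open>0 < b\<close> by (auto simp: m2F_def box_def)
qed

text \<open>\<open>m2F b\<close> lies in the kernel of \<open>V\<close>, which is the image of
  \<open>W\<close>, and \<open>socle_preimage\<close> places every preimage in
  \<open>mF c\<close>.\<close>

lemma image_mF:
  assumes nb: "\<not> baer" and VW: "dexact a b c V W" and WP: "dexact b c d W P" and PY: "dexact c d e' P Y"
    and m: "mat_m a b V" "mat_m b c W" "mat_m c d P"
  shows "mv b c W ` mF c = m2F b"
proof
  show "mv b c W ` mF c \<subseteq> m2F b" using mv_in_m2F[OF m(2)] by blast
  show "m2F b \<subseteq> mv b c W ` mF c"
  proof
    fix y assume y: "y \<in> m2F b"
    then have "y \<in> im b c W" using m2F_subset_kr[OF m(1)] VW by (auto simp: dexact_def)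
    then obtain w where w: "w \<in> carrier (free_mod R c)" "y = mv b c W w" by (auto simp: im_def)
    have "w \<in> mF c"
    proof (rule socle_preimage[OF nb WP PY m(3) w(1)])
      fix x assume x: "x \<in> m"
      have "mv b c W (x \<odot>\<^bsub>free_mod R c\<^esub> w) = x \<odot>\<^bsub>free_mod R b\<^esub> y"
        using linear_map.smult[OF mv_linear[OF mat_m_over[OF m(2)]]] x w by simp
      also have "\<dots> = \<zero>\<^bsub>free_mod R b\<^esub>"
        using x y m2F_closed mm2 by (intro free_eqI[of _ R b]) (auto simp: free_smult_nth free_zero_nth m2F_def box_def)
      finally show "x \<odot>\<^bsub>free_mod R c\<^esub> w \<in> kr b c W" using x w by (simp add: kr_def)
    qed
    then show "y \<in> mv b c W ` mF c" using w by blast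
  qed
qed

text \<open>Rank and nullity for \<open>W\<close> on \<open>mF c\<close>: minimality puts the whole
  kernel of \<open>W\<close> inside \<open>mF c\<close>, and the image is
  \<open>m2F b\<close>.\<close>

lemma kernel_length:
  assumes nb: "\<not> baer" and VW: "dexact a b c V W" and WP: "dexact b c d W P" and PY: "dexact c d e' P Y"
    and m: "mat_m a b V" "mat_m b c W" "mat_m c d P"
  shows "lenF c (kr b c W) + b * socdim = c * (embdim + socdim)"
proof -
  have "kr b c W = im c d P" using WP by (simp add: dexact_def)
  then have "kr b c W \<subseteq> mF c" using im_subset_mF[OF m(3)] by simp
  then have "mF c \<inter> kr b c W = kr b c W" by blast
  then show ?thesis
    using mv_len[OF mat_m_over[OF m(2)] mF_sub] image_mF[OF assms] len_mF len_m2F by simp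
qed

text \<open>Comparing the forward and the transposed recursion yields (b4 - b2)(r - 1) = 0 and (b5 -
  b3)(r - 1) = 0, which is where r \<ge> 2 is used. What is left, b3 e = b2 (1 + r) and b2 e = b3 (1
  + r), gives e^2 = (1 + r)^2.\<close>

lemma betti_arith:
  fixes b2 b3 b4 b5 e r :: nat
  assumes "b3 * e = b4 + b2 * r" "b4 * e = b5 + b3 * r" "b3 * e = b2 + b4 * r" "b4 * e = b3 + b5 * r"
    and r: "2 \<le> r" and "0 < b2"
  shows "e = 1 + r \<and> b3 = b2 \<and> b4 = b2"
proof -
  have eq: "x = y" if "x + y * r = y + x * r" for x y :: nat
  proof (rule ccontr)
    have "(int x - int y) * (int r - 1) = 0"
      using arg_cong[OF that, of int] by (simp add: algebra_simps)
    moreover assume "x \<noteq> y"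
    ultimately show False using r by auto
  qed
  have b4: "b4 = b2" using eq[of b4 b2] assms(1,3) by simp
  have b5: "b5 = b3" using eq[of b5 b3] assms(2,4) by simp
  have 1: "b3 * e = b2 * (1 + r)" "b2 * e = b3 * (1 + r)" using assms b4 b5 by (simp_all add: algebra_simps)
  have "b2 * (e * e) = b2 * ((1 + r) * (1 + r))"
    using 1 by (metis mult.assoc mult.commute)
  then have "e * e = (1 + r) * (1 + r)" using assms(6) unfolding mult_cancel1 by simp
  then have "e = 1 + r" by (metis power2_eq_square power2_nat_le_eq_le le_antisym order_refl)
  then show ?thesis using 1 b4 by (metis mult_cancel2 add_is_0 one_neq_zero)
qed

end

text \<open>\<open>D 0\<close> need not have its entries in \<open>m\<close>. It provides exactness
  of the sequence and of its transpose at the target of \<open>D 1\<close>. That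
  \<open>\<beta> 1\<close> and \<open>\<beta> 2\<close> agree reflects the square presentation
  matrix.\<close>

locale acyclic_seq = short_local +
  fixes \<beta> :: "nat \<Rightarrow> nat" and D :: "nat \<Rightarrow> nat \<Rightarrow> nat \<Rightarrow> 'a" and n :: nat
  assumes not_baer: "\<not> baer"
    and dex: "\<And>i. dexact (\<beta> i) (\<beta> (Suc i)) (\<beta> (Suc (Suc i))) (D i) (D (Suc i))"
    and Dm: "\<And>i. mat_m (\<beta> (Suc i)) (\<beta> (Suc (Suc i))) (D (Suc i))"
    and n: "\<beta> 1 = n" "\<beta> 2 = n" "0 < n"
begin

lemma D_over: "mat_over R (\<beta> i) (\<beta> (Suc i)) (D i)"
  using dex by (simp add: dexact_def)

lemma kr_length:
  "lenF (\<beta> (Suc (Suc (Suc i)))) (kr (\<beta> (Suc (Suc i))) (\<beta> (Suc (Suc (Suc i)))) (D (Suc (Suc i)))) + \<beta> (Suc (Suc i)) * socdim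
     = \<beta> (Suc (Suc (Suc i))) * (embdim + socdim)"
  by (rule kernel_length[OF not_baer dex dex dex Dm Dm Dm])

text \<open>The count of \<open>kr_length\<close> for the sequence read backwards. For
  \<open>D 2\<close> the two maps that follow are then the transposes of \<open>D 1\<close> and
  \<open>D 0\<close>.\<close>

lemma kr_tr_length:
  "lenF (\<beta> (Suc (Suc i))) (kr (\<beta> (Suc (Suc (Suc i)))) (\<beta> (Suc (Suc i))) (tr (D (Suc (Suc i))))) + \<beta> (Suc (Suc (Suc i))) * socdim
     = \<beta> (Suc (Suc i)) * (embdim + socdim)"
  by (rule kernel_length[OF not_baer dex[THEN dexact_tr] dex[THEN dexact_tr] dex[THEN dexact_tr]])
    (simp_all add: Dm)

lemma im_eq: "im (\<beta> (Suc i)) (\<beta> (Suc (Suc i))) (D (Suc i)) = kr (\<beta> i) (\<beta> (Suc i)) (D i)"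
  using dex[of i] by (simp add: dexact_def)

lemma im_tr_eq: "im (\<beta> (Suc i)) (\<beta> i) (tr (D i)) = kr (\<beta> (Suc (Suc i))) (\<beta> (Suc i)) (tr (D (Suc i)))"
  using dex[of i] by (simp add: dexact_def)

text \<open>Rank and nullity for \<open>D (i + 3)\<close>, whose image is the kernel of
  \<open>D (i + 2)\<close>, with both kernel lengths inserted.\<close>

lemma betti_rec:
  "\<beta> (Suc (Suc (Suc i))) * embdim = \<beta> (Suc (Suc (Suc (Suc i)))) + \<beta> (Suc (Suc i)) * socdim"
  using mv_len_full[OF D_over[of "Suc (Suc (Suc i))"]] kr_length[of "Suc i"] kr_length[of i]
  by (simp add: im_eq algebra_simps)

lemma betti_rec_tr:
  "\<beta> (Suc (Suc (Suc i))) * embdim = \<beta> (Suc (Suc i)) + \<beta> (Suc (Suc (Suc (Suc i)))) * socdim"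
proof -
  have "mat_over R (\<beta> (Suc (Suc (Suc i)))) (\<beta> (Suc (Suc i))) (tr (D (Suc (Suc i))))" using D_over by simp
  from mv_len_full[OF this] show ?thesis
    using kr_tr_length[of "Suc i"] kr_tr_length[of i] by (simp add: im_tr_eq algebra_simps)
qed

lemma socdim_ge_2: "2 \<le> socdim"
proof (rule ccontr)
  assume "\<not> 2 \<le> socdim"
  then have "socdim = 1" using socdim_pos by simp
  moreover have "x \<in> m2" if "x \<in> m" "\<And>y. y \<in> m \<Longrightarrow> y \<otimes> x = \<zero>" for x
    by (rule socle_eq_m2[OF not_baer dex dex dex Dm[of 0] Dm Dm]) (use n that in \<open>simp_all add: numeral_eq_Suc\<close>)
  ultimately show False using socdim_1_imp_baer not_baer by blast
qed

lemma betti: "embdim = 1 + socdim" "\<beta> 3 = n" "\<beta> 4 = n"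
proof -
  have "embdim = 1 + socdim \<and> \<beta> 3 = \<beta> 2 \<and> \<beta> 4 = \<beta> 2"
    using betti_rec[of 0] betti_rec[of 1] betti_rec_tr[of 0] betti_rec_tr[of 1] socdim_ge_2 n
    by (intro betti_arith[of "\<beta> 3" _ "\<beta> 4" _ _ "\<beta> 5"]) (simp_all add: numeral_eq_Suc)
  then show "embdim = 1 + socdim" "\<beta> 3 = n" "\<beta> 4 = n" using n by auto
qed

text \<open>Each of these kernels has half the length of R^n, because 1 + embdim + socdim = 2
  embdim.\<close>

lemma len_kernels:
  "lenF n (kr n n (D 2)) = n * embdim" "lenF n (kr n n (tr (D 2))) = n * embdim"
  "lenF n (kr n n (D 1)) = n * embdim" "lenF n (kr n n (tr (D 1))) = n * embdim"
proof -
  note nn = n betti(2,3)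
  have nn': "\<beta> (Suc 0) = n" "\<beta> (Suc (Suc 0)) = n" "\<beta> (Suc (Suc (Suc 0))) = n"
    using nn by (simp_all add: numeral_eq_Suc)
  show 1: "lenF n (kr n n (D 2)) = n * embdim" "lenF n (kr n n (tr (D 2))) = n * embdim"
    using kr_length[of 0] kr_tr_length[of 0] nn' by (simp_all add: numeral_eq_Suc algebra_simps)
  have D: "mat_over R n n (D 1)" "mat_over R n n (D 2)" "mat_over R n n (tr (D 1))"
    using D_over[of 1] D_over[of 2] nn' by (simp_all add: numeral_eq_Suc)
  have "im n n (D 2) = kr n n (D 1)" "im n n (tr (D 1)) = kr n n (tr (D 2))"
    using im_eq[of 1] im_tr_eq[of 1] nn' by (simp_all add: numeral_eq_Suc)
  then show "lenF n (kr n n (D 1)) = n * embdim" "lenF n (kr n n (tr (D 1))) = n * embdim"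
    using mv_len_full[OF D(2)] mv_len_full[OF D(3)] 1 betti(1) by (simp_all add: algebra_simps)
qed

end

section \<open>Diagonal entries of triangular matrices\<close>

context short_local
begin

interpretation self: module R "self_mod R" by (rule self_module)

abbreviation step :: "nat \<Rightarrow> 'a set \<Rightarrow> 'a set \<Rightarrow> nat \<Rightarrow> 'a set" where
  "step j A B \<equiv> \<lambda>i. if i < j then A else B"

lemma len_box_step:
  assumes "submodule A R (self_mod R)" "submodule B R (self_mod R)" "j \<le> n"
  shows "lenF n (box n (step j A B)) = j * len R (self_mod R) A + (n - j) * len R (self_mod R) B"
proof -
  have "{..<n} = {..<j} \<union> {j..<n}" using assms(3) by auto
  then have "(\<Sum>i<n. len R (self_mod R) (step j A B i)) =
      (\<Sum>i\<in>{..<j}. len R (self_mod R) (step j A B i)) + (\<Sum>i\<in>{j..<n}. len R (self_mod R) (step j A B i))"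
    by (metis finite_lessThan finite_atLeastLessThan ivl_disj_int_one(2) sum.union_disjoint)
  also have "\<dots> = j * len R (self_mod R) A + (n - j) * len R (self_mod R) B" by simp
  finally show ?thesis using len_box[of n "step j A B"] assms by simp
qed

lemma box_step_sub:
  "submodule A R (self_mod R) \<Longrightarrow> submodule B R (self_mod R) \<Longrightarrow> submodule (box n (step j A B)) R (free_mod R n)"
  by (intro box_submodule) auto

lemma box_mono: "(\<And>i. i < n \<Longrightarrow> J i \<subseteq> J' i) \<Longrightarrow> box n J \<subseteq> box n J'"
  unfolding box_def by blast

lemma len_zero_ideal [simp]: "len R (self_mod R) {\<zero>} = 0"
  using self.len_zero by simp

lemma dot_comm_vec:
  "u \<in> carrier (free_mod R n) \<Longrightarrow> v \<in> carrier (free_mod R n) \<Longrightarrow> dot n u v = dot n v u"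
  by (rule dot_comm) auto

lemma perp_submodule:
  assumes G: "G \<subseteq> carrier (free_mod R n)"
  shows "submodule {u \<in> m2F n. \<forall>v\<in>G. dot n v u = \<zero>} R (free_mod R n)" (is "submodule ?P _ _")
proof -
  interpret F: module R "free_mod R n" by (rule free_module)
  have lin: "linear_map R (free_mod R n) (self_mod R) (dot n v)" if "v \<in> G" for v
    using dot_linear that G by blast
  show ?thesis
  proof (rule F.submoduleI')
    show "?P \<subseteq> carrier (free_mod R n)" using m2F_closed by blast
    show "\<zero>\<^bsub>free_mod R n\<^esub> \<in> ?P"
      using F.submodule_zero[OF m2F_sub] linear_map.zero[OF lin] by auto
    fix x y assume xy: "x \<in> ?P" "y \<in> ?P"
    then have "x \<in> carrier (free_mod R n)" "y \<in> carrier (free_mod R n)" using m2F_closed by blast+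
    then show "x \<oplus>\<^bsub>free_mod R n\<^esub> y \<in> ?P"
      using xy F.submoduleE(5)[OF m2F_sub] linear_map.add[OF lin] by auto
  next
    fix a x assume a: "a \<in> carrier R" and x: "x \<in> ?P"
    then have "x \<in> carrier (free_mod R n)" using m2F_closed by blast
    then show "a \<odot>\<^bsub>free_mod R n\<^esub> x \<in> ?P"
      using x a F.submoduleE(4)[OF m2F_sub] linear_map.smult[OF lin] by auto
  qed
qed

text \<open>Orthogonal complements inside \<open>m\<^sup>2R\<^sup>n\<close>: adjoining one generator to \<open>G\<close> imposes one more
  equation with values in \<open>m\<^sup>2\<close>.\<close>

lemma len_perp:
  assumes "submodule G R (free_mod R n)" "mF n \<subseteq> G"
    "lenF n (carrier (free_mod R n)) \<le> lenF n G + q"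
  shows "lenF n {u \<in> m2F n. \<forall>v\<in>G. dot n v u = \<zero>} \<le> q * socdim"
  using assms
proof (induction q arbitrary: G)
  case 0
  interpret F: module R "free_mod R n" by (rule free_module)
  have "G = carrier (free_mod R n)"
    using lenF_eq[OF free_sub 0(1)] F.submoduleE(1)[OF 0(1)] 0(3) by simp
  then have Gc: "G \<subseteq> carrier (free_mod R n)" by simp
  have "u = \<zero>\<^bsub>free_mod R n\<^esub>" if "u \<in> m2F n" "\<forall>v\<in>G. dot n v u = \<zero>" for u
  proof (intro free_eqI[of _ R n])
    show uc: "u \<in> carrier (free_mod R n)" using that m2F_closed by blast
    fix i assume i: "i < n"
    have "dot n (unit_vec n i) u = u i"
      using uc i dot_unit[of n u i] by (subst dot_comm) (auto simp: unit_vec_def)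
    then show "u i = \<zero>\<^bsub>free_mod R n\<^esub> i"
      using that \<open>G = _\<close> i by (simp add: free_zero_nth)
  qed simp
  moreover have "dot n v \<zero>\<^bsub>free_mod R n\<^esub> = \<zero>" if "v \<in> carrier (free_mod R n)" for v
    using that by (intro dot_eq_zero) (auto simp: free_zero_nth free_nth)
  ultimately have "{u \<in> m2F n. \<forall>v\<in>G. dot n v u = \<zero>} = {\<zero>\<^bsub>free_mod R n\<^esub>}"
    using F.submodule_zero[OF m2F_sub] Gc by blast
  then show ?case by simp
next
  case (Suc q)
  interpret F: module R "free_mod R n" by (rule free_module)
  let ?P = "\<lambda>G. {u \<in> m2F n. \<forall>v\<in>G. dot n v u = \<zero>}"
  have Gc: "G \<subseteq> carrier (free_mod R n)" using F.submoduleE(1)[OF Suc.prems(1)] .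
  note Psub = perp_submodule
  show ?case
  proof (cases "G = carrier (free_mod R n)")
    case True
    then have "lenF n (?P G) \<le> q * socdim" using Suc.IH[OF Suc.prems(1,2)] by simp
    then show ?thesis by simp
  next
    case False
    then obtain x where x: "x \<in> carrier (free_mod R n)" "x \<notin> G" using Gc by blast
    let ?G = "add_cyclic R (free_mod R n) G x"
    have nu: "r \<odot>\<^bsub>free_mod R n\<^esub> x \<in> G" if "r \<in> carrier R - Units R" for r
    proof -
      have "r \<odot>\<^bsub>free_mod R n\<^esub> x \<in> mF n"
        using nonunit[OF that] that x by (auto simp: mF_def box_def free_smult_nth free_nth m.I_r_closed)
      then show ?thesis using Suc.prems by blast
    qed
    note ac = F.add_cyclic_submodule[OF Suc.prems(1) x(1)] F.add_cyclic_superset[OF Suc.prems(1) x(1)]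
    have "lenF n ?G = lenF n G + 1"
      using F.flen_add_cyclic(3)[OF flen_free[OF Suc.prems(1)] x(1) nu x(2)] .
    then have IH: "lenF n (?P ?G) \<le> q * socdim"
      using Suc.IH[OF ac(1)] Suc.prems ac(2) by auto
    interpret d: linear_map R "free_mod R n" "self_mod R" "dot n x" by (rule dot_linear[OF x(1)])
    have "?P G \<inter> d.ker \<subseteq> ?P ?G"
    proof
      fix u assume u: "u \<in> ?P G \<inter> d.ker"
      then have uc: "u \<in> carrier (free_mod R n)" "dot n x u = \<zero>" by (auto simp: d.ker_def)
      have "dot n v u = \<zero>" if "v \<in> ?G" for v
      proof -
        obtain g r where gr: "v = g \<oplus>\<^bsub>free_mod R n\<^esub> r \<odot>\<^bsub>free_mod R n\<^esub> x" "g \<in> G" "r \<in> carrier R"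
          using \<open>v \<in> ?G\<close> by (auto simp: add_cyclic_def)
        have gc: "g \<in> carrier (free_mod R n)" using gr Gc by blast
        interpret u: linear_map R "free_mod R n" "self_mod R" "dot n u" by (rule dot_linear[OF uc(1)])
        have c: "dot n v u = dot n u v" "dot n u g = dot n g u" "dot n u x = dot n x u"
          using dot_comm_vec[OF _ uc(1)] dot_comm_vec[OF uc(1)] gc x gr(3) unfolding gr(1) by simp_all
        have "dot n u v = dot n u g \<oplus> r \<otimes> dot n u x"
          unfolding gr(1) using gc x gr by (simp add: u.add u.smult)
        moreover have "dot n g u = \<zero>" using u gr by blast
        ultimately show ?thesis using c gr uc by simp
      qed
      then show "u \<in> ?P ?G" using u by auto
    qed
    then have 1: "lenF n (?P G \<inter> d.ker) \<le> q * socdim"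
      using lenF_mono[OF Psub[OF F.submoduleE(1)[OF ac(1)]] F.submodule_inter[OF Psub[OF Gc] d.ker_submodule]] IH
      by linarith
    have "dot n x ` ?P G \<subseteq> m2"
      using x by (auto intro!: dot_in[OF m2_sub] m2.I_l_closed simp: m2F_def box_def free_nth)
    then have 2: "len R (self_mod R) (dot n x ` ?P G) \<le> socdim"
      using self.len_mono[OF flen_self[OF m2_sub] d.image_submodule[OF Psub[OF Gc]]] len_m2 by simp
    show ?thesis
      using d.flen_rank_nullity(2)[OF Psub[OF Gc] flen_free[OF Psub[OF Gc]]] 1 2 by simp
  qed
qed

lemma dot_single:
  assumes I: "submodule I R (self_mod R)" and u: "\<And>k. k < n \<Longrightarrow> u k \<in> carrier R" "\<And>k. k < n \<Longrightarrow> v k \<in> carrier R"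
    and i: "i < n" and o: "\<And>k. k < n \<Longrightarrow> k \<noteq> i \<Longrightarrow> u k \<otimes> v k \<in> I"
  shows "\<exists>s\<in>I. dot n u v = u i \<otimes> v i \<oplus> s"
proof -
  have Ic: "I \<subseteq> carrier R" using self.submoduleE(1)[OF I] by simp
  let ?s = "\<Oplus>k\<in>{..<n} - {i}. u k \<otimes> v k"
  have "insert i ({..<n} - {i}) = {..<n}" using i by auto
  then have "dot n u v = u i \<otimes> v i \<oplus> ?s"
    unfolding dot_def using finsum_insert[of "{..<n} - {i}" i "\<lambda>k. u k \<otimes> v k"] u i by auto
  moreover have "?s \<in> I"
  proof -
    have "?s = (\<Oplus>\<^bsub>self_mod R\<^esub>k\<in>{..<n} - {i}. u k \<otimes> v k)" using o Ic by (subst self_finsum) auto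
    then show ?thesis using submodule_finsum[OF self_module I, of "{..<n} - {i}" "\<lambda>k. u k \<otimes> v k"] o by simp
  qed
  ultimately show ?thesis by blast
qed

lemma dot_one_term:
  assumes "\<And>k. k < n \<Longrightarrow> u k \<in> carrier R" "\<And>k. k < n \<Longrightarrow> v k \<in> carrier R"
    "i < n" "\<And>k. k < n \<Longrightarrow> k \<noteq> i \<Longrightarrow> u k \<otimes> v k = \<zero>"
  shows "dot n u v = u i \<otimes> v i"
  using dot_single[OF zero_sub assms(1,2,3)] assms by auto

end

text \<open>Only \<open>U\<close> is triangular; \<open>W\<close> is any minimal matrix continuing
  it. The length hypotheses are those supplied by \<open>len_kernels\<close>.\<close>

locale triangular_pair = short_local +
  fixes n :: nat and U W :: "nat \<Rightarrow> nat \<Rightarrow> 'a"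
  assumes triangular: "\<And>i j. i < n \<Longrightarrow> j < i \<Longrightarrow> U i j = \<zero>"
    and U: "mat_m n n U" and W: "mat_m n n W" and UW: "dexact n n n U W"
    and len_kr: "lenF n (kr n n U) = n * embdim"
    and len_kr_tr: "lenF n (kr n n (tr U)) = n * embdim"
    and embdim: "embdim = 1 + socdim" and socdim: "2 \<le> socdim"
begin

interpretation self: module R "self_mod R" by (rule self_module)
interpretation F: module R "free_mod R n" by (rule free_module)

text \<open>With E_j spanned by the first \<open>j\<close> unit vectors, \<open>M j\<close> and
  \<open>S j\<close> are m E_j and m^2 E_j.\<close>

abbreviation "M j \<equiv> box n (step j m {\<zero>})"
abbreviation "S j \<equiv> box n (step j m2 {\<zero>})"

lemma M_sub: "submodule (M j) R (free_mod R n)" and S_sub: "submodule (S j) R (free_mod R n)"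
  by (auto intro!: box_step_sub m_sub m2_sub zero_sub)

lemma U_over: "mat_over R n n U" and W_over: "mat_over R n n W"
  using U W mat_m_over by auto

lemma kr_U: "kr n n U = im n n W" and kr_tr_W: "kr n n (tr W) = im n n (tr U)"
  using UW by (auto simp: dexact_def)

lemma kr_sub_mF: "kr n n U \<subseteq> mF n"
  using im_subset_mF[OF W] kr_U by simp

lemma triangular_mv:
  assumes v: "v \<in> carrier (free_mod R n)" "\<And>k. j \<le> k \<Longrightarrow> k < n \<Longrightarrow> v k = \<zero>"
    and i: "j \<le> i" "i < n"
  shows "mv n n U v i = \<zero>"
proof -
  have "U i k \<otimes> v k = \<zero>" if "k < n" for k
  proof (cases "k < i")
    case True
    then show ?thesis using triangular[OF i(2)] v(1) that by (simp add: free_nth)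
  next
    case False
    then show ?thesis using v(2)[of k] i that mat_overD[OF U_over i(2)] by simp
  qed
  then show ?thesis using i by (simp add: mv_nth dot_eq_zero)
qed

lemma image_M_subset: "mv n n U ` M j \<subseteq> S j"
proof
  fix y assume "y \<in> mv n n U ` M j"
  then obtain v where v: "v \<in> M j" "y = mv n n U v" by blast
  have vc: "v \<in> carrier (free_mod R n)" using v by (simp add: box_def)
  have vi: "v k \<in> step j m {\<zero>} k" if "k < n" for k using v that unfolding box_def by blast
  have "M j \<subseteq> mF n" unfolding mF_def by (rule box_mono) (auto simp: m.zero_closed)
  then have "v \<in> mF n" using v by blast
  then have "y \<in> m2F n" using mv_in_m2F[OF U] v by blast
  then have y: "y \<in> carrier (free_mod R n)" "\<And>i. i < n \<Longrightarrow> y i \<in> m2" by (auto simp: m2F_def box_def)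
  have "v k = \<zero>" if "j \<le> k" "k < n" for k using vi[OF that(2)] that(1) by simp
  then have "y i = \<zero>" if "i < n" "\<not> i < j" for i
    using triangular_mv[OF vc, of j i] that v(2) by simp
  then show "y \<in> S j" using y by (auto simp: box_def)
qed

text \<open>A vector supported in the coordinates up to \<open>i\<close> meets row \<open>i\<close>
  of \<open>U\<close> only in the diagonal entry, since the entries left of it vanish. A preimage of
  y times unit vector \<open>i\<close> therefore solves the equation in its coordinate
  \<open>i\<close>.\<close>

lemma diag_nonsquare:
  assumes "mv n n U ` M (Suc i) = S (Suc i)" "i < n" and y: "y \<in> m2"
  shows "\<exists>x\<in>m. U i i \<otimes> x = y"
proof -
  define w where "w = (\<lambda>k\<in>{..<n}. if k = i then y else \<zero>)"
  have "w \<in> S (Suc i)" using y assms(2) m2.Icarr by (auto simp: w_def box_def free_mod_carrier)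
  then obtain v where v: "v \<in> M (Suc i)" "w = mv n n U v" using assms(1) by blast
  have vc: "v \<in> carrier (free_mod R n)" using v by (simp add: box_def)
  have vi: "v k \<in> step (Suc i) m {\<zero>} k" if "k < n" for k using v that unfolding box_def by blast
  have "dot n (U i) v = U i i \<otimes> v i"
  proof (rule dot_one_term)
    fix k assume k: "k < n" "k \<noteq> i"
    show "U i k \<otimes> v k = \<zero>"
    proof (cases "k < i")
      case True
      then show ?thesis using triangular[OF assms(2)] vc k by (simp add: free_nth)
    next
      case False
      then show ?thesis using vi[OF k(1)] k mat_overD[OF U_over assms(2)] by auto
    qed
  qed (use vc assms(2) mat_overD[OF U_over assms(2)] in \<open>auto simp: free_nth\<close>)
  moreover have "w i = y" using assms(2) by (simp add: w_def)
  ultimately have "U i i \<otimes> v i = y" using v(2) assms(2) by (simp add: mv_nth)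
  moreover have "v i \<in> m" using vi[OF assms(2)] by simp
  ultimately show ?thesis by blast
qed

text \<open>An entry in \<open>m2\<close> annihilates \<open>m\<close>, so it could not reach a
  nonzero element of \<open>m2\<close>.\<close>

lemma diag_not_m2:
  assumes "mv n n U ` M (Suc i) = S (Suc i)" "i < n"
  shows "U i i \<notin> m2"
proof
  assume "U i i \<in> m2"
  obtain y where y: "y \<in> m2" "y \<noteq> \<zero>" using square m2.zero_closed by blast
  then obtain x where "x \<in> m" "U i i \<otimes> x = y" using diag_nonsquare[OF assms] by blast
  then show False using m2m[OF \<open>U i i \<in> m2\<close>] y by simp
qed

text \<open>Forward substitution in the lower triangular transpose: once the earlier coordinates of
  \<open>w\<close> are in \<open>m\<close>, their contributions to row \<open>i\<close> lie in
  \<open>m2\<close>, so the diagonal entry times \<open>w i\<close> does too. A unit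
  \<open>w i\<close> would then put the diagonal entry itself into \<open>m2\<close>. The argument
  stops before \<open>j'\<close>, because only the entries before it are known to avoid
  \<open>m2\<close>.\<close>

lemma tr_preimage_bound:
  assumes good: "\<And>i. i < j' \<Longrightarrow> mv n n U ` M (Suc i) = S (Suc i)" and j: "j' < n"
    and w: "w \<in> carrier (free_mod R n)" "\<And>i. i \<le> j' \<Longrightarrow> mv n n (tr U) w i \<in> m2"
  shows "i < j' \<Longrightarrow> w i \<in> m"
proof (induction i rule: less_induct)
  case (less i)
  have i: "i < n" using less j by simp
  have wc: "w k \<in> carrier R" if "k < n" for k using w that by auto
  have Uc: "U k i \<in> m" if "k < n" for k using U that i by (auto simp: mat_m_def)
  have "\<exists>s\<in>m2. dot n (tr U i) w = tr U i i \<otimes> w i \<oplus> s"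
  proof (rule dot_single[OF m2_sub])
    fix k assume k: "k < n" "k \<noteq> i"
    show "tr U i k \<otimes> w k \<in> m2"
    proof (cases "k < i")
      case True
      then show ?thesis using less Uc[OF k(1)] mm by (simp add: tr_def)
    next
      case False
      then show ?thesis using triangular[of k i] k wc by (simp add: tr_def m2.zero_closed)
    qed
  qed (use wc Uc i in \<open>auto simp: tr_def\<close>)
  then obtain s where s: "s \<in> m2" "dot n (tr U i) w = U i i \<otimes> w i \<oplus> s" by (auto simp: tr_def)
  have "dot n (tr U i) w \<in> m2" using w(2)[of i] less i by (simp add: mv_nth)
  moreover have c: "U i i \<otimes> w i \<in> carrier R" "s \<in> carrier R" using wc[OF i] Uc[OF i] s m2.Icarr by auto
  moreover have "U i i \<otimes> w i = dot n (tr U i) w \<oplus> \<ominus> s" using s c by (simp add: a_assoc r_neg)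
  moreover have "dot n (tr U i) w \<oplus> \<ominus> s \<in> m2"
    using m2.a_closed[OF _ m2.a_inv_closed[OF s(1)]] calculation(1) by blast
  ultimately have 1: "U i i \<otimes> w i \<in> m2" by metis
  show "w i \<in> m"
  proof (rule ccontr)
    assume "w i \<notin> m"
    then have u: "w i \<in> Units R" using unit_iff wc[OF i] by simp
    have "U i i = (U i i \<otimes> w i) \<otimes> inv (w i)" using u wc[OF i] Uc[OF i] by (simp add: m_assoc)
    then have "U i i \<in> m2" using m2.I_r_closed[OF 1, of "inv (w i)"] u by simp
    then show False using diag_not_m2[OF good] less i by blast
  qed
qed

lemma tail_projection:
  "linear_map R (free_mod R n) (free_mod R n) (\<lambda>v. \<lambda>i\<in>{..<n}. if i < j then \<zero> else v i)" (is "linear_map _ _ _ ?f")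
proof (intro linear_map.intro linear_map_axioms.intro free_module)
  have c: "?f v \<in> carrier (free_mod R n)" if "v \<in> carrier (free_mod R n)" for v
    by (rule free_restrict) (use that in \<open>simp add: free_nth\<close>)
  have "?f (u \<oplus>\<^bsub>free_mod R n\<^esub> v) = ?f u \<oplus>\<^bsub>free_mod R n\<^esub> ?f v"
    if "u \<in> carrier (free_mod R n)" "v \<in> carrier (free_mod R n)" for u v
    using that c by (intro free_eqI[of _ R n]) (simp_all add: free_add_nth)
  moreover have "?f (a \<odot>\<^bsub>free_mod R n\<^esub> v) = a \<odot>\<^bsub>free_mod R n\<^esub> ?f v"
    if "a \<in> carrier R" "v \<in> carrier (free_mod R n)" for a v
    using that c by (intro free_eqI[of _ R n]) (simp_all add: free_smult_nth)
  ultimately show "?f \<in> mod_hom R (free_mod R n) (free_mod R n)"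
    using c unfolding mod_hom_def hom_def by simp
qed

lemma good_step:
  assumes j: "j \<le> n" and good: "\<And>i. i < j \<Longrightarrow> mv n n U ` M i = S i"
  shows "mv n n U ` M j = S j"
proof (rule ccontr)
  assume bad: "mv n n U ` M j \<noteq> S j"
  have "j \<noteq> 0"
  proof
    assume "j = 0"
    have "M 0 = {\<zero>\<^bsub>free_mod R n\<^esub>}" "S 0 = {\<zero>\<^bsub>free_mod R n\<^esub>}"
      by (auto simp: box_def free_zero_nth intro!: free_eqI[of _ R n])
    then show False using bad \<open>j = 0\<close> linear_map.zero[OF mv_linear[OF U_over]] by simp
  qed
  then obtain j' where j': "j = Suc j'" using not0_implies_Suc by blast
  have "lenF n (mv n n U ` M j) < lenF n (S j)"
    using module.len_strict_mono[OF free_module flen_free[OF S_sub] mv_image_sub[OF U_over M_sub]]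
      image_M_subset bad by blast
  then have "lenF n (mv n n U ` M j) < j * socdim"
    using len_box_step[OF m2_sub zero_sub j] len_m2 by simp
  moreover have "lenF n (M j) = j * (embdim + socdim)"
    using len_box_step[OF m_sub zero_sub j] len_m by simp
  ultimately have lenK: "j * embdim + 1 \<le> lenF n (M j \<inter> kr n n U)"
    using mv_len[OF U_over M_sub, of j] by (simp add: algebra_simps)
  \<comment> \<open>A vector of \<open>mF n\<close> in this box has coordinates in \<open>m\<close>
    before \<open>j\<close> and in \<open>m2\<close> from \<open>j\<close> on. The box
    \<open>?Q\<close> below has the two ideals exchanged, which makes such vectors orthogonal to
    it.\<close>
  let ?B = "box n (step j (carrier R) m2)"
  have B: "submodule ?B R (free_mod R n)" by (rule box_step_sub[OF R_sub m2_sub])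
  have krs: "submodule (kr n n U) R (free_mod R n)" by (rule kr_submodule[OF U_over])
  define C where "C = kr n n U \<inter> ?B"
  have C: "submodule C R (free_mod R n)" unfolding C_def by (rule F.submodule_inter[OF krs B])
  \<comment> \<open>Projection to the coordinates from \<open>j\<close> on: the kernel part contains
    the overlong piece of \<open>lenK\<close>, and the image contains all vectors with tail in
    \<open>m2\<close>, since \<open>m2F n\<close> lies in the kernel of \<open>U\<close>.\<close>
  have lenC: "j * embdim + 1 + (n - j) * socdim \<le> lenF n C"
  proof -
    let ?\<pi> = "\<lambda>v. \<lambda>i\<in>{..<n}. if i < j then \<zero> else v i"
    interpret \<pi>: linear_map R "free_mod R n" "free_mod R n" ?\<pi> by (rule tail_projection)
    let ?T = "box n (step j {\<zero>} m2)"
    have "?T \<subseteq> ?\<pi> ` C"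
    proof
      fix v assume v: "v \<in> ?T"
      have vc: "v \<in> carrier (free_mod R n)" and vi: "\<And>i. i < n \<Longrightarrow> v i \<in> step j {\<zero>} m2 i"
        using v unfolding box_def by blast+
      have "?T \<subseteq> m2F n" unfolding m2F_def by (rule box_mono) (auto simp: m2.zero_closed)
      then have "v \<in> kr n n U" using v m2F_subset_kr[OF U] by blast
      moreover have "?T \<subseteq> ?B" by (rule box_mono) auto
      then have "v \<in> ?B" using v by blast
      moreover have "?\<pi> v = v"
      proof (rule free_eqI[where R = R])
        fix i assume "i < n"
        then show "?\<pi> v i = v i" using vi[of i] by (auto split: if_splits)
      qed (use vc \<pi>.closed[OF vc] in simp_all)
      ultimately show "v \<in> ?\<pi> ` C" using image_eqI[of v ?\<pi> v C] unfolding C_def by simp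
    qed
    then have "(n - j) * socdim \<le> lenF n (?\<pi> ` C)"
      using lenF_mono[OF \<pi>.image_submodule[OF C] box_step_sub[OF zero_sub m2_sub, of n j]]
        len_box_step[OF zero_sub m2_sub j] len_m2 by simp
    moreover have "M j \<inter> kr n n U \<subseteq> C \<inter> \<pi>.ker"
    proof
      fix v assume v: "v \<in> M j \<inter> kr n n U"
      have vc: "v \<in> carrier (free_mod R n)" and vi: "\<And>i. i < n \<Longrightarrow> v i \<in> step j m {\<zero>} i"
        using v unfolding box_def by blast+
      have "M j \<subseteq> ?B" by (rule box_mono) (auto simp: m2.zero_closed)
      then have "v \<in> ?B" using v by blast
      moreover have "?\<pi> v = \<zero>\<^bsub>free_mod R n\<^esub>"
      proof (rule free_eqI[where R = R])
        fix i assume "i < n"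
        then show "?\<pi> v i = \<zero>\<^bsub>free_mod R n\<^esub> i" using vi[of i] by (auto simp: free_zero_nth split: if_splits)
      qed (use vc \<pi>.closed[OF vc] in simp_all)
      ultimately show "v \<in> C \<inter> \<pi>.ker" using v vc by (auto simp: C_def \<pi>.ker_def)
    qed
    then have "lenF n (M j \<inter> kr n n U) \<le> lenF n (C \<inter> \<pi>.ker)"
      by (intro lenF_mono F.submodule_inter C \<pi>.ker_submodule M_sub krs)
    ultimately show ?thesis using \<pi>.flen_rank_nullity(2)[OF C flen_free[OF C]] lenK by simp
  qed
  \<comment> \<open>\<open>W\<close> maps \<open>G\<close> onto \<open>C\<close>, because the kernel
    of \<open>U\<close> is the image of \<open>W\<close>. The length of \<open>G\<close> is thus
    that of \<open>C\<close> plus that of the kernel of \<open>W\<close>.\<close>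
  define G where "G = {v \<in> carrier (free_mod R n). mv n n W v \<in> ?B}"
  have G: "submodule G R (free_mod R n)"
    unfolding G_def by (rule linear_map.preimage_submodule[OF mv_linear[OF W_over] B])
  have "mF n \<subseteq> G"
  proof
    fix v assume v: "v \<in> mF n"
    then have "mv n n W v \<in> m2F n" using mv_in_m2F[OF W] by blast
    then show "v \<in> G" using v mF_closed m2.Icarr by (auto simp: G_def m2F_def box_def)
  qed
  have "kr n n W \<subseteq> G" using F.submodule_zero[OF B] by (auto simp: G_def kr_def)
  then have "G \<inter> kr n n W = kr n n W" by blast
  moreover have "mv n n W ` G = C" unfolding C_def kr_U by (auto simp: G_def im_def)
  ultimately have "lenF n G = lenF n (kr n n W) + lenF n C" using mv_len[OF W_over G] by simp
  then have lenG: "lenF n (carrier (free_mod R n)) + lenF n C = lenF n G + n * embdim"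
    using mv_len_full[OF W_over] len_free[of n] kr_U len_kr by simp
  define t where "t = n - j"
  have nt: "n = j + t" using j by (simp add: t_def)
  \<comment> \<open>The colength of \<open>G\<close> is n e - len C \<le> t (e - r) - 1 = t - 1,
    using e = 1 + r. In particular t is positive, and t' = t - 1.\<close>
  have "lenF n (carrier (free_mod R n)) + 1 \<le> lenF n G + t"
    using lenG lenC embdim nt by (simp add: algebra_simps)
  moreover have "lenF n G \<le> lenF n (carrier (free_mod R n))"
    using lenF_mono[OF free_sub G F.submoduleE(1)[OF G]] .
  ultimately obtain t' where t': "t = Suc t'" "lenF n (carrier (free_mod R n)) \<le> lenF n G + t'"
    by (cases t) auto
  have perp: "lenF n {u \<in> m2F n. \<forall>v\<in>G. dot n v u = \<zero>} \<le> t' * socdim"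
    by (rule len_perp[OF G \<open>mF n \<subseteq> G\<close> t'(2)])
  let ?Q = "box n (step j m2 m)"
  have Q: "submodule ?Q R (free_mod R n)" by (rule box_step_sub[OF m2_sub m_sub])
  have trW: "mat_m n n (tr W)" "mat_over R n n (tr W)" "mat_over R n n (tr U)"
    using W W_over U_over by simp_all
  \<comment> \<open>By adjointness, pairing v in \<open>G\<close> with the transpose of
    \<open>W\<close> applied to u is pairing W v with u, and each term of that sum lies in m^3 =
    0.\<close>
  have "mv n n (tr W) ` ?Q \<subseteq> {u \<in> m2F n. \<forall>v\<in>G. dot n v u = \<zero>}"
  proof
    fix z assume "z \<in> mv n n (tr W) ` ?Q"
    then obtain u where u: "u \<in> ?Q" "z = mv n n (tr W) u" by blast
    have uc: "u \<in> carrier (free_mod R n)" and ui: "\<And>i. i < n \<Longrightarrow> u i \<in> step j m2 m i"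
      using u unfolding box_def by blast+
    have "?Q \<subseteq> mF n" unfolding mF_def by (rule box_mono) (use m2_le in auto)
    then have "u \<in> mF n" using u by blast
    then have "z \<in> m2F n" using mv_in_m2F[OF trW(1)] u by blast
    moreover have "dot n v z = \<zero>" if v: "v \<in> G" for v
    proof -
      have vc: "v \<in> carrier (free_mod R n)" and vB: "mv n n W v \<in> ?B" using v by (auto simp: G_def)
      have vm: "mv n n W v \<in> mF n" using mv_in_mF[OF W vc] .
      have "dot n v z = dot n (mv n n W v) u"
        using mv_adjoint[OF trW(2) vc uc] u by simp
      also have "\<dots> = \<zero>"
      proof (rule dot_eq_zero)
        fix i assume i: "i < n"
        have "mv n n W v i \<in> m" using vm i by (simp add: mF_def box_def)
        moreover have "mv n n W v i \<in> step j (carrier R) m2 i" using vB i unfolding box_def by blast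
        ultimately show "mv n n W v i \<otimes> u i = \<zero>"
          using ui[OF i] mm2 m2m by (auto split: if_splits)
      qed
      finally show ?thesis .
    qed
    ultimately show "z \<in> {u \<in> m2F n. \<forall>v\<in>G. dot n v u = \<zero>}" by blast
  qed
  moreover have "submodule {u \<in> m2F n. \<forall>v\<in>G. dot n v u = \<zero>} R (free_mod R n)"
    by (rule perp_submodule[OF F.submoduleE(1)[OF G]])
  ultimately have "lenF n (mv n n (tr W) ` ?Q) \<le> t' * socdim"
    using lenF_mono[OF _ mv_image_sub[OF trW(2) Q]] perp le_trans by blast
  moreover have "lenF n ?Q = j * socdim + t * (embdim + socdim)"
    using len_box_step[OF m2_sub m_sub j] len_m len_m2 by (simp add: t_def)
  ultimately have len\<Phi>: "j * socdim + t * (embdim + socdim) \<le> lenF n (?Q \<inter> kr n n (tr W)) + t' * socdim"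
    using mv_len[OF trW(2) Q] by linarith
  \<comment> \<open>The transpose of \<open>U\<close> maps this preimage onto \<open>?Q\<close>
    \<inter> ker W^T, so its length is bounded below by exactness, while triangularity bounds it
    above.\<close>
  define \<Omega> where "\<Omega> = {w \<in> carrier (free_mod R n). mv n n (tr U) w \<in> ?Q}"
  have \<Omega>: "submodule \<Omega> R (free_mod R n)"
    unfolding \<Omega>_def by (rule linear_map.preimage_submodule[OF mv_linear[OF trW(3)] Q])
  have "kr n n (tr U) \<subseteq> \<Omega>" using F.submodule_zero[OF Q] by (auto simp: \<Omega>_def kr_def)
  then have "\<Omega> \<inter> kr n n (tr U) = kr n n (tr U)" by blast
  moreover have "mv n n (tr U) ` \<Omega> = ?Q \<inter> kr n n (tr W)" unfolding kr_tr_W by (auto simp: \<Omega>_def im_def)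
  ultimately have len\<Omega>: "lenF n \<Omega> = n * embdim + lenF n (?Q \<inter> kr n n (tr W))"
    using mv_len[OF trW(3) \<Omega>] len_kr_tr by simp
  have "\<Omega> \<subseteq> box n (step j' m (carrier R))"
  proof
    fix w assume w: "w \<in> \<Omega>"
    then have wc: "w \<in> carrier (free_mod R n)" by (simp add: \<Omega>_def)
    have "mv n n (tr U) w i \<in> m2" if "i \<le> j'" for i
    proof -
      have "mv n n (tr U) w \<in> ?Q" using w by (simp add: \<Omega>_def)
      moreover have "i < n" using that j j' by simp
      ultimately have "mv n n (tr U) w i \<in> step j m2 m i" unfolding box_def by blast
      then show ?thesis using that j' by simp
    qed
    then have "w i \<in> m" if "i < j'" for i
      using tr_preimage_bound[of j' w i] good j j' wc that by auto
    then show "w \<in> box n (step j' m (carrier R))" using wc by (auto simp: box_def free_nth)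
  qed
  then have "lenF n \<Omega> \<le> j' * (embdim + socdim) + (n - j') * (1 + embdim + socdim)"
    using lenF_mono[OF box_step_sub[OF m_sub R_sub, of n j'] \<Omega>] len_box_step[OF m_sub R_sub, of j' n] j j' len_m len_R
    by simp
  moreover have "n - j' = Suc t" using nt j' by simp
  moreover have "n = Suc (j' + t)" using nt j' by simp
  \<comment> \<open>After removing the common term j' (e + r), the lower bound is (2t + 1) e + 2r
    and the upper bound (t + 1)(1 + e + r) = (2t + 2) e. Hence 2r \<le> e = 1 + r, against r \<ge>
    2.\<close>
  ultimately show False
    using len\<Omega> len\<Phi> j' t'(1) embdim socdim by (simp add: algebra_simps)
qed

lemma image_M: "j \<le> n \<Longrightarrow> mv n n U ` M j = S j"
proof (induction j rule: less_induct)
  case (less j)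
  show ?case by (rule good_step[OF less.prems]) (use less in simp_all)
qed

lemma diag_mult: "i < n \<Longrightarrow> y \<in> m2 \<Longrightarrow> \<exists>x\<in>m. U i i \<otimes> x = y"
  using diag_nonsquare[of i y] image_M[of "Suc i"] by simp

lemma len_M_kr:
  assumes "j \<le> n"
  shows "lenF n (M j \<inter> kr n n U) = j * embdim"
proof -
  have "lenF n (M j) = j * (embdim + socdim)" using len_box_step[OF m_sub zero_sub assms] len_m by simp
  moreover have "lenF n (mv n n U ` M j) = j * socdim"
    unfolding image_M[OF assms] using len_box_step[OF m2_sub zero_sub assms] len_m2 by simp
  ultimately show ?thesis using mv_len[OF U_over M_sub, of j] by (simp add: algebra_simps)
qed

end

lemma (in module) submodule_sum:
  assumes A: "submodule A R M" and B: "submodule B R M"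
  shows "submodule {y \<oplus>\<^bsub>M\<^esub> s | y s. y \<in> A \<and> s \<in> B} R M"
    and "A \<subseteq> {y \<oplus>\<^bsub>M\<^esub> s | y s. y \<in> A \<and> s \<in> B}" "B \<subseteq> {y \<oplus>\<^bsub>M\<^esub> s | y s. y \<in> A \<and> s \<in> B}"
proof -
  have c: "A \<subseteq> carrier M" "B \<subseteq> carrier M" using submoduleE(1)[OF A] submoduleE(1)[OF B] by auto
  have z: "\<zero>\<^bsub>M\<^esub> \<in> A" "\<zero>\<^bsub>M\<^esub> \<in> B" using submodule_zero A B by auto
  let ?S = "{y \<oplus>\<^bsub>M\<^esub> s | y s. y \<in> A \<and> s \<in> B}"
  show AS: "A \<subseteq> ?S"
  proof
    fix y assume "y \<in> A"
    moreover have "y = y \<oplus>\<^bsub>M\<^esub> \<zero>\<^bsub>M\<^esub>" using calculation c by (simp add: subsetD)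
    ultimately show "y \<in> ?S" using z by blast
  qed
  show "B \<subseteq> ?S"
  proof
    fix y assume "y \<in> B"
    moreover have "y = \<zero>\<^bsub>M\<^esub> \<oplus>\<^bsub>M\<^esub> y" using calculation c by (simp add: subsetD)
    ultimately show "y \<in> ?S" using z by blast
  qed
  show "submodule ?S R M"
  proof (rule submoduleI')
    show "?S \<subseteq> carrier M" using c by (auto simp: subset_iff)
    show "\<zero>\<^bsub>M\<^esub> \<in> ?S" using AS z by blast
    fix x x' assume "x \<in> ?S" "x' \<in> ?S"
    then obtain y s y' s' where h: "x = y \<oplus>\<^bsub>M\<^esub> s" "x' = y' \<oplus>\<^bsub>M\<^esub> s'" "y \<in> A" "y' \<in> A" "s \<in> B" "s' \<in> B" by blast
    have hc: "y \<in> carrier M" "y' \<in> carrier M" "s \<in> carrier M" "s' \<in> carrier M" using h c by auto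
    have "x \<oplus>\<^bsub>M\<^esub> x' = (y \<oplus>\<^bsub>M\<^esub> y') \<oplus>\<^bsub>M\<^esub> (s \<oplus>\<^bsub>M\<^esub> s')" unfolding h(1,2) using hc by (simp add: M.a_ac)
    then show "x \<oplus>\<^bsub>M\<^esub> x' \<in> ?S" using submoduleE(5)[OF A h(3,4)] submoduleE(5)[OF B h(5,6)] by blast
  next
    fix a x assume a: "a \<in> carrier R" and "x \<in> ?S"
    then obtain y s where h: "x = y \<oplus>\<^bsub>M\<^esub> s" "y \<in> A" "s \<in> B" by blast
    have hc: "y \<in> carrier M" "s \<in> carrier M" using h c by auto
    have "a \<odot>\<^bsub>M\<^esub> x = a \<odot>\<^bsub>M\<^esub> y \<oplus>\<^bsub>M\<^esub> a \<odot>\<^bsub>M\<^esub> s" unfolding h(1) using hc a by (simp add: smult_r_distr)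
    then show "a \<odot>\<^bsub>M\<^esub> x \<in> ?S" using submoduleE(4)[OF A a h(2)] submoduleE(4)[OF B a h(3)] by blast
  qed
qed

section \<open>A triangular matrix generating the kernel\<close>

context triangular_pair
begin

interpretation self: module R "self_mod R" by (rule self_module)
interpretation F: module R "free_mod R n" by (rule free_module)

lemma M_step: "x \<in> M (Suc j) \<Longrightarrow> x j = \<zero> \<Longrightarrow> x \<in> M j"
proof -
  assume x: "x \<in> M (Suc j)" "x j = \<zero>"
  then have xc: "x \<in> carrier (free_mod R n)" and xi: "\<And>i. i < n \<Longrightarrow> x i \<in> step (Suc j) m {\<zero>} i"
    unfolding box_def by blast+
  have "x i \<in> step j m {\<zero>} i" if "i < n" for i
    using xi[OF that] x(2) by (cases "i = j") (auto simp: less_Suc_eq m.zero_closed)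
  then show "x \<in> M j" using xc unfolding box_def by blast
qed

lemma M_mono: "M j \<subseteq> M (Suc j)"
  by (rule box_mono) (auto simp: m.zero_closed)

text \<open>Coordinate \<open>j\<close> maps the kernel of \<open>U\<close> on m E_(j+1) with kernel
  the same piece for E_j, so the ideal of last coordinates has length (j + 1) e - j e. It contains
  \<open>m2\<close> because \<open>m2F n\<close> is killed by \<open>U\<close>.\<close>

lemma corner_ideal:
  assumes j: "j < n"
  shows "len R (self_mod R) ((\<lambda>v. v j) ` (M (Suc j) \<inter> kr n n U)) = embdim"
    and "m2 \<subseteq> (\<lambda>v. v j) ` (M (Suc j) \<inter> kr n n U)"
proof -
  let ?K = "\<lambda>j. M j \<inter> kr n n U"
  have K: "submodule (?K j) R (free_mod R n)" for j
    by (rule F.submodule_inter[OF M_sub kr_submodule[OF U_over]])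
  interpret c: linear_map R "free_mod R n" "self_mod R" "\<lambda>v. v j" by (rule nth_linear[OF j])
  have "?K (Suc j) \<inter> c.ker = ?K j"
  proof
    show "?K (Suc j) \<inter> c.ker \<subseteq> ?K j" using M_step by (auto simp: c.ker_def)
    show "?K j \<subseteq> ?K (Suc j) \<inter> c.ker"
    proof
      fix x assume x: "x \<in> ?K j"
      then have "x j \<in> step j m {\<zero>} j" using j unfolding box_def by blast
      then show "x \<in> ?K (Suc j) \<inter> c.ker" using x M_mono F.submoduleE(1)[OF K] by (auto simp: c.ker_def)
    qed
  qed
  then show "len R (self_mod R) ((\<lambda>v. v j) ` ?K (Suc j)) = embdim"
    using c.flen_rank_nullity(2)[OF K[of "Suc j"] flen_free[OF K]] len_M_kr[of j] len_M_kr[of "Suc j"] j by simp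
  show "m2 \<subseteq> (\<lambda>v. v j) ` ?K (Suc j)"
  proof
    fix y assume y: "y \<in> m2"
    define w where "w = (\<lambda>k\<in>{..<n}. if k = j then y else \<zero>)"
    have wc: "w \<in> carrier (free_mod R n)" using y m2.Icarr by (auto simp: w_def free_mod_carrier)
    have "w \<in> m2F n" using y wc m2.zero_closed by (auto simp: w_def m2F_def box_def)
    then have "w \<in> kr n n U" using m2F_subset_kr[OF U] by blast
    moreover have "w \<in> M (Suc j)" using wc y m2_le m.zero_closed by (auto simp: w_def box_def)
    moreover have "w j = y" using j by (simp add: w_def)
    ultimately show "y \<in> (\<lambda>v. v j) ` ?K (Suc j)" by blast
  qed
qed

text \<open>Each corner ideal has length e = 1 + r and contains \<open>m2\<close>, so it is
  generated by \<open>m2\<close> and any one of its elements outside \<open>m2\<close>. A kernel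
  vector realising such an element becomes column \<open>j\<close>. Eliminating last coordinates
  shows that these columns generate the kernel modulo \<open>m2F n\<close>, and the assumption on
  \<open>W\<close> absorbs the remainder.\<close>

lemma triangular_syzygy:
  assumes Wm: "mv n n W ` mF n = m2F n"
  shows "\<exists>V. mat_m n n V \<and> (\<forall>i<n. \<forall>j<i. V i j = \<zero>) \<and> im n n V = kr n n U"
proof -
  let ?K = "\<lambda>j. M j \<inter> kr n n U"
  let ?I = "\<lambda>j. (\<lambda>v. v j) ` ?K (Suc j)"
  have K: "submodule (?K j) R (free_mod R n)" for j
    by (rule F.submodule_inter[OF M_sub kr_submodule[OF U_over]])
  have Is: "submodule (?I j) R (self_mod R)" if "j < n" for j
    by (rule linear_map.image_submodule[OF nth_linear[OF that] K])
  have "\<exists>v. v \<in> ?K (Suc j) \<and> v j \<notin> m2" if j: "j < n" for j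
  proof (rule ccontr)
    assume "\<not> ?thesis"
    then have "?I j \<subseteq> m2" by blast
    then have "embdim \<le> socdim"
      using self.len_mono[OF flen_self[OF m2_sub] Is[OF j]] corner_ideal(1)[OF j] len_m2 by simp
    then show False using embdim by simp
  qed
  then obtain vv where vv: "\<And>j. j < n \<Longrightarrow> vv j \<in> ?K (Suc j)" "\<And>j. j < n \<Longrightarrow> vv j j \<notin> m2" by metis
  have vvc: "vv j \<in> carrier (free_mod R n)" if "j < n" for j using vv(1)[OF that] by (simp add: box_def)
  have vvM: "vv j i \<in> step (Suc j) m {\<zero>} i" if "j < n" "i < n" for i j
    using vv(1)[OF that(1)] that(2) unfolding box_def by blast
  define V where "V = (\<lambda>i j. vv j i)"
  have V: "mat_over R n n V" and Vcol: "\<And>j. j < n \<Longrightarrow> mat_col n V j = vv j"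
    unfolding V_def using mat_of_columns[of n vv n] vvc by auto
  have Vm: "mat_m n n V" unfolding mat_m_def V_def
  proof (intro allI impI)
    fix i j assume "i < n" "j < n"
    then show "vv j i \<in> m" using vvM[of j i] by (auto split: if_splits simp: m.zero_closed)
  qed
  have Vt: "\<forall>i<n. \<forall>j<i. V i j = \<zero>"
  proof (intro allI impI)
    fix i j assume "i < n" "j < i"
    then show "V i j = \<zero>" using vvM[of j i] by (simp add: V_def)
  qed
  have Vkr: "im n n V \<subseteq> kr n n U"
    by (rule im_least[OF V kr_submodule[OF U_over]]) (use vv Vcol in auto)
  let ?B = "{y \<oplus>\<^bsub>free_mod R n\<^esub> s | y s. y \<in> im n n V \<and> s \<in> m2F n}"
  note B = F.submodule_sum[OF im_submodule[OF V] m2F_sub]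
  have KB: "j \<le> n \<Longrightarrow> ?K j \<subseteq> ?B" for j
  proof (induction j)
    case 0
    have "M 0 \<subseteq> {\<zero>\<^bsub>free_mod R n\<^esub>}"
      by (auto simp: box_def free_zero_nth intro!: free_eqI[of _ R n])
    then show ?case using F.submodule_zero[OF B(1)] by blast
  next
    case (Suc j)
    then have j: "j < n" by simp
    have bc: "vv j j \<in> carrier (self_mod R)" using vvc j by auto
    have mb: "r \<odot>\<^bsub>self_mod R\<^esub> vv j j \<in> m2" if "r \<in> carrier R - Units R" for r
      using mm[OF nonunit[OF that]] vvM[OF j j] by simp
    have "add_cyclic R (self_mod R) m2 (vv j j) \<subseteq> ?I j"
      using corner_ideal(2)[OF j] vv(1)[OF j] by (intro self.add_cyclic_least[OF Is[OF j]]) auto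
    moreover have "len R (self_mod R) (add_cyclic R (self_mod R) m2 (vv j j)) = embdim"
      using self.flen_add_cyclic(3)[OF flen_self[OF m2_sub] bc mb vv(2)[OF j]] len_m2 embdim by simp
    ultimately have Ij: "?I j = add_cyclic R (self_mod R) m2 (vv j j)"
      using self.len_eq_imp_eq[OF flen_self[OF Is[OF j]] self.add_cyclic_submodule[OF m2_sub bc]]
        corner_ideal(1)[OF j] by simp
    show ?case
    proof
      fix h assume h: "h \<in> ?K (Suc j)"
      then have hc: "h \<in> carrier (free_mod R n)" by (simp add: box_def)
      have "h j \<in> ?I j" using h by blast
      then obtain s0 c where sc: "h j = s0 \<oplus> c \<otimes> vv j j" "s0 \<in> m2" "c \<in> carrier R"
        unfolding Ij by (auto simp: add_cyclic_def)
      define w where "w = (\<lambda>k\<in>{..<n}. if k = j then s0 else \<zero>)"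
      have wc: "w \<in> carrier (free_mod R n)" using sc m2.Icarr by (auto simp: w_def free_mod_carrier)
      have wm2: "w \<in> m2F n" using sc wc m2.zero_closed by (auto simp: w_def m2F_def box_def)
      have wK: "w \<in> ?K (Suc j)"
        using wm2 m2F_subset_kr[OF U] wc sc m2_le m.zero_closed by (auto simp: w_def box_def)
      define z where "z = w \<oplus>\<^bsub>free_mod R n\<^esub> c \<odot>\<^bsub>free_mod R n\<^esub> vv j"
      have cK: "c \<odot>\<^bsub>free_mod R n\<^esub> vv j \<in> ?K (Suc j)" using F.submoduleE(4)[OF K sc(3) vv(1)[OF j]] .
      have zK: "z \<in> ?K (Suc j)" unfolding z_def by (rule F.submoduleE(5)[OF K wK cK])
      have zc: "z \<in> carrier (free_mod R n)" unfolding z_def using wc vvc[OF j] sc by simp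
      have zj: "z j = h j" unfolding z_def sc(1) using j by (simp add: free_add_nth free_smult_nth w_def)
      have "h \<ominus>\<^bsub>free_mod R n\<^esub> z \<in> ?K (Suc j)" by (rule F.submodule_minus[OF K h zK])
      moreover have "(h \<ominus>\<^bsub>free_mod R n\<^esub> z) j = \<zero>"
        using free_minus_nth[OF hc zc j] zj hc j by (simp add: a_minus_def r_neg free_nth)
      ultimately have "h \<ominus>\<^bsub>free_mod R n\<^esub> z \<in> ?K j" using M_step by blast
      then have hz: "h \<ominus>\<^bsub>free_mod R n\<^esub> z \<in> ?B" using Suc by auto
      have "vv j \<in> im n n V" using col_in_im[OF V j] Vcol[OF j] by simp
      then have "c \<odot>\<^bsub>free_mod R n\<^esub> vv j \<in> ?B" using F.submoduleE(4)[OF B(1) sc(3)] B(2) by blast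
      then have "z \<in> ?B" unfolding z_def using F.submoduleE(5)[OF B(1)] B(3) wm2 by blast
      then have "(h \<ominus>\<^bsub>free_mod R n\<^esub> z) \<oplus>\<^bsub>free_mod R n\<^esub> z \<in> ?B" using F.submoduleE(5)[OF B(1) hz] by blast
      moreover have "(h \<ominus>\<^bsub>free_mod R n\<^esub> z) \<oplus>\<^bsub>free_mod R n\<^esub> z = h"
        using hc zc by (simp add: a_minus_def F.M.a_assoc F.M.l_neg)
      ultimately show "h \<in> ?B" by simp
    qed
  qed
  have "M n = mF n" unfolding mF_def box_def by auto
  then have krB: "kr n n U \<subseteq> ?B" using KB[of n] kr_sub_mF by auto
  \<comment> \<open>Nakayama's lemma by hand: \<open>m2F n\<close> consists of combinations, with
    coefficients in \<open>m\<close>, of columns of \<open>W\<close>. These columns agree with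
    elements of \<open>im n n V\<close> up to \<open>m2F n\<close>, which \<open>m\<close>
    annihilates.\<close>
  have "m2F n \<subseteq> im n n V"
  proof
    fix y assume "y \<in> m2F n"
    then obtain w where w: "w \<in> mF n" "y = mv n n W w" using Wm by blast
    have wc: "w \<in> carrier (free_mod R n)" using w mF_closed by blast
    have wl: "w l \<in> m" if "l < n" for l using w that by (simp add: mF_def box_def)
    have "w l \<odot>\<^bsub>free_mod R n\<^esub> mat_col n W l \<in> im n n V" if l: "l < n" for l
    proof -
      have "mat_col n W l \<in> ?B" using krB kr_U col_in_im[OF W_over l] by blast
      then obtain y s where ys: "mat_col n W l = y \<oplus>\<^bsub>free_mod R n\<^esub> s" "y \<in> im n n V" "s \<in> m2F n" by blast
      have yc: "y \<in> carrier (free_mod R n)" "s \<in> carrier (free_mod R n)" using ys im_closed[OF V] m2F_closed by auto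
      have "w l \<odot>\<^bsub>free_mod R n\<^esub> s = \<zero>\<^bsub>free_mod R n\<^esub>"
        using ys(3) wl[OF l] yc mm2
        by (intro free_eqI[of _ R n]) (auto simp: free_smult_nth free_zero_nth m2F_def box_def)
      then have "w l \<odot>\<^bsub>free_mod R n\<^esub> mat_col n W l = w l \<odot>\<^bsub>free_mod R n\<^esub> y"
        unfolding ys(1) using yc wl[OF l] by (simp add: F.smult_r_distr)
      then show ?thesis using F.submoduleE(4)[OF im_submodule[OF V] _ ys(2)] wl[OF l] by simp
    qed
    then have "(\<Oplus>\<^bsub>free_mod R n\<^esub>l\<in>{..<n}. w l \<odot>\<^bsub>free_mod R n\<^esub> mat_col n W l) \<in> im n n V"
      by (intro submodule_finsum[OF free_module im_submodule[OF V]]) auto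
    then show "y \<in> im n n V" using mv_eq_finsum[OF W_over wc] w(2) by simp
  qed
  then have "?B \<subseteq> im n n V" using F.submoduleE(5)[OF im_submodule[OF V]] by blast
  then show ?thesis using krB Vkr Vm Vt by blast
qed

end

section \<open>Triangular complexes\<close>

context short_local
begin

interpretation self: module R "self_mod R" by (rule self_module)

text \<open>If \<open>embdim = socdim + 1\<close>, a length count turns this into \<open>(0 : a) = (b)\<close> and \<open>(0 : b) = (a)\<close>.\<close>

definition dual_pair :: "'a \<Rightarrow> 'a \<Rightarrow> bool" where
  "dual_pair a b \<longleftrightarrow> a \<in> m \<and> b \<in> m \<and> a \<otimes> b = \<zero> \<and>
     (\<forall>y\<in>m2. \<exists>x\<in>m. a \<otimes> x = y) \<and> (\<forall>y\<in>m2. \<exists>x\<in>m. b \<otimes> x = y)"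

lemma dual_pair_sym: "dual_pair a b \<Longrightarrow> dual_pair b a"
  unfolding dual_pair_def using m_comm[of a b] by auto

text \<open>The ideals (a) and (b) contain \<open>m2\<close> and have generators outside it, so both
  have length at least r + 1. Then the annihilator of a has length at most (1 + e + r) - (r + 1) = r
  + 1, and the ideal (b) inside it fills it.\<close>

lemma dual_pair_ann:
  assumes ab: "dual_pair a b" and e: "embdim = 1 + socdim" and x: "x \<in> carrier R" "a \<otimes> x = \<zero>"
  shows "\<exists>c\<in>carrier R. x = b \<otimes> c"
proof -
  have lin: "linear_map R (self_mod R) (self_mod R) (\<lambda>x. a \<otimes> x)" if "a \<in> m" for a
    using that by (intro linear_map.intro linear_map_axioms.intro self_module)
      (auto simp: mod_hom_def hom_def r_distr m_lcomm)
  have img: "socdim + 1 \<le> len R (self_mod R) ((\<lambda>x. a \<otimes> x) ` carrier R)"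
    if am: "a \<in> m" and "\<forall>y\<in>m2. \<exists>x\<in>m. a \<otimes> x = y" for a
  proof -
    have "a \<notin> m2"
    proof
      assume "a \<in> m2"
      obtain y where "y \<in> m2" "y \<noteq> \<zero>" using square m2.zero_closed by blast
      then show False using that(2) m2m[OF \<open>a \<in> m2\<close>] by metis
    qed
    have s: "submodule ((\<lambda>x. a \<otimes> x) ` carrier R) R (self_mod R)"
      using linear_map.image_submodule[OF lin[OF am] R_sub] .
    have "m2 \<subseteq> (\<lambda>x. a \<otimes> x) ` carrier R" using that(2) m.Icarr by (metis image_eqI subsetI)
    moreover have "a \<in> (\<lambda>x. a \<otimes> x) ` carrier R" using am by (intro image_eqI[of _ _ \<one>]) auto
    ultimately have "add_cyclic R (self_mod R) m2 a \<subseteq> (\<lambda>x. a \<otimes> x) ` carrier R"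
      using self.add_cyclic_least[OF s] by blast
    moreover have "len R (self_mod R) (add_cyclic R (self_mod R) m2 a) = socdim + 1"
      using self.flen_add_cyclic(3)[OF flen_self[OF m2_sub] _ _ \<open>a \<notin> m2\<close>] am mm nonunit len_m2 by simp
    ultimately show ?thesis
      using self.len_mono[OF flen_self[OF s] self.add_cyclic_submodule[OF m2_sub, of a]] am by simp
  qed
  have abm: "a \<in> m" "b \<in> m" "a \<otimes> b = \<zero>" using ab by (auto simp: dual_pair_def)
  interpret a: linear_map R "self_mod R" "self_mod R" "\<lambda>x. a \<otimes> x" by (rule lin[OF abm(1)])
  have "a.ker = carrier R \<inter> a.ker" by (auto simp: a.ker_def)
  then have "len R (self_mod R) a.ker + len R (self_mod R) ((\<lambda>x. a \<otimes> x) ` carrier R) = 1 + embdim + socdim"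
    using a.flen_rank_nullity(2)[OF R_sub flen_R] len_R by simp
  then have k: "len R (self_mod R) a.ker \<le> socdim + 1"
    using img[of a] ab e by (simp add: dual_pair_def)
  have sb: "submodule ((\<lambda>x. b \<otimes> x) ` carrier R) R (self_mod R)"
    using linear_map.image_submodule[OF lin[OF abm(2)] R_sub] .
  have "(\<lambda>x. b \<otimes> x) ` carrier R \<subseteq> a.ker"
    using abm m_assoc[of a b, symmetric] by (auto simp: a.ker_def)
  then have "(\<lambda>x. b \<otimes> x) ` carrier R = a.ker"
    using self.len_eq_imp_eq[OF flen_self[OF a.ker_submodule] sb] k img[of b] ab by (simp add: dual_pair_def)
  moreover have "x \<in> a.ker" using x by (simp add: a.ker_def)
  ultimately show ?thesis by blast
qed

definition triangular_diag :: "nat \<Rightarrow> (nat \<Rightarrow> 'a) \<Rightarrow> (nat \<Rightarrow> nat \<Rightarrow> 'a) \<Rightarrow> bool" where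
  "triangular_diag n a A \<longleftrightarrow> mat_m n n A \<and> (\<forall>i<n. \<forall>j<i. A i j = \<zero>) \<and> (\<forall>i<n. A i i = a i)"

lemma triangular_diag_over: "triangular_diag n a A \<Longrightarrow> mat_over R n n A"
  using mat_m_over by (simp add: triangular_diag_def)

lemma triangular_row:
  assumes A: "triangular_diag n a A" and i: "i < n" and v: "v \<in> carrier (free_mod R n)"
    and z: "\<And>k. i < k \<Longrightarrow> k < n \<Longrightarrow> v k = \<zero>"
  shows "dot n (A i) v = a i \<otimes> v i"
proof -
  have Ac: "A i k \<in> carrier R" if "k < n" for k using A i that by (auto simp: triangular_diag_def mat_m_def)
  have "A i k \<otimes> v k = \<zero>" if "k < n" "k \<noteq> i" for k
  proof (cases "k < i")
    case True
    then show ?thesis using A i v that by (simp add: triangular_diag_def free_nth)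
  next
    case False
    then show ?thesis using z[of k] that Ac by simp
  qed
  then have "dot n (A i) v = A i i \<otimes> v i" using v i Ac by (intro dot_one_term) auto
  then show ?thesis using A i by (simp add: triangular_diag_def)
qed

text \<open>Back substitution. The entry \<open>b j\<close> in position \<open>j\<close> satisfies
  row \<open>j\<close>, and \<open>d\<close> counts the rows above it already solved. In the next
  row the defect lies in \<open>m2\<close>, so a suitable coordinate in \<open>m\<close> cancels it
  through the diagonal entry; triangularity leaves the rows below unchanged.\<close>

lemma solve_column:
  assumes A: "triangular_diag n a A" and ab: "\<And>i. i < n \<Longrightarrow> dual_pair (a i) (b i)" and j: "j < n" and d: "d \<le> j"
  shows "\<exists>v\<in>mF n. v j = b j \<and> (\<forall>k<n. j < k \<longrightarrow> v k = \<zero>) \<and> (\<forall>k. k < j - d \<longrightarrow> v k = \<zero>) \<and>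
    (\<forall>i<n. j - d \<le> i \<longrightarrow> dot n (A i) v = \<zero>)"
  using d
proof (induction d)
  case 0
  define v where "v = (\<lambda>k\<in>{..<n}. if k = j then b j else \<zero>)"
  have bj: "b j \<in> m" "a j \<otimes> b j = \<zero>" using ab[OF j] by (auto simp: dual_pair_def)
  have vc: "v \<in> carrier (free_mod R n)" using bj by (auto simp: v_def free_mod_carrier)
  have vm: "v \<in> mF n" using vc bj m.zero_closed by (auto simp: v_def mF_def box_def)
  have "dot n (A i) v = \<zero>" if "i < n" "j \<le> i" for i
  proof -
    have "a i \<in> carrier R" using ab[OF that(1)] by (auto simp: dual_pair_def)
    moreover have "dot n (A i) v = a i \<otimes> v i"
      by (rule triangular_row[OF A that(1) vc]) (use that in \<open>simp add: v_def\<close>)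
    moreover have "v i = (if i = j then b j else \<zero>)" using that(1) by (simp add: v_def)
    ultimately show ?thesis using bj by (cases "i = j") simp_all
  qed
  moreover have "v j = b j" "\<And>k. k < n \<Longrightarrow> k \<noteq> j \<Longrightarrow> v k = \<zero>" using j by (simp_all add: v_def)
  ultimately show ?case using vm j by (intro bexI[of _ v]) auto
next
  case (Suc d)
  then obtain v where v: "v \<in> mF n" "v j = b j" "\<And>k. k < n \<Longrightarrow> j < k \<Longrightarrow> v k = \<zero>"
     "\<And>k. k < j - d \<Longrightarrow> v k = \<zero>" "\<And>i. i < n \<Longrightarrow> j - d \<le> i \<Longrightarrow> dot n (A i) v = \<zero>" by auto
  define i where "i = j - Suc d"
  have i: "i < n" "i < j" "j - d = Suc i" using Suc.prems j by (auto simp: i_def)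
  have vc: "v \<in> carrier (free_mod R n)" using v mF_closed by blast
  have vm: "v k \<in> m" if "k < n" for k using v(1) that by (simp add: mF_def box_def)
  have Am: "A k l \<in> m" if "k < n" "l < n" for k l using A that by (simp add: triangular_diag_def mat_m_def)
  have "dot n (A i) v \<in> m2" using Am[OF i(1)] vm mm by (intro dot_in[OF m2_sub]) auto
  then have "\<ominus> dot n (A i) v \<in> m2" by simp
  then obtain x where x: "x \<in> m" "a i \<otimes> x = \<ominus> dot n (A i) v" using ab[OF i(1)] unfolding dual_pair_def by blast
  define u where "u = (\<lambda>k\<in>{..<n}. if k = i then x else \<zero>)"
  have uc: "u \<in> carrier (free_mod R n)" using x by (auto simp: u_def free_mod_carrier)
  define w where "w = v \<oplus>\<^bsub>free_mod R n\<^esub> u"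
  have wc: "w \<in> carrier (free_mod R n)" using vc uc by (simp add: w_def)
  have wk: "w k = v k" if "k < n" "k \<noteq> i" for k
    using that vc by (simp add: w_def free_add_nth u_def free_nth)
  have wi: "w i = x" using i v(4)[of i] x by (simp add: w_def free_add_nth u_def)
  have dw: "dot n (A k) w = dot n (A k) v \<oplus> a k \<otimes> u k" if k: "k < n" "i \<le> k" for k
  proof -
    have Ak: "A k l \<in> carrier R" if "l < n" for l using Am[OF k(1) that] by simp
    have "dot n (A k) w = dot n (A k) (\<lambda>l. v l \<oplus> u l)"
      using Ak vc uc by (intro dot_cong) (auto simp: w_def free_add_nth free_nth)
    also have "\<dots> = dot n (A k) v \<oplus> dot n (A k) u"
      using Ak vc uc by (intro dot_add) auto
    also have "dot n (A k) u = a k \<otimes> u k"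
      by (rule triangular_row[OF A k(1) uc]) (use k in \<open>auto simp: u_def\<close>)
    finally show ?thesis .
  qed
  have dvc: "dot n (A i) v \<in> carrier R" using Am[OF i(1)] vm by (intro dot_closed) auto
  have 1: "w \<in> mF n" unfolding mF_def box_def
  proof (intro CollectI conjI allI impI wc)
    fix k assume "k < n" then show "w k \<in> m" using wk[of k] wi vm x by (cases "k = i") auto
  qed
  have 2: "dot n (A k) w = \<zero>" if k: "k < n" "i \<le> k" for k
  proof (cases "k = i")
    case True
    then show ?thesis using dw[OF k] x(2) dvc k by (simp add: u_def r_neg)
  next
    case False
    have "a k = A k k" using A k by (simp add: triangular_diag_def)
    then have "a k \<in> m" using Am[OF k(1,1)] by simp
    then show ?thesis using dw[OF k] v(5)[of k] False k i by (simp add: u_def)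
  qed
  have 3: "w k = \<zero>" if "k < j - Suc d" for k
  proof -
    have "k < n" "k \<noteq> i" "k < j - d" using that i j by (auto simp: i_def)
    then show ?thesis using wk v(4) by simp
  qed
  show ?case
    using 1 2 3 wk v(2,3) i j by (intro bexI[of _ w]) (auto simp: i_def)
qed

lemma triangular_lift:
  assumes A: "triangular_diag n a A" and ab: "\<And>i. i < n \<Longrightarrow> dual_pair (a i) (b i)"
  shows "\<exists>B. triangular_diag n b B \<and> (\<forall>i<n. \<forall>j<n. mat_mul n A B i j = \<zero>)"
proof -
  let ?Q = "\<lambda>j v. v \<in> mF n \<and> v j = b j \<and> (\<forall>k<n. j < k \<longrightarrow> v k = \<zero>) \<and> (\<forall>i<n. dot n (A i) v = \<zero>)"
  have "\<forall>j. \<exists>v. j < n \<longrightarrow> ?Q j v"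
  proof
    fix j
    show "\<exists>v. j < n \<longrightarrow> ?Q j v"
    proof (cases "j < n")
      case True
      show ?thesis using solve_column[OF A ab True order_refl] by auto
    qed simp
  qed
  from choice[OF this] obtain vv where Q: "\<forall>j. j < n \<longrightarrow> ?Q j (vv j)" by (elim exE)
  have vv: "\<And>j. j < n \<Longrightarrow> vv j \<in> mF n" "\<And>j. j < n \<Longrightarrow> vv j j = b j"
    "\<And>j k. j < n \<Longrightarrow> k < n \<Longrightarrow> j < k \<Longrightarrow> vv j k = \<zero>" "\<And>i j. i < n \<Longrightarrow> j < n \<Longrightarrow> dot n (A i) (vv j) = \<zero>"
    using Q by simp_all
  have "mat_m n n (\<lambda>i j. vv j i)" using vv(1) by (auto simp: mat_m_def mF_def box_def)
  moreover have "mat_mul n A (\<lambda>i j. vv j i) i j = \<zero>" if "i < n" "j < n" for i j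
    using vv(4)[OF that] by (simp add: mat_mul_def)
  moreover have "\<forall>i<n. \<forall>j<i. vv j i = \<zero>" using vv(3) by simp
  ultimately show ?thesis
    using vv(2) by (intro exI[of _ "\<lambda>i j. vv j i"]) (auto simp: triangular_diag_def)
qed

text \<open>Elimination from the last nonzero coordinate: row \<open>j\<close> gives a_j v_j = 0, so
  v_j is a multiple of b_j and the corresponding multiple of column \<open>j\<close> of
  \<open>B\<close> can be subtracted. The relation between \<open>embdim\<close> and
  \<open>socdim\<close> is asked for only when \<open>0 < n\<close>, the case in which it is
  derived.\<close>

lemma triangular_exact:
  assumes A: "triangular_diag n a A" and B: "triangular_diag n b B"
    and ab: "\<And>i. i < n \<Longrightarrow> dual_pair (a i) (b i)" and e: "0 < n \<Longrightarrow> embdim = 1 + socdim"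
    and AB: "\<And>i j. i < n \<Longrightarrow> j < n \<Longrightarrow> mat_mul n A B i j = \<zero>"
  shows "kr n n A = im n n B"
proof
  interpret F: module R "free_mod R n" by (rule free_module)
  have Ao: "mat_over R n n A" and Bo: "mat_over R n n B"
    using triangular_diag_over[OF A] triangular_diag_over[OF B] by simp_all
  show sub: "im n n B \<subseteq> kr n n A" using im_subset_kr_iff[OF Ao Bo] AB by blast
  have "j \<le> n \<Longrightarrow> v \<in> kr n n A \<Longrightarrow> (\<forall>k<n. j \<le> k \<longrightarrow> v k = \<zero>) \<Longrightarrow> v \<in> im n n B" for j v
  proof (induction j arbitrary: v)
    case 0
    then have "v = \<zero>\<^bsub>free_mod R n\<^esub>" by (intro free_eqI[of _ R n]) (auto simp: kr_def free_zero_nth)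
    then show ?case using F.submodule_zero[OF im_submodule[OF Bo]] by simp
  next
    case (Suc j)
    then have j: "j < n" by simp
    have vc: "v \<in> carrier (free_mod R n)" "mv n n A v = \<zero>\<^bsub>free_mod R n\<^esub>" using Suc.prems(2) by (auto simp: kr_def)
    have "dot n (A j) v = \<zero>" using vc(2) j by (metis free_zero_nth mv_nth)
    moreover have "dot n (A j) v = a j \<otimes> v j"
      using Suc.prems(3) by (intro triangular_row[OF A j vc(1)]) auto
    ultimately obtain c where c: "c \<in> carrier R" "v j = b j \<otimes> c"
      using dual_pair_ann[OF ab[OF j] e, of "v j"] vc(1) j by auto
    define z where "z = mat_col n B j"
    have zim: "z \<in> im n n B" unfolding z_def by (rule col_in_im[OF Bo j])
    have zc: "z \<in> carrier (free_mod R n)" unfolding z_def by (rule mat_col_closed[OF Bo j])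
    define w where "w = v \<ominus>\<^bsub>free_mod R n\<^esub> c \<odot>\<^bsub>free_mod R n\<^esub> z"
    have czim: "c \<odot>\<^bsub>free_mod R n\<^esub> z \<in> im n n B" using F.submoduleE(4)[OF im_submodule[OF Bo] c(1) zim] .
    have "w \<in> kr n n A" unfolding w_def
      using F.submodule_minus[OF kr_submodule[OF Ao] Suc.prems(2)] sub czim by blast
    moreover have "w k = \<zero>" if k: "k < n" "j \<le> k" for k
    proof -
      have wk: "w k = v k \<ominus> c \<otimes> z k" unfolding w_def
        using free_minus_nth[OF vc(1) _ k(1), of "c \<odot>\<^bsub>free_mod R n\<^esub> z"] zc c k by (simp add: free_smult_nth)
      show ?thesis
      proof (cases "k = j")
        case True
        have "b j \<in> carrier R" using ab[OF j] by (auto simp: dual_pair_def)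
        moreover have "z j = b j" using B j by (simp add: z_def mat_col_def triangular_diag_def)
        ultimately show ?thesis using wk c True m_comm[of c "b j"] by (simp add: a_minus_def r_neg)
      next
        case False
        then have "z k = \<zero>" "v k = \<zero>"
          using B k Suc.prems(3) by (auto simp: z_def mat_col_def triangular_diag_def)
        then show ?thesis using wk c by (simp add: a_minus_def)
      qed
    qed
    ultimately have "w \<in> im n n B" using Suc.IH[of w] Suc.prems(1) by auto
    then have "w \<oplus>\<^bsub>free_mod R n\<^esub> c \<odot>\<^bsub>free_mod R n\<^esub> z \<in> im n n B"
      using F.submoduleE(5)[OF im_submodule[OF Bo] _ czim] by blast
    moreover have "w \<oplus>\<^bsub>free_mod R n\<^esub> c \<odot>\<^bsub>free_mod R n\<^esub> z = v"
      unfolding w_def using vc zc c by (simp add: a_minus_def F.M.a_assoc F.M.l_neg)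
    ultimately show ?case by simp
  qed
  from this[of n] show "kr n n A \<subseteq> im n n B" by auto
qed

text \<open>Reversing the order of the basis turns lower triangular matrices into upper triangular ones.\<close>

definition flip :: "nat \<Rightarrow> (nat \<Rightarrow> nat \<Rightarrow> 'a) \<Rightarrow> nat \<Rightarrow> nat \<Rightarrow> 'a" where
  "flip n A i j = A (n - 1 - i) (n - 1 - j)"

definition flipv :: "nat \<Rightarrow> (nat \<Rightarrow> 'a) \<Rightarrow> nat \<Rightarrow> 'a" where
  "flipv n v = (\<lambda>i\<in>{..<n}. v (n - 1 - i))"

lemma dot_flip:
  assumes "\<And>i. i < n \<Longrightarrow> u i \<in> carrier R" "\<And>i. i < n \<Longrightarrow> v i \<in> carrier R"
  shows "dot n (\<lambda>i. u (n - 1 - i)) (\<lambda>i. v (n - 1 - i)) = dot n u v"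
proof -
  have inj: "inj_on (\<lambda>i. n - 1 - i) {..<n}" by (auto simp: inj_on_def)
  have "(\<lambda>i. n - 1 - i) ` {..<n} = {..<n}"
  proof
    show "{..<n} \<subseteq> (\<lambda>i. n - 1 - i) ` {..<n}"
    proof
      fix i assume "i \<in> {..<n}"
      then show "i \<in> (\<lambda>i. n - 1 - i) ` {..<n}" by (intro image_eqI[of _ _ "n - 1 - i"]) auto
    qed
  qed auto
  then show ?thesis
    unfolding dot_def using finsum_reindex[OF _ inj, of "\<lambda>i. u i \<otimes> v i"] assms by auto
qed

lemma mat_mul_flip:
  assumes "mat_over R n n A" "mat_over R n n B" "i < n" "j < n"
  shows "mat_mul n (flip n A) (flip n B) i j = mat_mul n A B (n - 1 - i) (n - 1 - j)"
  unfolding mat_mul_def flip_def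
  using dot_flip[of n "A (n - 1 - i)" "\<lambda>l. B l (n - 1 - j)"] assms by (auto simp: mat_over_def)

lemma mv_flip:
  assumes A: "mat_over R n n A" and v: "v \<in> carrier (free_mod R n)"
  shows "mv n n (flip n A) (flipv n v) = flipv n (mv n n A v)"
proof
  fix i
  show "mv n n (flip n A) (flipv n v) i = flipv n (mv n n A v) i"
  proof (cases "i < n")
    case i: True
    have "dot n (flip n A i) (flipv n v) = dot n (\<lambda>k. A (n - 1 - i) (n - 1 - k)) (\<lambda>k. v (n - 1 - k))"
      using A v i by (intro dot_cong) (auto simp: flip_def flipv_def mat_over_def free_nth)
    also have "\<dots> = dot n (A (n - 1 - i)) v"
      using A v i by (intro dot_flip) (auto simp: mat_over_def)
    finally show ?thesis using i by (simp add: mv_nth flipv_def)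
  qed (simp add: mv_def flipv_def)
qed

lemma flipv_closed: "v \<in> carrier (free_mod R n) \<Longrightarrow> flipv n v \<in> carrier (free_mod R n)"
  unfolding flipv_def by (rule free_restrict) auto

lemma flipv_flipv: "v \<in> carrier (free_mod R n) \<Longrightarrow> flipv n (flipv n v) = v"
  using flipv_closed[OF flipv_closed] by (intro free_eqI[of _ R n]) (auto simp: flipv_def)

lemma triangular_flip_tr:
  assumes "triangular_diag n a A"
  shows "triangular_diag n (\<lambda>i. a (n - 1 - i)) (flip n (tr A))"
  using assms unfolding triangular_diag_def mat_m_def flip_def tr_def by auto

lemma mat_mul_flip_tr_zero:
  assumes "mat_over R n n A" "mat_over R n n B" "\<And>i j. i < n \<Longrightarrow> j < n \<Longrightarrow> mat_mul n A B i j = \<zero>"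
    "i < n" "j < n"
  shows "mat_mul n (flip n (tr B)) (flip n (tr A)) i j = \<zero>"
  using mat_mul_flip[of n "tr B" "tr A" i j] mat_mul_tr[of n n A n B "n - 1 - i" "n - 1 - j"] assms by simp

text \<open>Transposing and reversing the basis turns a left factor into a right factor and
  preserves upper triangularity, so \<open>triangular_lift\<close> applies.\<close>

lemma triangular_lift_left:
  assumes A: "triangular_diag n a A" and ab: "\<And>i. i < n \<Longrightarrow> dual_pair (a i) (b i)"
  shows "\<exists>B. triangular_diag n b B \<and> (\<forall>i<n. \<forall>j<n. mat_mul n B A i j = \<zero>)"
proof -
  obtain B where B: "triangular_diag n (\<lambda>i. b (n - 1 - i)) B"
    "\<And>i j. i < n \<Longrightarrow> j < n \<Longrightarrow> mat_mul n (flip n (tr A)) B i j = \<zero>"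
    using triangular_lift[OF triangular_flip_tr[OF A], of "\<lambda>i. b (n - 1 - i)"] ab by auto
  define C where "C = flip n (tr B)"
  have C: "triangular_diag n b C"
    using triangular_flip_tr[OF B(1)] by (simp add: C_def triangular_diag_def)
  have Ao: "mat_over R n n A" "mat_over R n n B" "mat_over R n n (flip n (tr A))" "mat_over R n n C"
    using triangular_diag_over[OF A] triangular_diag_over[OF B(1)] triangular_diag_over[OF C]
      triangular_diag_over[OF triangular_flip_tr[OF A]] by blast+
  have "mat_mul n C A i j = \<zero>" if ij: "i < n" "j < n" for i j
  proof -
    have "mat_mul n C (flip n (tr (flip n (tr A)))) i j = \<zero>"
      unfolding C_def by (rule mat_mul_flip_tr_zero[OF Ao(3,2) B(2) ij])
    moreover have "mat_mul n C (flip n (tr (flip n (tr A)))) i j = mat_mul n C A i j"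
      unfolding mat_mul_def using Ao ij by (intro dot_cong) (auto simp: flip_def tr_def mat_over_def)
    ultimately show ?thesis by simp
  qed
  then show ?thesis using C by blast
qed

text \<open>Exactness of the dual sequence is \<open>triangular_exact\<close> for the reversed
  transposes, where \<open>a\<close> and \<open>b\<close> exchange their roles.\<close>

lemma triangular_dexact:
  assumes A: "triangular_diag n a A" and B: "triangular_diag n b B"
    and ab: "\<And>i. i < n \<Longrightarrow> dual_pair (a i) (b i)" and e: "0 < n \<Longrightarrow> embdim = 1 + socdim"
    and AB: "\<And>i j. i < n \<Longrightarrow> j < n \<Longrightarrow> mat_mul n A B i j = \<zero>"
  shows "dexact n n n A B"
proof -
  have Ao: "mat_over R n n A" "mat_over R n n B" "mat_over R n n (tr A)" "mat_over R n n (tr B)"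
    using triangular_diag_over[OF A] triangular_diag_over[OF B] by simp_all
  have f: "kr n n (flip n (tr B)) = im n n (flip n (tr A))"
    by (rule triangular_exact[OF triangular_flip_tr[OF B] triangular_flip_tr[OF A]])
      (use dual_pair_sym ab e mat_mul_flip_tr_zero[OF Ao(1,2) AB] in auto)
  have "kr n n (tr B) \<subseteq> im n n (tr A)"
  proof
    fix v assume "v \<in> kr n n (tr B)"
    then have v: "v \<in> carrier (free_mod R n)" "mv n n (tr B) v = \<zero>\<^bsub>free_mod R n\<^esub>" by (auto simp: kr_def)
    have "flipv n \<zero>\<^bsub>free_mod R n\<^esub> = \<zero>\<^bsub>free_mod R n\<^esub>" by (auto simp: flipv_def free_mod_def)
    then have "flipv n v \<in> kr n n (flip n (tr B))"
      using mv_flip[OF Ao(4) v(1)] v flipv_closed by (simp add: kr_def)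
    then obtain w where w: "w \<in> carrier (free_mod R n)" "flipv n v = mv n n (flip n (tr A)) w"
      unfolding f by (auto simp: im_def)
    have "flipv n v = flipv n (mv n n (tr A) (flipv n w))"
      using mv_flip[OF Ao(3) flipv_closed[OF w(1)]] unfolding flipv_flipv[OF w(1)] w(2) .
    then have "v = mv n n (tr A) (flipv n w)"
      using flipv_flipv[OF v(1)] flipv_flipv[OF mv_closed[OF Ao(3) flipv_closed[OF w(1)]]] by metis
    then show "v \<in> im n n (tr A)" using flipv_closed[OF w(1)] by (auto simp: im_def)
  qed
  moreover have "kr n n A = im n n B" by (rule triangular_exact[OF A B ab e AB])
  moreover from this have "im n n (tr A) \<subseteq> kr n n (tr B)" using im_subset_kr_tr[OF Ao(1,2)] by simp
  ultimately show ?thesis using Ao by (simp add: dexact_def)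
qed

lemma biinfinite_triangular:
  assumes A: "triangular_diag n a A" and ab: "\<And>i. i < n \<Longrightarrow> dual_pair (a i) (b i)"
    and e: "0 < n \<Longrightarrow> embdim = 1 + socdim"
  shows "\<exists>D :: int \<Rightarrow> nat \<Rightarrow> nat \<Rightarrow> 'a. D 1 = A \<and> (\<forall>i. mat_m n n (D i) \<and> (\<forall>k<n. \<forall>l<k. D i k l = \<zero>) \<and>
     dexact n n n (D i) (D (i + 1)))"
proof -
  let ?c = "\<lambda>k::nat. if even k then a else b"
  let ?P = "\<lambda>k D. triangular_diag n (?c k) D \<and> (k = 0 \<longrightarrow> D = A)"
  have c: "dual_pair (?c k i) (?c (Suc k) i)" if "i < n" for k i
    using ab[OF that] dual_pair_sym by auto
  have z: "\<exists>D. ?P 0 D" using A by auto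
  have s1: "\<exists>E. ?P (Suc k) E \<and> (\<forall>i<n. \<forall>j<n. mat_mul n D E i j = \<zero>)" if "?P k D" for k D
    using triangular_lift[of n "?c k" D "?c (Suc k)"] that c by auto
  have s2: "\<exists>E. ?P (Suc k) E \<and> (\<forall>i<n. \<forall>j<n. mat_mul n E D i j = \<zero>)" if "?P k D" for k D
    using triangular_lift_left[of n "?c k" D "?c (Suc k)"] that c by auto
  obtain f where f: "\<And>k. ?P k (f k)" "\<And>k. \<forall>i<n. \<forall>j<n. mat_mul n (f k) (f (Suc k)) i j = \<zero>"
    using dependent_nat_choice[of ?P "\<lambda>k D E. \<forall>i<n. \<forall>j<n. mat_mul n D E i j = \<zero>", OF z s1] by blast
  obtain g where g: "\<And>k. ?P k (g k)" "\<And>k. \<forall>i<n. \<forall>j<n. mat_mul n (g (Suc k)) (g k) i j = \<zero>"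
    using dependent_nat_choice[of ?P "\<lambda>k D E. \<forall>i<n. \<forall>j<n. mat_mul n E D i j = \<zero>", OF z s2] by blast
  \<comment> \<open>\<open>f\<close> runs to the right and \<open>g\<close> to the left, both
    starting from \<open>A\<close>. The seam lies between \<open>D 0 = g 1\<close> and
    \<open>D 1 = f 0\<close>, and the latter equals \<open>g 0\<close>.\<close>
  define D where "D = (\<lambda>i::int. if 1 \<le> i then f (nat (i - 1)) else g (nat (1 - i)))"
  have fc: "triangular_diag n (?c k) (f k)" and gc: "triangular_diag n (?c k) (g k)" for k
    using f(1)[of k] g(1)[of k] by blast+
  have tri: "\<exists>c. triangular_diag n c (D i)" for i
    unfolding D_def using fc[of "nat (i - 1)"] gc[of "nat (1 - i)"] by (cases "1 \<le> i") (simp_all only: if_True if_False, blast+)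
  have ex: "dexact n n n (D i) (D (i + 1))" for i
  proof (cases "1 \<le> i")
    case True
    then have "nat (i + 1 - 1) = Suc (nat (i - 1))" by simp
    then have D: "D i = f (nat (i - 1))" "D (i + 1) = f (Suc (nat (i - 1)))" using True by (simp_all add: D_def)
    show ?thesis unfolding D
      by (rule triangular_dexact[OF fc fc c e f(2)[rule_format]])
  next
    case False
    define k where "k = nat (- i)"
    have D: "D i = g (Suc k)" using False by (simp add: D_def k_def Suc_nat_eq_nat_zadd1)
    have D': "D (i + 1) = g k"
    proof (cases "i = 0")
      case True
      then show ?thesis using f(1)[of 0] g(1)[of 0] by (simp add: D_def k_def)
    next
      case False
      then show ?thesis using \<open>\<not> 1 \<le> i\<close> by (simp add: D_def k_def)
    qed
    show ?thesis unfolding D D'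
      by (rule triangular_dexact[OF gc gc c[THEN dual_pair_sym] e g(2)[rule_format]])
  qed
  have "D 1 = A" using f(1)[of 0] by (simp add: D_def)
  then show ?thesis using tri ex unfolding triangular_diag_def by (intro exI[of _ D]) blast
qed

end

section \<open>Duals of free modules\<close>

context cring
begin

text \<open>Identifies R^n with its dual through the pairing; under it \<open>Hom_map\<close> of a
  matrix is the transposed matrix (\<open>Hom_map_dual_vec\<close>). The restriction matches the
  extensional elements of \<open>Hom_mod\<close>.\<close>

definition dual_vec :: "nat \<Rightarrow> (nat \<Rightarrow> 'a) \<Rightarrow> (nat \<Rightarrow> 'a) \<Rightarrow> 'a" where
  "dual_vec n y = (\<lambda>v\<in>carrier (free_mod R n). dot n y v)"

lemma dual_mod_carrier:
  "\<phi> \<in> carrier (dual_mod R M) \<longleftrightarrow> \<phi> \<in> mod_hom R M (self_mod R) \<and> \<phi> \<in> extensional (carrier M)"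
  by (simp add: dual_mod_def Hom_mod_def)

lemma dual_zero: "\<zero>\<^bsub>dual_mod R M\<^esub> = (\<lambda>x\<in>carrier M. \<zero>)"
  by (simp add: dual_mod_def Hom_mod_def)

lemma dual_vec_closed:
  assumes y: "y \<in> carrier (free_mod R n)"
  shows "dual_vec n y \<in> carrier (dual_mod R (free_mod R n))"
proof -
  interpret l: linear_map R "free_mod R n" "self_mod R" "dot n y" by (rule dot_linear[OF y])
  have "dual_vec n y \<in> mod_hom R (free_mod R n) (self_mod R)"
    using l.closed l.add l.smult unfolding mod_hom_def hom_def dual_vec_def by simp
  then show ?thesis by (simp add: dual_mod_carrier dual_vec_def)
qed

lemma dual_vec_surj:
  assumes "\<phi> \<in> carrier (dual_mod R (free_mod R n))"
  shows "\<exists>y\<in>carrier (free_mod R n). \<phi> = dual_vec n y"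
proof -
  have \<phi>: "\<phi> \<in> mod_hom R (free_mod R n) (self_mod R)" "\<phi> \<in> extensional (carrier (free_mod R n))"
    using assms by (simp_all add: dual_mod_carrier)
  interpret \<phi>: linear_map R "free_mod R n" "self_mod R" \<phi>
    by (intro linear_map.intro linear_map_axioms.intro free_module self_module \<phi>)
  define y where "y = (\<lambda>j\<in>{..<n}. \<phi> (unit_vec n j))"
  have y: "y \<in> carrier (free_mod R n)"
    unfolding y_def using \<phi>.closed[OF unit_vec_closed] by (intro free_restrict) simp
  have "\<phi> = dual_vec n y"
  proof (rule extensionalityI[OF \<phi>(2)])
    show "dual_vec n y \<in> extensional (carrier (free_mod R n))" by (simp add: dual_vec_def)
    fix v assume v: "v \<in> carrier (free_mod R n)"
    then show "\<phi> v = dual_vec n y v"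
      using functional_eq_dot[OF \<phi>.linear_map_axioms v] by (simp only: dual_vec_def y_def restrict_apply' if_True)
  qed
  then show ?thesis using y by blast
qed

lemma dual_vec_inj:
  assumes "u \<in> carrier (free_mod R n)" "v \<in> carrier (free_mod R n)" "dual_vec n u = dual_vec n v"
  shows "u = v"
proof (rule free_eqI[OF assms(1,2)])
  fix i assume i: "i < n"
  have "dual_vec n u (unit_vec n i) = dual_vec n v (unit_vec n i)" using assms(3) by simp
  then have "dot n u (unit_vec n i) = dot n v (unit_vec n i)"
    unfolding dual_vec_def using unit_vec_closed[of n i] by simp
  then show "u i = v i" using dot_unit[of n u i] dot_unit[of n v i] assms i free_nth by metis
qed

lemma Hom_map_dual_vec:
  assumes D: "mat_over R a b D" and y: "y \<in> carrier (free_mod R a)"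
  shows "Hom_map (free_mod R b) (mv a b D) (dual_vec a y) = dual_vec b (mv b a (tr D) y)"
proof
  fix v
  show "Hom_map (free_mod R b) (mv a b D) (dual_vec a y) v = dual_vec b (mv b a (tr D) y) v"
    using mv_adjoint[OF D y, of v] mv_closed[OF D, of v]
    by (simp add: Hom_map_def compose_def dual_vec_def)
qed

lemma dual_vec_zero: "dual_vec n \<zero>\<^bsub>free_mod R n\<^esub> = \<zero>\<^bsub>dual_mod R (free_mod R n)\<^esub>"
proof -
  have "dot n \<zero>\<^bsub>free_mod R n\<^esub> v = \<zero>" if "v \<in> carrier (free_mod R n)" for v
    using that by (intro dot_eq_zero) (simp add: free_zero_nth free_nth)
  then show ?thesis unfolding dual_vec_def dual_zero by (intro restrict_ext) simp
qed

lemma dual_kernel: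
  assumes E: "mat_over R b c E"
  shows "a_kernel (dual_mod R (free_mod R b)) (dual_mod R (free_mod R c)) (Hom_map (free_mod R c) (mv b c E))
     = dual_vec b ` kr c b (tr E)"
proof -
  have Et: "mat_over R c b (tr E)" using E by simp
  have iff: "Hom_map (free_mod R c) (mv b c E) (dual_vec b y) = \<zero>\<^bsub>dual_mod R (free_mod R c)\<^esub> \<longleftrightarrow>
      mv c b (tr E) y = \<zero>\<^bsub>free_mod R c\<^esub>" if y: "y \<in> carrier (free_mod R b)" for y
    unfolding Hom_map_dual_vec[OF E y] dual_vec_zero[symmetric]
    using dual_vec_inj[OF mv_closed[OF Et y] free_zero_closed] by auto
  show ?thesis
  proof (rule subset_antisym; rule subsetI)
    fix \<phi> assume "\<phi> \<in> a_kernel (dual_mod R (free_mod R b)) (dual_mod R (free_mod R c)) (Hom_map (free_mod R c) (mv b c E))"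
    then have \<phi>: "\<phi> \<in> carrier (dual_mod R (free_mod R b))"
      "Hom_map (free_mod R c) (mv b c E) \<phi> = \<zero>\<^bsub>dual_mod R (free_mod R c)\<^esub>" by (simp_all add: a_kernel_def')
    obtain y where y: "y \<in> carrier (free_mod R b)" "\<phi> = dual_vec b y" using dual_vec_surj[OF \<phi>(1)] by blast
    then have "y \<in> kr c b (tr E)" using \<phi>(2) iff[OF y(1)] by (simp add: kr_def)
    then show "\<phi> \<in> dual_vec b ` kr c b (tr E)" using y by blast
  next
    fix \<phi> assume "\<phi> \<in> dual_vec b ` kr c b (tr E)"
    then obtain y where y: "y \<in> carrier (free_mod R b)" "mv c b (tr E) y = \<zero>\<^bsub>free_mod R c\<^esub>" "\<phi> = dual_vec b y"
      by (auto simp: kr_def)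
    show "\<phi> \<in> a_kernel (dual_mod R (free_mod R b)) (dual_mod R (free_mod R c)) (Hom_map (free_mod R c) (mv b c E))"
      unfolding a_kernel_def' y(3) using dual_vec_closed[OF y(1)] iff[OF y(1)] y(2) by simp
  qed
qed

lemma dual_image:
  assumes D: "mat_over R a b D"
  shows "Hom_map (free_mod R b) (mv a b D) ` carrier (dual_mod R (free_mod R a)) = dual_vec b ` im b a (tr D)"
proof (rule subset_antisym; rule subsetI)
  fix \<phi> assume "\<phi> \<in> Hom_map (free_mod R b) (mv a b D) ` carrier (dual_mod R (free_mod R a))"
  then obtain y where "y \<in> carrier (free_mod R a)" "\<phi> = Hom_map (free_mod R b) (mv a b D) (dual_vec a y)"
    using dual_vec_surj by blast
  then show "\<phi> \<in> dual_vec b ` im b a (tr D)" using Hom_map_dual_vec[OF D] by (auto simp: im_def)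
next
  fix \<phi> assume "\<phi> \<in> dual_vec b ` im b a (tr D)"
  then obtain y where y: "y \<in> carrier (free_mod R a)" "\<phi> = dual_vec b (mv b a (tr D) y)" by (auto simp: im_def)
  show "\<phi> \<in> Hom_map (free_mod R b) (mv a b D) ` carrier (dual_mod R (free_mod R a))"
    unfolding y(2) Hom_map_dual_vec[OF D y(1), symmetric] using dual_vec_closed[OF y(1)] by blast
qed

lemma a_kernel_mv: "mat_over R a b D \<Longrightarrow> a_kernel (free_mod R b) (free_mod R a) (mv a b D) = kr a b D"
  by (simp add: a_kernel_def' kr_def)

lemma unit_vec_basis: "is_basis R (free_mod R n) n (unit_vec n)"
  unfolding is_basis_def
proof (intro conjI ballI)
  show "unit_vec n ` {..<n} \<subseteq> carrier (free_mod R n)" by auto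
  fix x assume x: "x \<in> carrier (free_mod R n)"
  show "\<exists>!c. c \<in> {..<n} \<rightarrow>\<^sub>E carrier R \<and> x = (\<Oplus>\<^bsub>free_mod R n\<^esub>i\<in>{..<n}. c i \<odot>\<^bsub>free_mod R n\<^esub> unit_vec n i)"
    using x free_eq_finsum_unit unfolding free_mod_carrier[symmetric] by (intro ex1I[of _ x]) metis+
qed

text \<open>The isomorphism sends an element of \<open>T\<close> to its fibre under
  \<open>p\<close>, which is a coset of \<open>K\<close>. Working with whole fibres avoids a choice
  of representatives.\<close>

lemma quotient_iso:
  assumes T: "module R T" and p: "p \<in> mod_hom R (free_mod R n) T" and surj: "p ` carrier (free_mod R n) = carrier T"
    and K: "K = a_kernel (free_mod R n) T p"
  shows "mod_iso R T (quot_mod (free_mod R n) K) \<noteq> {}"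
proof -
  interpret p: linear_map R "free_mod R n" T p
    by (intro linear_map.intro linear_map_axioms.intro free_module T p)
  let ?F = "free_mod R n"
  have K': "K = p.ker" using K by (simp add: a_kernel_def' p.ker_def)
  define f where "f = (\<lambda>x. {u \<in> carrier ?F. p u = x})"
  have coset: "K +>\<^bsub>?F\<^esub> u = f (p u)" if u: "u \<in> carrier ?F" for u
  proof (rule subset_antisym; rule subsetI)
    fix v assume "v \<in> K +>\<^bsub>?F\<^esub> u"
    then obtain k where "k \<in> K" "v = k \<oplus>\<^bsub>?F\<^esub> u" by (auto simp: a_r_coset_def')
    then show "v \<in> f (p u)" using u by (auto simp: f_def K' p.ker_def p.add)
  next
    fix v assume v: "v \<in> f (p u)"
    then have vc: "v \<in> carrier ?F" "p v = p u" by (auto simp: f_def)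
    have "v \<ominus>\<^bsub>?F\<^esub> u \<in> K" using p.eq_imp_diff_ker[OF vc(1) u vc(2)] K' by simp
    moreover have "v = (v \<ominus>\<^bsub>?F\<^esub> u) \<oplus>\<^bsub>?F\<^esub> u" using vc u by (simp add: a_minus_def p.M.M.a_assoc p.M.M.l_neg)
    ultimately show "v \<in> K +>\<^bsub>?F\<^esub> u" by (auto simp: a_r_coset_def')
  qed
  have pre: "\<exists>u\<in>carrier ?F. p u = x" if "x \<in> carrier T" for x using that surj by (metis imageE)
  have rc: "a_rcosets\<^bsub>?F\<^esub> K = f ` carrier T"
    using coset pre surj by (auto simp: A_RCOSETS_def') (metis imageI)
  have fadd: "f (x \<oplus>\<^bsub>T\<^esub> y) = f x <+>\<^bsub>?F\<^esub> f y" if xy: "x \<in> carrier T" "y \<in> carrier T" for x y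
  proof (rule subset_antisym; rule subsetI)
    fix w assume "w \<in> f (x \<oplus>\<^bsub>T\<^esub> y)"
    then have w: "w \<in> carrier ?F" "p w = x \<oplus>\<^bsub>T\<^esub> y" by (auto simp: f_def)
    obtain u where u: "u \<in> carrier ?F" "p u = x" using pre xy by blast
    have "p (w \<ominus>\<^bsub>?F\<^esub> u) = (x \<oplus>\<^bsub>T\<^esub> y) \<ominus>\<^bsub>T\<^esub> x" using w u by (simp add: p.diff)
    also have "\<dots> = y"
      using xy by (simp add: a_minus_def p.N.M.a_comm[of x y] p.N.M.a_assoc p.N.M.r_neg)
    finally have "p (w \<ominus>\<^bsub>?F\<^esub> u) = y" .
    moreover have "w = u \<oplus>\<^bsub>?F\<^esub> (w \<ominus>\<^bsub>?F\<^esub> u)"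
      using w u p.M.M.a_lcomm[of u w "\<ominus>\<^bsub>?F\<^esub> u"] by (simp add: a_minus_def p.M.M.r_neg)
    moreover have "u \<in> f x" "w \<ominus>\<^bsub>?F\<^esub> u \<in> f y" using u w calculation(1) by (simp_all add: f_def)
    ultimately show "w \<in> f x <+>\<^bsub>?F\<^esub> f y" unfolding set_add_def' by blast
  next
    fix w assume "w \<in> f x <+>\<^bsub>?F\<^esub> f y"
    then show "w \<in> f (x \<oplus>\<^bsub>T\<^esub> y)" by (auto simp: set_add_def' f_def p.add)
  qed
  have fsm: "f (r \<odot>\<^bsub>T\<^esub> x) = (\<Union>y\<in>f x. K +>\<^bsub>?F\<^esub> (r \<odot>\<^bsub>?F\<^esub> y))" if "r \<in> carrier R" "x \<in> carrier T" for r x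
  proof -
    have "K +>\<^bsub>?F\<^esub> (r \<odot>\<^bsub>?F\<^esub> y) = f (r \<odot>\<^bsub>T\<^esub> x)" if "y \<in> f x" for y
      using coset[of "r \<odot>\<^bsub>?F\<^esub> y"] that \<open>r \<in> carrier R\<close> by (auto simp: f_def p.smult)
    moreover have "f x \<noteq> {}" using pre[OF that(2)] by (auto simp: f_def)
    ultimately show ?thesis by auto
  qed
  have hom: "f \<in> mod_hom R T (quot_mod ?F K)"
    using fadd fsm by (auto simp: mod_hom_def hom_def quot_mod_def rc)
  have "inj_on f (carrier T)"
  proof (rule inj_onI)
    fix x y assume xy: "x \<in> carrier T" "y \<in> carrier T" "f x = f y"
    obtain u where "u \<in> carrier ?F" "p u = x" using pre[OF xy(1)] by blast
    then have "u \<in> f y" using xy(3) by (auto simp: f_def)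
    then show "x = y" using \<open>p u = x\<close> by (simp add: f_def)
  qed
  then have "bij_betw f (carrier T) (carrier (quot_mod ?F K))"
    by (simp add: bij_betw_def quot_mod_def rc)
  then show ?thesis using hom by (auto simp: mod_iso_def)
qed

end

section \<open>The complex defined by a biinfinite sequence of matrices\<close>

lemma (in short_local) mF_subset_ideal_smult: "mF n \<subseteq> ideal_smult R m (free_mod R n)"
  unfolding ideal_smult_def mod_span_def
proof (intro subsetI InterI)
  fix v N assume v: "v \<in> mF n" and "N \<in> {N. submodule N R (free_mod R n) \<and>
     {r \<odot>\<^bsub>free_mod R n\<^esub> x |r x. r \<in> m \<and> x \<in> carrier (free_mod R n)} \<subseteq> N}"
  then have N: "submodule N R (free_mod R n)" "\<And>r x. r \<in> m \<Longrightarrow> x \<in> carrier (free_mod R n) \<Longrightarrow> r \<odot>\<^bsub>free_mod R n\<^esub> x \<in> N"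
    by auto
  have "v j \<odot>\<^bsub>free_mod R n\<^esub> unit_vec n j \<in> N" if "j < n" for j
    using N(2)[of "v j" "unit_vec n j"] v that by (simp add: mF_def box_def)
  then have "(\<Oplus>\<^bsub>free_mod R n\<^esub>j\<in>{..<n}. v j \<odot>\<^bsub>free_mod R n\<^esub> unit_vec n j) \<in> N"
    by (intro submodule_finsum[OF free_module N(1)]) auto
  moreover have vc: "v \<in> carrier (free_mod R n)" using v mF_closed by blast
  ultimately show "v \<in> N" by (simp only: free_eq_finsum_unit[OF vc, symmetric])
qed

locale matrix_complex = short_local +
  fixes n :: nat and D :: "int \<Rightarrow> nat \<Rightarrow> nat \<Rightarrow> 'a"
  assumes Dm: "\<And>i. mat_m n n (D i)" and triangular: "\<And>i k l. k < n \<Longrightarrow> l < k \<Longrightarrow> D i k l = \<zero>"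
    and dex: "\<And>i. dexact n n n (D i) (D (i + 1))"
begin

definition terms :: "int \<Rightarrow> ('a, nat \<Rightarrow> 'a) module" where "terms i = free_mod R n"
definition diffs :: "int \<Rightarrow> (nat \<Rightarrow> 'a) \<Rightarrow> nat \<Rightarrow> 'a" where "diffs i = mv n n (D i)"

lemma Do: "mat_over R n n (D i)"
  using Dm mat_m_over by blast

lemma kr_D: "kr n n (D i) = im n n (D (i + 1))" and kr_tr_D: "kr n n (tr (D (i + 1))) = im n n (tr (D i))"
  using dex[of i] by (simp_all add: dexact_def)

lemma free_complex: "free_complex R terms diffs"
  unfolding free_complex_def
proof (intro conjI allI ballI)
  fix i
  show "fin_free R (terms i)"
    using free_module unit_vec_basis unfolding fin_free_def terms_def by blast
  show "diffs i \<in> mod_hom R (terms i) (terms (i - 1))"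
    using mv_mod_hom[OF Do] by (simp add: diffs_def terms_def)
  fix x assume "x \<in> carrier (terms i)"
  then have "mv n n (D i) x \<in> im n n (D (i - 1 + 1))" by (auto simp: terms_def im_def)
  then have "mv n n (D i) x \<in> kr n n (D (i - 1))" using kr_D by blast
  then show "diffs (i - 1) (diffs i x) = \<zero>\<^bsub>terms (i - 2)\<^esub>" by (simp add: diffs_def terms_def kr_def)
qed

lemma acyclic: "acyclic_complex terms diffs"
  using a_kernel_mv[OF Do] kr_D by (simp add: acyclic_complex_def diffs_def terms_def im_def)

lemma dual_acyclic: "acyclic_complex (dual_complex R terms) (dual_diff terms diffs)"
  unfolding acyclic_complex_def
proof
  fix i
  \<comment> \<open>Degree \<open>i\<close> of the dual complex is the dual of degree
    \<open>- i\<close>, and its differential comes from \<open>D (1 - i)\<close>. The index is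
    written \<open>- i + 1\<close> to match \<open>kr_tr_D\<close>.\<close>
  have "a_kernel (dual_mod R (free_mod R n)) (dual_mod R (free_mod R n)) (Hom_map (free_mod R n) (mv n n (D (- i + 1))))
      = dual_vec n ` kr n n (tr (D (- i + 1)))" by (rule dual_kernel[OF Do])
  also have "\<dots> = dual_vec n ` im n n (tr (D (- i)))" unfolding kr_tr_D ..
  also have "\<dots> = Hom_map (free_mod R n) (mv n n (D (- i))) ` carrier (dual_mod R (free_mod R n))"
    by (rule dual_image[OF Do, symmetric])
  finally show "a_kernel (dual_complex R terms i) (dual_complex R terms (i - 1)) (dual_diff terms diffs i) =
      dual_diff terms diffs (i + 1) ` carrier (dual_complex R terms (i + 1))"
    by (simp add: dual_complex_def dual_diff_def terms_def diffs_def)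
qed

lemma minimal: "minimal_complex R m terms diffs"
  unfolding minimal_complex_def terms_def diffs_def
proof (intro allI image_subsetI)
  fix i x assume "x \<in> carrier (free_mod R n)"
  then show "mv n n (D i) x \<in> ideal_smult R m (free_mod R n)"
    using mv_in_mF[OF Dm] mF_subset_ideal_smult by blast
qed

lemma upper_triangular: "upper_triangular_complex R terms diffs"
  unfolding upper_triangular_complex_def
proof (rule exI[of _ n], rule exI[of _ "\<lambda>_. unit_vec n"], rule exI[of _ D], intro allI conjI impI)
  fix i
  show "is_basis R (terms i) n (unit_vec n)" unfolding terms_def by (rule unit_vec_basis)
  show "upper_triangular_mat R n (D i)" using Do triangular by (simp add: upper_triangular_mat_def)
  fix t assume t: "t < n"
  interpret F: module R "free_mod R n" by (rule free_module)
  have c: "mat_col n (D i) t \<in> carrier (free_mod R n)" by (rule mat_col_closed[OF Do t])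
  have "mat_col n (D i) t = (\<Oplus>\<^bsub>free_mod R n\<^esub>s\<in>{..<n}. mat_col n (D i) t s \<odot>\<^bsub>free_mod R n\<^esub> unit_vec n s)"
    by (rule free_eq_finsum_unit[OF c])
  also have "\<dots> = (\<Oplus>\<^bsub>free_mod R n\<^esub>s\<in>{..<n}. D i s t \<odot>\<^bsub>free_mod R n\<^esub> unit_vec n s)"
    using mat_overD[OF Do _ t] by (intro F.M.finsum_cong') (auto simp: mat_col_def)
  finally show "diffs i (unit_vec n t) =
      (\<Oplus>\<^bsub>terms (i - 1)\<^esub>s\<in>{..<n}. D i s t \<odot>\<^bsub>terms (i - 1)\<^esub> unit_vec n s)"
    using mv_unit[OF Do t] by (simp add: diffs_def terms_def)
qed

lemma complete_resolution:
  assumes "module R T" "p \<in> mod_hom R (free_mod R n) T" "p ` carrier (free_mod R n) = carrier T"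
    "a_kernel (free_mod R n) T p = im n n (D 1)"
  shows "complete_resolution R T terms diffs"
  using free_complex acyclic dual_acyclic quotient_iso[OF assms(1-3) refl] assms(4)
  by (simp add: complete_resolution_def totally_acyclic_def terms_def diffs_def im_def)

end

section \<open>Matrices of a totally reflexive module\<close>

text \<open>\<open>b\<close> plays the role of the zero cochain. Only the equation for
  \<open>b\<close> is assumed, so no group structure on cochains has to be established before
  reading off vanishing cohomology.\<close>

lemma coset_space_trivial:
  assumes "carrier (quot_mod (M\<lparr>carrier := Z\<rparr>) B) = {\<zero>\<^bsub>quot_mod (M\<lparr>carrier := Z\<rparr>) B\<^esub>}"
    and "z \<in> Z" "b \<in> B" "b \<oplus>\<^bsub>M\<^esub> z = z"
  shows "z \<in> B"
proof -
  have "B +>\<^bsub>M\<lparr>carrier := Z\<rparr>\<^esub> z \<in> carrier (quot_mod (M\<lparr>carrier := Z\<rparr>) B)"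
    using assms(2) by (auto simp: quot_mod_def A_RCOSETS_def')
  then have "B +>\<^bsub>M\<lparr>carrier := Z\<rparr>\<^esub> z = B" unfolding assms(1) by (simp add: quot_mod_def)
  moreover have "b \<oplus>\<^bsub>M\<^esub> z \<in> B +>\<^bsub>M\<lparr>carrier := Z\<rparr>\<^esub> z" using assms(3) by (auto simp: a_r_coset_def')
  ultimately show ?thesis using assms(4) by simp
qed

locale presented = short_local +
  fixes T :: "('a, 'c, 'q) module_scheme" and n :: nat and U :: "nat \<Rightarrow> nat \<Rightarrow> 'a" and p :: "(nat \<Rightarrow> 'a) \<Rightarrow> 'c"
  assumes reflexive: "totally_reflexive R T"
    and n_min: "n = min_num_gens R T" and Uo: "mat_over R n n U"
    and p_hom: "p \<in> mod_hom R (free_mod R n) T" and p_surj: "p ` carrier (free_mod R n) = carrier T"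
    and span: "mod_span R (free_mod R n) (mat_col n U ` {..<n}) = a_kernel (free_mod R n) T p"
    and irredundant: "\<And>J. J \<subset> {..<n} \<Longrightarrow>
      mod_span R (free_mod R n) (mat_col n U ` J) \<noteq> a_kernel (free_mod R n) T p"
begin

interpretation F: module R "free_mod R n" by (rule free_module)

lemma T_module: "module R T"
  using reflexive by (simp add: totally_reflexive_def)

interpretation p: linear_map R "free_mod R n" T p
  by (intro linear_map.intro linear_map_axioms.intro free_module T_module p_hom)

lemma ker_p: "a_kernel (free_mod R n) T p = im n n U"
  using span span_eq_im[OF Uo] by simp

lemma p_zero_iff: "v \<in> carrier (free_mod R n) \<Longrightarrow> p v = \<zero>\<^bsub>T\<^esub> \<longleftrightarrow> v \<in> im n n U"
  unfolding ker_p[symmetric] by (simp add: a_kernel_def')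

text \<open>A unit entry in row \<open>i\<close> would make a relation expressing generator
  \<open>i\<close> through the others, leaving fewer generators than \<open>min_num_gens\<close>
  allows.\<close>

lemma U_m: "mat_m n n U"
  unfolding mat_m_def
proof (intro allI impI)
  fix i j assume i: "i < n" and j: "j < n"
  show "U i j \<in> m"
  proof (rule ccontr)
    assume "U i j \<notin> m"
    moreover have Uc: "U k j \<in> carrier R" if "k < n" for k using mat_overD[OF Uo that j] .
    ultimately have u: "U i j \<in> Units R" using unit_iff i by simp
    define S where "S = (\<lambda>k. p (unit_vec n k)) ` ({..<n} - {i})"
    have Sc: "S \<subseteq> carrier T" by (auto simp: S_def)
    have all: "carrier T \<subseteq> N" if N: "submodule N R T" "S \<subseteq> N" for N
    proof -
      define P where "P = {v \<in> carrier (free_mod R n). p v \<in> N}"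
      have P: "submodule P R (free_mod R n)" unfolding P_def by (rule p.preimage_submodule[OF N(1)])
      have ek: "unit_vec n k \<in> P" if "k < n" "k \<noteq> i" for k
        using N(2) that by (auto simp: P_def S_def)
      let ?c = "mat_col n U j"
      have cc: "?c \<in> carrier (free_mod R n)" by (rule mat_col_closed[OF Uo j])
      have "p ?c = \<zero>\<^bsub>T\<^esub>" using p_zero_iff[OF cc] col_in_im[OF Uo j] by simp
      then have cP: "?c \<in> P" using cc p.N.submodule_zero[OF N(1)] by (simp add: P_def)
      define s where "s = (\<Oplus>\<^bsub>free_mod R n\<^esub>k\<in>{..<n} - {i}. ?c k \<odot>\<^bsub>free_mod R n\<^esub> unit_vec n k)"
      have ck: "?c k \<in> carrier R" if "k < n" for k using cc that by (rule free_nth)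
      have s: "s \<in> P" unfolding s_def
        using ek F.submoduleE(4)[OF P] ck by (intro submodule_finsum[OF free_module P]) auto
      have sc: "s \<in> carrier (free_mod R n)" using s by (simp add: P_def)
      have "insert i ({..<n} - {i}) = {..<n}" using i by auto
      then have "?c = ?c i \<odot>\<^bsub>free_mod R n\<^esub> unit_vec n i \<oplus>\<^bsub>free_mod R n\<^esub> s"
        using free_eq_finsum_unit[OF cc] ck i
          F.M.finsum_insert[of "{..<n} - {i}" i "\<lambda>k. ?c k \<odot>\<^bsub>free_mod R n\<^esub> unit_vec n k"]
        by (simp add: s_def Pi_def)
      moreover have "?c i = U i j" using i by (simp add: mat_col_def)
      ultimately have "?c \<ominus>\<^bsub>free_mod R n\<^esub> s = U i j \<odot>\<^bsub>free_mod R n\<^esub> unit_vec n i"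
        using sc Uc[OF i] by (simp add: a_minus_def F.M.a_assoc F.M.r_neg)
      then have "U i j \<odot>\<^bsub>free_mod R n\<^esub> unit_vec n i \<in> P" using F.submodule_minus[OF P cP s] by simp
      then have "inv (U i j) \<odot>\<^bsub>free_mod R n\<^esub> (U i j \<odot>\<^bsub>free_mod R n\<^esub> unit_vec n i) \<in> P"
        using F.submoduleE(4)[OF P] u by simp
      moreover have "inv (U i j) \<odot>\<^bsub>free_mod R n\<^esub> (U i j \<odot>\<^bsub>free_mod R n\<^esub> unit_vec n i) = unit_vec n i"
        using F.smult_assoc1[of "inv (U i j)" "U i j" "unit_vec n i", symmetric] u Uc[OF i] by simp
      ultimately have ei: "unit_vec n k \<in> P" if "k < n" for k using ek that by (cases "k = i") auto
      show "carrier T \<subseteq> N"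
      proof
        fix x assume "x \<in> carrier T"
        then obtain v where v: "v \<in> carrier (free_mod R n)" "x = p v" using p_surj by (metis imageE)
        have "(\<Oplus>\<^bsub>free_mod R n\<^esub>k\<in>{..<n}. v k \<odot>\<^bsub>free_mod R n\<^esub> unit_vec n k) \<in> P"
          using F.submoduleE(4)[OF P] ei free_nth[OF v(1)] by (intro submodule_finsum[OF free_module P]) auto
        then have "v \<in> P" by (simp only: free_eq_finsum_unit[OF v(1), symmetric])
        then show "x \<in> N" using v by (simp add: P_def)
      qed
    qed
    have "mod_span R T S = carrier T"
      unfolding mod_span_def using all Sc p.N.carrier_is_submodule by blast
    then have "\<exists>S'. finite S' \<and> card S' = card S \<and> generates R T S'"
      using Sc by (intro exI[of _ S]) (simp add: generates_def S_def)
    then have "n \<le> card S" unfolding n_min min_num_gens_def by (rule Least_le)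
    also have "\<dots> \<le> card ({..<n} - {i})" unfolding S_def by (rule card_image_le) simp
    also have "\<dots> < n" using i by simp
    finally show False by simp
  qed
qed

text \<open>A unit coordinate would make a column redundant by \<open>unit_relation\<close>, against
  \<open>irredundant\<close>.\<close>

lemma kr_U_mF: "kr n n U \<subseteq> mF n"
proof
  fix v assume v: "v \<in> kr n n U"
  have "v j \<in> m" if j: "j < n" for j
  proof (rule ccontr)
    assume vj: "v j \<notin> m"
    let ?S = "mod_span R (free_mod R n) (mat_col n U ` ({..<n} - {j}))"
    have "im n n U \<subseteq> ?S" by (rule unit_relation[OF Uo v j vj])
    moreover have "?S \<subseteq> im n n U"
      unfolding mod_span_def using im_submodule[OF Uo] col_in_im[OF Uo] by blast
    ultimately have "?S = a_kernel (free_mod R n) T p" using ker_p by blast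
    then show False using irredundant[of "{..<n} - {j}"] j by blast
  qed
  then show "v \<in> mF n" using v by (auto simp: mF_def box_def kr_def)
qed

text \<open>Injectivity of the biduality map enters here. The columns of \<open>C\<close> generate
  the kernel of the transpose of \<open>U\<close>, that is, the dual of \<open>T\<close>. If the
  transpose of \<open>C\<close> kills v, then every functional on \<open>T\<close> kills p v, so p v
  = 0 and v lies in the image of \<open>U\<close>.\<close>

lemma left_syzygy: "\<exists>b D. mat_over R b n D \<and> dexact b n n D U"
proof -
  have Ut: "mat_over R n n (tr U)" using Uo by simp
  obtain b C where C: "mat_over R n b C" "im n b C = kr n n (tr U)"
    using exists_matrix[OF kr_submodule[OF Ut]] by blast
  have Ct: "mat_over R b n (tr C)" using C by simp
  have sub: "im n n U \<subseteq> kr b n (tr C)"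
    using im_subset_kr_tr[OF Ut C(1)] C(2) by simp
  have "kr b n (tr C) \<subseteq> im n n U"
  proof
    fix v assume "v \<in> kr b n (tr C)"
    then have v: "v \<in> carrier (free_mod R n)" "mv b n (tr C) v = \<zero>\<^bsub>free_mod R b\<^esub>" by (auto simp: kr_def)
    have zero: "\<phi> (p v) = \<zero>" if \<phi>: "\<phi> \<in> carrier (dual_mod R T)" for \<phi>
    proof -
      interpret \<phi>: linear_map R T "self_mod R" \<phi>
        using \<phi> by (intro linear_map.intro linear_map_axioms.intro T_module self_module) (simp add: dual_mod_carrier)
      have l: "linear_map R (free_mod R n) (self_mod R) (\<lambda>w. \<phi> (p w))"
        by (intro linear_map.intro linear_map_axioms.intro free_module self_module)
          (use \<phi>.closed in \<open>auto simp: mod_hom_def hom_def p.add p.smult \<phi>.add[simplified] \<phi>.smult[simplified]\<close>)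
      define y where "y = (\<lambda>j\<in>{..<n}. \<phi> (p (unit_vec n j)))"
      have y: "y \<in> carrier (free_mod R n)"
        unfolding y_def using linear_map.closed[OF l unit_vec_closed] by (intro free_restrict) simp
      have yd: "\<phi> (p w) = dot n y w" if "w \<in> carrier (free_mod R n)" for w
        unfolding y_def by (rule functional_eq_dot[OF l that])
      have "mv n n (tr U) y = \<zero>\<^bsub>free_mod R n\<^esub>"
      proof (rule mv_eq_zeroI[OF Ut y])
        fix i assume i: "i < n"
        have c: "mat_col n U i \<in> carrier (free_mod R n)" by (rule mat_col_closed[OF Uo i])
        have "dot n (tr U i) y = dot n (mat_col n U i) y"
          using mat_overD[OF Uo _ i] y by (intro dot_cong) (auto simp: tr_def mat_col_def free_nth)
        also have "\<dots> = dot n y (mat_col n U i)" using c y by (rule dot_comm_vec)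
        also have "\<dots> = \<phi> (p (mat_col n U i))" using yd[OF c] by simp
        also have "p (mat_col n U i) = \<zero>\<^bsub>T\<^esub>" using p_zero_iff[OF c] col_in_im[OF Uo i] by simp
        finally show "dot n (tr U i) y = \<zero>" using \<phi>.zero by simp
      qed
      then have "y \<in> im n b C" unfolding C(2) using y by (simp add: kr_def)
      then obtain c where c: "c \<in> carrier (free_mod R b)" "y = mv n b C c" by (auto simp: im_def)
      have "dot n y v = dot b c (mv b n (tr C) v)"
        using mv_adjoint[OF Ct c(1) v(1)] c(2) by simp
      also have "\<dots> = \<zero>" unfolding v(2)
        using c(1) by (intro dot_eq_zero) (auto simp: free_zero_nth free_nth)
      finally show ?thesis using yd[OF v(1)] by simp
    qed
    have "biduality R T (p v) = biduality R T \<zero>\<^bsub>T\<^esub>"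
      unfolding biduality_def
    proof (rule restrict_ext)
      fix \<phi> assume \<phi>: "\<phi> \<in> carrier (dual_mod R T)"
      interpret \<phi>: linear_map R T "self_mod R" \<phi>
        using \<phi> by (intro linear_map.intro linear_map_axioms.intro T_module self_module) (simp add: dual_mod_carrier)
      show "\<phi> (p v) = \<phi> \<zero>\<^bsub>T\<^esub>" using zero[OF \<phi>] \<phi>.zero by simp
    qed
    moreover have "inj_on (biduality R T) (carrier T)"
      using reflexive by (auto simp: totally_reflexive_def mod_iso_def bij_betw_def)
    ultimately have "p v = \<zero>\<^bsub>T\<^esub>" using v(1) by (auto dest!: inj_onD)
    then show "v \<in> im n n U" using p_zero_iff v by simp
  qed
  then have "dexact b n n (tr C) U" using sub Ct Uo C by (auto simp: dexact_def)
  then show ?thesis using Ct by blast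
qed

text \<open>The matrices from \<open>U\<close> on form a free resolution of \<open>T\<close>, and
  vanishing of Ext in degree i + 1 is exactness of the transposed sequence at the free module of
  rank \<open>\<beta> (i + 2)\<close>.\<close>

lemma ext_exact:
  assumes D1: "D 1 = U" "\<beta> 1 = n" "\<beta> 2 = n"
    and Do: "\<And>i. mat_over R (\<beta> (Suc i)) (\<beta> (Suc (Suc i))) (D (Suc i))"
    and ker: "\<And>i. kr (\<beta> (Suc i)) (\<beta> (Suc (Suc i))) (D (Suc i)) =
       im (\<beta> (Suc (Suc i))) (\<beta> (Suc (Suc (Suc i)))) (D (Suc (Suc i)))"
  shows "dexact (\<beta> (Suc i)) (\<beta> (Suc (Suc i))) (\<beta> (Suc (Suc (Suc i)))) (D (Suc i)) (D (Suc (Suc i)))"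
proof -
  \<comment> \<open>A resolution is indexed from 0, while index 0 of the sequence is reserved for
    the matrix to the left of \<open>U\<close>.\<close>
  define \<nu> where "\<nu> = (\<lambda>i. \<beta> (Suc i))"
  define d where "d = (\<lambda>i. mv (\<nu> i) (\<nu> (Suc i)) (D (Suc i)))"
  have o: "mat_over R (\<nu> i) (\<nu> (Suc i)) (D (Suc i))" for i using Do by (simp add: \<nu>_def)
  have \<nu>0: "\<nu> 0 = n" "\<nu> 1 = n" using D1 by (simp_all add: \<nu>_def numeral_2_eq_2)
  have "free_resolution R T \<nu> d p"
    unfolding free_resolution_def
  proof (intro conjI allI)
    show "p \<in> mod_hom R (free_mod R (\<nu> 0)) T" "p ` carrier (free_mod R (\<nu> 0)) = carrier T"
      using p_hom p_surj \<nu>0 by simp_all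
    show "a_kernel (free_mod R (\<nu> 0)) T p = d 0 ` carrier (free_mod R (\<nu> 1))"
      using ker_p \<nu>0 D1 by (simp add: d_def im_def)
    fix i
    show "d i \<in> mod_hom R (free_mod R (\<nu> (Suc i))) (free_mod R (\<nu> i))"
      unfolding d_def by (rule mv_mod_hom[OF o])
    show "a_kernel (free_mod R (\<nu> (Suc i))) (free_mod R (\<nu> i)) (d i) = d (Suc i) ` carrier (free_mod R (\<nu> (Suc (Suc i))))"
      unfolding d_def a_kernel_mv[OF o] using ker[of i] by (simp add: \<nu>_def im_def)
  qed
  then have Ext: "carrier (Hom_cohomology R \<nu> d (self_mod R) (Suc i)) = {\<zero>\<^bsub>Hom_cohomology R \<nu> d (self_mod R) (Suc i)\<^esub>}"
    using reflexive unfolding totally_reflexive_def Ext_vanishes_def by blast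
  let ?H = "dual_mod R (free_mod R (\<nu> (Suc i)))"
  define Z where "Z = dual_vec (\<nu> (Suc i)) ` kr (\<nu> (Suc (Suc i))) (\<nu> (Suc i)) (tr (D (Suc (Suc i))))"
  define B where "B = dual_vec (\<nu> (Suc i)) ` im (\<nu> (Suc i)) (\<nu> i) (tr (D (Suc i)))"
  have "Hom_cohomology R \<nu> d (self_mod R) (Suc i) = quot_mod (?H\<lparr>carrier := Z\<rparr>) B"
    unfolding Hom_cohomology_def Let_def Z_def B_def
    using dual_kernel[OF o[of "Suc i"]] dual_image[OF o[of i]]
    by (simp add: dual_mod_def d_def)
  then have Ext': "carrier (quot_mod (?H\<lparr>carrier := Z\<rparr>) B) = {\<zero>\<^bsub>quot_mod (?H\<lparr>carrier := Z\<rparr>) B\<^esub>}"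
    using Ext by simp
  have ot: "mat_over R (\<nu> (Suc i)) (\<nu> i) (tr (D (Suc i)))" "mat_over R (\<nu> (Suc (Suc i))) (\<nu> (Suc i)) (tr (D (Suc (Suc i))))"
    using o by simp_all
  have "kr (\<nu> (Suc (Suc i))) (\<nu> (Suc i)) (tr (D (Suc (Suc i)))) \<subseteq> im (\<nu> (Suc i)) (\<nu> i) (tr (D (Suc i)))"
  proof
    fix y assume y: "y \<in> kr (\<nu> (Suc (Suc i))) (\<nu> (Suc i)) (tr (D (Suc (Suc i))))"
    then have yc: "y \<in> carrier (free_mod R (\<nu> (Suc i)))" by (simp add: kr_def)
    define z where "z = dual_vec (\<nu> (Suc i)) y"
    have zH: "z \<in> carrier ?H" unfolding z_def by (rule dual_vec_closed[OF yc])
    have zZ: "z \<in> Z" using y by (simp add: z_def Z_def)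
    have "\<zero>\<^bsub>free_mod R (\<nu> (Suc i))\<^esub> \<in> im (\<nu> (Suc i)) (\<nu> i) (tr (D (Suc i)))"
      by (rule module.submodule_zero[OF free_module im_submodule[OF ot(1)]])
    then have zB: "\<zero>\<^bsub>?H\<^esub> \<in> B" unfolding B_def dual_vec_zero[symmetric] by blast
    have "z x \<in> carrier R" if "x \<in> carrier (free_mod R (\<nu> (Suc i)))" for x
      using that yc by (simp add: z_def dual_vec_def free_nth)
    then have "\<zero>\<^bsub>?H\<^esub> \<oplus>\<^bsub>?H\<^esub> z = z"
      using zH unfolding dual_mod_carrier dual_zero
      by (intro extensionalityI[of _ "carrier (free_mod R (\<nu> (Suc i)))"])
        (auto simp: dual_mod_def Hom_mod_def)
    then have "z \<in> B" by (rule coset_space_trivial[OF Ext' zZ zB])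
    then obtain y' where y': "y' \<in> im (\<nu> (Suc i)) (\<nu> i) (tr (D (Suc i)))" "dual_vec (\<nu> (Suc i)) y = dual_vec (\<nu> (Suc i)) y'"
      unfolding B_def z_def by blast
    have "y' \<in> carrier (free_mod R (\<nu> (Suc i)))" using im_closed[OF ot(1)] y'(1) by blast
    then have "y = y'" using dual_vec_inj[OF yc _ y'(2)] by blast
    then show "y \<in> im (\<nu> (Suc i)) (\<nu> i) (tr (D (Suc i)))" using y'(1) by simp
  qed
  moreover have "im (\<nu> (Suc i)) (\<nu> i) (tr (D (Suc i))) \<subseteq> kr (\<nu> (Suc (Suc i))) (\<nu> (Suc i)) (tr (D (Suc (Suc i))))"
    using im_subset_kr_tr[OF o[of i] o[of "Suc i"]] ker[of i] by (simp add: \<nu>_def)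
  ultimately show ?thesis using Do ker by (simp add: dexact_def \<nu>_def)
qed

text \<open>The matrix after \<open>U\<close> is prescribed, so that the result can be used first
  with any minimal syzygy and then again with a triangular one.\<close>

lemma exists_acyclic_seq:
  assumes nb: "\<not> baer" and n0: "0 < n"
    and V: "mat_over R n c V" "im n c V = kr n n U" "kr n c V \<subseteq> mF c"
  shows "\<exists>\<beta> D. acyclic_seq R m \<beta> D n \<and> D 1 = U \<and> D 2 = V \<and> \<beta> 3 = c"
proof -
  obtain b0 D0 where D0: "mat_over R b0 n D0" "dexact b0 n n D0 U" using left_syzygy by blast
  \<comment> \<open>A state consists of the numbers of rows and columns and the matrix; the clause
    for \<open>k = 0\<close> pins the recursion to \<open>V\<close>.\<close>
  let ?P = "\<lambda>k::nat. \<lambda>(a, b, A). mat_over R a b A \<and> kr a b A \<subseteq> mF b \<and> (k = 0 \<longrightarrow> a = n \<and> b = c \<and> A = V)"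
  let ?Q = "\<lambda>k::nat. \<lambda>(a, b, A) (a', b', A'). a' = b \<and> im a' b' A' = kr a b A"
  have start: "\<exists>t. ?P 0 t" using V by (intro exI[of _ "(n, c, V)"]) simp
  have nxt: "\<exists>t'. ?P (Suc k) t' \<and> ?Q k t t'" if t: "?P k t" for k t
  proof -
    obtain a b A where t': "t = (a, b, A)" by (cases t)
    have A: "mat_over R a b A" using t t' by simp
    obtain b' A' where "mat_over R b b' A'" "im b b' A' = kr a b A" "kr b b' A' \<subseteq> mF b'"
      using exists_minimal_matrix[OF kr_submodule[OF A]] by blast
    then show ?thesis using t' by (intro exI[of _ "(b, b', A')"]) simp
  qed
  have "\<exists>f. \<forall>k. ?P k (f k) \<and> ?Q k (f k) (f (Suc k))"
    by (rule dependent_nat_choice[OF start nxt])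
  then obtain f where f': "\<forall>k. ?P k (f k) \<and> ?Q k (f k) (f (Suc k))" by (elim exE)
  have f: "?P k (f k)" "?Q k (f k) (f (Suc k))" for k
    using spec[OF f', of k] by (rule conjunct1, rule conjunct2)
  define \<alpha> where "\<alpha> = (\<lambda>k. fst (f k))"
  define E where "E = (\<lambda>k. snd (snd (f k)))"
  have snd_f: "fst (snd (f k)) = \<alpha> (Suc k)" for k
    using f(2)[of k] by (simp add: \<alpha>_def case_prod_unfold)
  have Eo: "mat_over R (\<alpha> k) (\<alpha> (Suc k)) (E k)" "kr (\<alpha> k) (\<alpha> (Suc k)) (E k) \<subseteq> mF (\<alpha> (Suc k))" for k
    using f(1)[of k] snd_f[of k] by (simp_all add: \<alpha>_def E_def case_prod_unfold)
  have Ek: "kr (\<alpha> k) (\<alpha> (Suc k)) (E k) = im (\<alpha> (Suc k)) (\<alpha> (Suc (Suc k))) (E (Suc k))" for k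
    using f(2)[of k] snd_f[of k] snd_f[of "Suc k"] by (simp add: \<alpha>_def E_def case_prod_unfold)
  have E0: "E 0 = V" "\<alpha> 0 = n" "\<alpha> (Suc 0) = c"
    using f(1)[of 0] snd_f[of 0] by (simp_all add: \<alpha>_def E_def case_prod_unfold)
  define \<beta> where "\<beta> = (\<lambda>i. case i of 0 \<Rightarrow> b0 | Suc 0 \<Rightarrow> n | Suc (Suc k) \<Rightarrow> \<alpha> k)"
  define D where "D = (\<lambda>i. case i of 0 \<Rightarrow> D0 | Suc 0 \<Rightarrow> U | Suc (Suc k) \<Rightarrow> E k)"
  have \<beta>: "\<beta> 0 = b0" "\<beta> (Suc 0) = n" "\<beta> (Suc (Suc k)) = \<alpha> k" for k by (simp_all add: \<beta>_def)
  have D: "D 0 = D0" "D (Suc 0) = U" "D (Suc (Suc k)) = E k" for k by (simp_all add: D_def)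
  have Do: "mat_over R (\<beta> (Suc i)) (\<beta> (Suc (Suc i))) (D (Suc i))" for i
    using Uo Eo E0 by (cases i) (simp_all add: \<beta> D)
  have ker: "kr (\<beta> (Suc i)) (\<beta> (Suc (Suc i))) (D (Suc i)) = im (\<beta> (Suc (Suc i))) (\<beta> (Suc (Suc (Suc i)))) (D (Suc (Suc i)))" for i
    using V(2) E0 Ek by (cases i) (simp_all add: \<beta> D)
  have small: "kr (\<beta> (Suc i)) (\<beta> (Suc (Suc i))) (D (Suc i)) \<subseteq> mF (\<beta> (Suc (Suc i)))" for i
    using kr_U_mF E0 Eo by (cases i) (simp_all add: \<beta> D)
  have dex: "dexact (\<beta> i) (\<beta> (Suc i)) (\<beta> (Suc (Suc i))) (D i) (D (Suc i))" for i
  proof (cases i)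
    case 0
    then show ?thesis using D0(2) E0 by (simp add: \<beta> D)
  next
    case (Suc k)
    show ?thesis unfolding Suc
      by (rule ext_exact[where D = D and \<beta> = \<beta>, OF _ _ _ Do ker]) (simp_all add: \<beta> D E0 numeral_2_eq_2)
  qed
  have Dm: "mat_m (\<beta> (Suc i)) (\<beta> (Suc (Suc i))) (D (Suc i))" for i
  proof (cases i)
    case 0
    then show ?thesis using U_m E0 by (simp add: \<beta> D)
  next
    case (Suc k)
    show ?thesis using small[of k] ker[of k] im_subset_mF_iff[OF Do[of "Suc k"]] unfolding Suc by simp
  qed
  have "acyclic_seq R m \<beta> D n"
    by unfold_locales (use nb dex Dm n0 in \<open>simp_all add: \<beta> E0 numeral_2_eq_2\<close>)
  then show ?thesis
    by (intro exI[of _ \<beta>] exI[of _ D]) (simp add: \<beta> D E0 numeral_2_eq_2 numeral_3_eq_3)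
qed

end

section \<open>From the presentation matrix to dual pairs and the resolution\<close>

lemma (in acyclic_seq) triangular_pairI:
  assumes "\<And>i j. i < n \<Longrightarrow> j < i \<Longrightarrow> D k i j = \<zero>" and "k = 1 \<or> k = 2"
  shows "triangular_pair R m n (D k) (D (Suc k))"
proof -
  have \<beta>: "\<beta> (Suc 0) = n" "\<beta> (Suc (Suc 0)) = n" "\<beta> (Suc (Suc (Suc 0))) = n" "\<beta> (Suc (Suc (Suc (Suc 0)))) = n"
    using n betti by (simp_all add: numeral_eq_Suc)
  have "dexact n n n (D 1) (D 2)" "dexact n n n (D 2) (D 3)"
    using dex[of 1] dex[of 2] \<beta> by (simp_all add: numeral_2_eq_2 numeral_3_eq_3)
  moreover have "mat_m n n (D 1)" "mat_m n n (D 2)" "mat_m n n (D 3)"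
    using Dm[of 0] Dm[of 1] Dm[of 2] \<beta> by (simp_all add: numeral_2_eq_2 numeral_3_eq_3)
  ultimately have "mat_m n n (D k)" "mat_m n n (D (Suc k))" "dexact n n n (D k) (D (Suc k))"
    "lenF n (kr n n (D k)) = n * embdim" "lenF n (kr n n (tr (D k))) = n * embdim"
    using assms(2) len_kernels by (auto simp: numeral_2_eq_2 numeral_3_eq_3)
  then show ?thesis
    using assms(1) betti(1) socdim_ge_2
    by (intro triangular_pair.intro triangular_pair_axioms.intro short_local_axioms)
qed

lemma (in acyclic_seq) image_D2: "mv n n (D 2) ` mF n = m2F n"
  using image_mF[OF not_baer dex dex dex Dm[of 0] Dm Dm] n betti
  by (simp add: numeral_eq_Suc)

text \<open>Two sequences through \<open>U\<close> are used. The first, with an arbitrary minimal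
  syzygy, shows that this syzygy has \<open>n\<close> columns and yields a triangular replacement
  \<open>V'\<close>. The second contains \<open>V'\<close> itself, so that the triangular argument
  applies to it as well. The products of diagonal entries vanish because U V' = 0 and both factors
  are triangular.\<close>

lemma (in presented) dual_pairs:
  assumes nb: "\<not> baer" and n0: "0 < n" and tri: "\<And>i j. i < n \<Longrightarrow> j < i \<Longrightarrow> U i j = \<zero>"
  shows "embdim = 1 + socdim \<and> (\<exists>b. \<forall>i<n. dual_pair (U i i) (b i))"
proof -
  obtain c V where V: "mat_over R n c V" "im n c V = kr n n U" "kr n c V \<subseteq> mF c"
    and min: "\<And>b' V'. mat_over R n b' V' \<Longrightarrow> im n b' V' = kr n n U \<Longrightarrow> c \<le> b'"
    using exists_minimal_matrix[OF kr_submodule[OF Uo]] by blast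
  obtain \<beta> D where s: "acyclic_seq R m \<beta> D n" and D: "D 1 = U" "D 2 = V" "\<beta> 3 = c"
    using exists_acyclic_seq[OF nb n0 V] by blast
  interpret s: acyclic_seq R m \<beta> D n by (rule s)
  have c: "c = n" using s.betti(2) D(3) by simp
  have "triangular_pair R m n U V"
    using s.triangular_pairI[of 1] tri D by (simp add: numeral_2_eq_2)
  then interpret U: triangular_pair R m n U V .
  have "mv n n V ` mF n = m2F n" using s.image_D2 D(2) by simp
  then obtain V' where V': "mat_m n n V'" "\<forall>i<n. \<forall>j<i. V' i j = \<zero>" "im n n V' = kr n n U"
    using U.triangular_syzygy by blast
  have V'o: "mat_over R n n V'" using V'(1) mat_m_over by blast
  \<comment> \<open>\<open>V'\<close> has \<open>n\<close> columns, as many as the minimal matrix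
    \<open>V\<close> with the same image, so it is minimal too.\<close>
  have V'k: "kr n n V' \<subseteq> mF n"
    by (rule minimal_kr_subset_mF[OF V'o]) (use min V'(3) c in auto)
  obtain \<beta>' D' where s': "acyclic_seq R m \<beta>' D' n" and D': "D' 1 = U" "D' 2 = V'" "\<beta>' 3 = n"
    using exists_acyclic_seq[OF nb n0 V'o V'(3) V'k] by blast
  interpret s': acyclic_seq R m \<beta>' D' n by (rule s')
  have "triangular_pair R m n V' (D' (Suc 2))"
    using s'.triangular_pairI[of 2] V'(2) D' by simp
  then interpret V: triangular_pair R m n V' "D' (Suc 2)" .
  have zero: "mat_mul n U V' i j = \<zero>" if "i < n" "j < n" for i j
    using im_subset_kr_iff[OF Uo V'o] V'(3) that by simp
  have "dual_pair (U i i) (V' i i)" if i: "i < n" for i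
  proof -
    have m: "U i i \<in> m" "V' i i \<in> m" using U_m V'(1) i by (auto simp: mat_m_def)
    have "U i k \<otimes> V' k i = \<zero>" if k: "k < n" "k \<noteq> i" for k
    proof (cases "k < i")
      case True
      then show ?thesis using tri[OF i] mat_overD[OF V'o k(1) i] by simp
    next
      case False
      then show ?thesis using V'(2) k mat_overD[OF Uo i k(1)] by simp
    qed
    then have "mat_mul n U V' i i = U i i \<otimes> V' i i"
      unfolding mat_mul_def using i mat_overD[OF Uo i] mat_overD[OF V'o _ i] by (intro dot_one_term) auto
    then have "U i i \<otimes> V' i i = \<zero>" using zero[OF i i] by simp
    then show ?thesis
      unfolding dual_pair_def using m U.diag_mult[OF i] V.diag_mult[OF i] by blast
  qed
  then show ?thesis using s.betti(1) by (intro conjI exI[of _ "\<lambda>i. V' i i"]) simp_all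
qed

theorem corollary13:
  fixes R :: "('a, 'r) ring_scheme" (structure)
    and m :: "'a set"
    and T :: "('a, 'b, 't) module_scheme"
  assumes "noetherian_local_ring R m"
    and "\<not> gorenstein R"
    and "m \<cdot> m \<cdot> m = {\<zero>}"
    and "m \<cdot> m \<noteq> {\<zero>}"
    and "\<exists>a. exact_zero_divisor R a"
    and "totally_reflexive R T"
    and "has_upper_triangular_min_pres R T"
  shows "\<exists>(A :: int \<Rightarrow> ('a, nat \<Rightarrow> 'a) module) d.
           complete_resolution R T A d \<and> minimal_complex R m A d \<and> upper_triangular_complex R A d"
proof -
  have "cring R" "noetherian_ring R" "maximalideal m R"
    using assms(1) by (simp_all add: noetherian_local_ring_def)
  then interpret short_local R m
    using assms(3,4) by (intro short_local.intro short_local_axioms.intro)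
  have nb: "\<not> baer" using baer_imp_gorenstein assms(2) by blast
  obtain n U where pres: "minimal_presentation_matrix R T n n U" and ut: "upper_triangular_mat R n U"
    using assms(7) unfolding has_upper_triangular_min_pres_def by blast
  obtain p where p: "p \<in> mod_hom R (free_mod R n) T" "p ` carrier (free_mod R n) = carrier T"
    "mod_span R (free_mod R n) (mat_col n U ` {..<n}) = a_kernel (free_mod R n) T p"
    "\<And>J. J \<subset> {..<n} \<Longrightarrow> mod_span R (free_mod R n) (mat_col n U ` J) \<noteq> a_kernel (free_mod R n) T p"
    using conjunct2[OF conjunct2[OF pres[unfolded minimal_presentation_matrix_def]]] by (elim conjE bexE) simp
  have "n = min_num_gens R T" "mat_over R n n U"
    using conjunct1[OF pres[unfolded minimal_presentation_matrix_def]]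
      conjunct1[OF conjunct2[OF pres[unfolded minimal_presentation_matrix_def]]] .
  then interpret presented R m T n U p
    using assms(6) p by (intro presented.intro presented_axioms.intro short_local_axioms)
  have tri: "U i j = \<zero>" if "i < n" "j < i" for i j using ut that by (simp add: upper_triangular_mat_def)
  \<comment> \<open>For \<open>n = 0\<close> both claims are vacuous, and the complex below is the
    zero complex.\<close>
  obtain b where b: "\<And>i. i < n \<Longrightarrow> dual_pair (U i i) (b i)" and e: "0 < n \<Longrightarrow> embdim = 1 + socdim"
    using dual_pairs[OF nb _ tri] by (cases "0 < n") auto
  have "triangular_diag n (\<lambda>i. U i i) U" using U_m tri by (simp add: triangular_diag_def)
  then obtain D :: "int \<Rightarrow> nat \<Rightarrow> nat \<Rightarrow> 'a" where D1: "D 1 = U"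
    and D: "\<forall>i. mat_m n n (D i) \<and> (\<forall>k<n. \<forall>l<k. D i k l = \<zero>) \<and> dexact n n n (D i) (D (i + 1))"
    using biinfinite_triangular[of n "\<lambda>i. U i i" U b] b e by blast
  interpret C: matrix_complex R m n D 
    using D by (intro matrix_complex.intro matrix_complex_axioms.intro short_local_axioms) blast+
  have "complete_resolution R T C.terms C.diffs"
    by (rule C.complete_resolution[OF T_module p(1,2)]) (simp add: ker_p D1)
  then show ?thesis using C.minimal C.upper_triangular by blast
qed

end
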